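(* Let $d\ge2$ and let $\Lambda$ be a full rank lattice in $\mathbb{R}^d$ of covolume $1$, with dual lattice $\Lambda^\ast$. If any of the exponents $\Omega_1(\Lambda),\dots,\Omega_{d-1}(\Lambda),\Omega_1(\Lambda^\ast),\dots,\Omega_{d-1}(\Lambda^\ast)$ is zero, then so are all the others. If they are nonzero, then \[ \frac{1+\Omega_1(\Lambda)^{-1}}{d-1}\le\dots\le\frac{k}{d-k}\big(1+\Omega_k(\Lambda)^{-1}\big)\le\dots\le(d-1)\big(1+\Omega_{d-1}(\Lambda)^{-1}\big) \] and $\Omega_{d-1}(\Lambda)=\Omega_1(\Lambda^\ast)$.
   Context: $\Lambda^\ast=\{\mathbf w\in\mathbb{R}^d:\langle\mathbf w,\mathbf z\rangle\in\mathbb{Z}\ \forall\mathbf z\in\Lambda\}$. $|\cdot|$ is the supremum norm; $\Pi(\mathbf v)=\prod_{i=1}^d|v_i|^{1/d}$; $|\mathbf v|^{[k]}=\max_{1\le i_1<\dots<i_k\le d}\prod_{j=1}^k|v_{i_j}|^{1/k}$. Elements of $\bigwedge^k(\mathbb{R}^d)$ are written $\mathbf Z=(Z_{i_1,\dots,i_k})$ (coordinates in the basis $\mathbf e_{i_1}\wedge\dots\wedge\mathbf e_{i_k}$, $i_1<\dots<i_k$); $\bigwedge^k(\Lambda)$ is the lattice generated by all $\mathbf z_1\wedge\dots\wedge\mathbf z_k$ with $\mathbf z_i\in\Lambda$. For $\mathbf v\in\mathbb{R}^d$ let $\mathcal P^{[k]}(\mathbf v)=\{\mathbf Z: |Z_{i_1,\dots,i_k}|\le\prod_{j=1}^k|v_{i_j}|\}$.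 The $k$-th Diophantine exponent of the second type $\Omega_k(\Lambda)$ is the supremum of real $\gamma$ such that $\mathcal P^{[k]}(\mathbf v)$ contains a nonzero element of $\bigwedge^k(\Lambda)$ for some $\mathbf v\in\mathbb{R}_{>0}^d$ satisfying $\Pi(\mathbf v)=(|\mathbf v|^{[k]})^{-\gamma}$ with $|\mathbf v|$ arbitrarily large. *)

theory Defs
  imports "HOL-Analysis.Analysis" "HOL-Computational_Algebra.Group_Closure"
begin

text \<open>
  \<open>\<real>\<^sup>d\<close> is \<^typ>\<open>real ^ 'n\<close> with \<open>d = CARD('n)\<close>; the coordinates are linearly ordered so that
  \<open>i\<^sub>1 < \<dots> < i\<^sub>k\<close> makes sense.
\<close>

definition lattice_basis :: "real ^ 'n ^ 'n \<Rightarrow> (real ^ 'n) set \<Rightarrow> bool" where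
  "lattice_basis A \<Lambda> \<longleftrightarrow>
     invertible A \<and> \<Lambda> = range (\<lambda>m :: int ^ 'n. A *v (\<chi> i. real_of_int (m $ i)))"

definition full_rank_lattice :: "(real ^ 'n) set \<Rightarrow> bool" where
  "full_rank_lattice \<Lambda> \<longleftrightarrow> (\<exists>A. lattice_basis A \<Lambda>)"

definition covolume :: "(real ^ 'n) set \<Rightarrow> real" where
  "covolume \<Lambda> = \<bar>det (SOME A. lattice_basis A \<Lambda>)\<bar>"

lemma lattice_basis_change:
  fixes A B :: "real ^ 'n ^ 'n"
  assumes "lattice_basis A \<Lambda>" and "lattice_basis B \<Lambda>"
  shows "\<exists>c\<in>\<int>. det A = det B * c"
proof -
  have "\<exists>m :: int ^ 'n. column i A = B *v (\<chi> j. real_of_int (m $ j))" for i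
  proof -
    have "A *v (\<chi> j. real_of_int ((axis i 1 :: int ^ 'n) $ j)) \<in> \<Lambda>"
      using assms(1) by (auto simp: lattice_basis_def)
    moreover have "(\<chi> j. real_of_int ((axis i 1 :: int ^ 'n) $ j)) = axis i 1"
      by (auto simp: vec_eq_iff axis_def)
    ultimately have "column i A \<in> \<Lambda>"
      by (simp add: matrix_vector_mult_basis)
    then show ?thesis
      using assms(2) by (auto simp: lattice_basis_def)
  qed
  then obtain m :: "'n \<Rightarrow> int ^ 'n"
    where m: "\<And>i. column i A = B *v (\<chi> j. real_of_int (m i $ j))"
    by metis
  define M :: "real ^ 'n ^ 'n" where "M = (\<chi> j i. real_of_int (m i $ j))"
  have "A $ j $ i = (B ** M) $ j $ i" for i j
    using m[of i] by (simp add: vec_eq_iff column_def matrix_matrix_mult_def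
        matrix_vector_mult_def M_def)
  then have "A = B ** M"
    by (simp add: vec_eq_iff)
  moreover have "det M \<in> \<int>"
    unfolding det_def M_def by (auto intro!: Ints_sum Ints_mult Ints_prod)
  ultimately show ?thesis
    by (auto simp: det_mul)
qed

lemma covolume_eq:
  assumes "lattice_basis A \<Lambda>"
  shows "covolume \<Lambda> = \<bar>det A\<bar>"
proof -
  define B where "B = (SOME A. lattice_basis A \<Lambda>)"
  have B: "lattice_basis B \<Lambda>"
    unfolding B_def using assms by (rule someI)
  obtain c where c: "c \<in> \<int>" "det A = det B * c"
    using lattice_basis_change[OF assms B] by blast
  obtain c' where c': "c' \<in> \<int>" "det B = det A * c'"
    using lattice_basis_change[OF B assms] by blast
  have "det A \<noteq> 0"
    using assms by (simp add: lattice_basis_def invertible_det_nz)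
  then have one: "c' * c = 1"
    by (metis c(2) c'(2) mult.assoc mult.right_neutral mult_left_cancel)
  obtain a a' where "c = of_int a" "c' = of_int a'"
    using c(1) c'(1) by (auto elim!: Ints_cases)
  then have "a' * a = 1"
    using one by (simp flip: of_int_mult)
  then have "\<bar>a\<bar> = 1"
    using zmult_eq_1_iff by force
  then have "\<bar>c\<bar> = 1"
    using \<open>c = of_int a\<close> by linarith
  then show ?thesis
    by (simp add: covolume_def flip: B_def) (simp add: c(2) abs_mult)
qed

definition dual_lattice :: "(real ^ 'n) set \<Rightarrow> (real ^ 'n) set" where
  "dual_lattice \<Lambda> = {w. \<forall>z\<in>\<Lambda>. w \<bullet> z \<in> \<int>}"

definition geo_mean :: "real ^ 'n \<Rightarrow> real" where
  "geo_mean v = (\<Prod>i\<in>UNIV. \<bar>v $ i\<bar> powr (1 / real CARD('n)))"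

definition max_geo_mean :: "nat \<Rightarrow> real ^ 'n \<Rightarrow> real" where
  "max_geo_mean k v = Max ((\<lambda>I. \<Prod>i\<in>I. \<bar>v $ i\<bar> powr (1 / real k)) ` {I. card I = k})"

text \<open>
  \<^typ>\<open>real ^ ('n set)\<close> is the whole exterior algebra of \<^typ>\<open>real ^ 'n\<close>: the coordinate at
  \<open>I = {i\<^sub>1 < \<dots> < i\<^sub>k}\<close> belongs to the basis element \<open>e\<^bsub>i\<^sub>1\<^esub> \<and> \<dots> \<and> e\<^bsub>i\<^sub>k\<^esub>\<close>.
\<close>

definition exterior_power :: "nat \<Rightarrow> (real ^ ('n::{finite,linorder} set)) set" where
  "exterior_power k = {Z. \<forall>I. card I \<noteq> k \<longrightarrow> Z $ I = 0}"

text \<open>The coordinates of \<open>z\<^sub>1 \<and> \<dots> \<and> z\<^sub>k\<close> are the \<open>k \<times> k\<close> minors, by the Leibniz formula.\<close>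

definition wedge :: "(real ^ 'n::{finite,linorder}) list \<Rightarrow> real ^ ('n set)" where
  "wedge zs = (\<chi> I. if card I = length zs
     then \<Sum>p | p permutes {..<length zs}.
            of_int (sign p) * (\<Prod>j<length zs. (zs ! p j) $ (sorted_list_of_set I ! j))
     else 0)"

definition exterior_lattice ::
    "nat \<Rightarrow> (real ^ 'n::{finite,linorder}) set \<Rightarrow> (real ^ ('n set)) set" where
  "exterior_lattice k \<Lambda> = group_closure {wedge zs | zs. length zs = k \<and> set zs \<subseteq> \<Lambda>}"

definition parallelepiped ::
    "nat \<Rightarrow> real ^ 'n::{finite,linorder} \<Rightarrow> (real ^ ('n set)) set" where
  "parallelepiped k v =
     {Z \<in> exterior_power k. \<forall>I. card I = k \<longrightarrow> \<bar>Z $ I\<bar> \<le> (\<Prod>i\<in>I. \<bar>v $ i\<bar>)}"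

text \<open>The exponent may be infinite, hence the supremum is taken in the extended reals.\<close>

definition Omega_exponent :: "nat \<Rightarrow> (real ^ 'n::{finite,linorder}) set \<Rightarrow> ereal" where
  "Omega_exponent k \<Lambda> = Sup (ereal ` {\<gamma>. \<forall>T. \<exists>v. (\<forall>i. v $ i > 0) \<and> infnorm v > T \<and>
     geo_mean v = max_geo_mean k v powr (- \<gamma>) \<and>
     (\<exists>Z \<in> exterior_lattice k \<Lambda>. Z \<noteq> 0 \<and> Z \<in> parallelepiped k v)})"

end

theory Submission
  imports Defs
begin

text \<open>
  For \<open>v\<close> with positive coordinates, a Hermite-reduced basis of \<open>diag(1/v) \<Lambda>\<close> has vectors of norms
  \<open>n\<^sub>j\<close> whose product is comparable to the covolume \<open>1 / \<Prod>v\<close>. Pairing with wedges of the dual basis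
  shows that, up to constants independent of \<open>v\<close>, the parallelepiped of order \<open>k\<close> attached to \<open>v\<close>
  contains a nonzero point of the \<open>k\<close>-th exterior lattice iff some \<open>k\<close> of the \<open>n\<^sub>j\<close> have product
  at most \<open>1\<close>. Dropping the largest factor passes from \<open>k + 1\<close> to \<open>k\<close> with the same \<open>v\<close>, and comparing
  the order \<open>k\<close> and order \<open>k + 1\<close> maximal means of \<open>v\<close> turns this into the stated inequality.
  Adding the smallest remaining factor, at the price of enlarging \<open>v\<close>, passes from \<open>k\<close> to \<open>k + 1\<close> and
  preserves positivity. For \<open>k = d - 1\<close>, omitting one \<open>n\<^sub>j\<close> corresponds to the dual basis vector of
  index \<open>j\<close>, which links \<open>\<Lambda>\<close> with \<open>\<Lambda>\<^sup>*\<close>. All constants disappear in the exponents because the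
  maximal mean of \<open>v\<close> tends to infinity.
\<close>

subsection \<open>Minors and pairings in the exterior algebra\<close>

text \<open>The basis must serve two opposite purposes. Producing points needs basis vectors with
  small coordinates; excluding points needs dual vectors of size about \<open>1 / n j\<close>. By
  Cramer's rule a dual vector is bounded by the product of the other norms over the determinant, so
  both hold at once only for a basis whose orthogonality defect is bounded, whence Hermite
  reduction. Exclusion works because a nonzero pairing of lattice and dual wedges is a nonzero
  integer, hence at least 1 in absolute value.

  The obstacle in the exponents is that dilating \<open>v\<close> by a bounded factor destroys the
  exact relation between \<open>geo_mean\<close> and \<open>max_geo_mean\<close>. A test value
  \<open>\<delta>\<close> strictly below an admissible \<open>\<gamma>\<close> leaves room
  proportional to \<open>ln (max_geo_mean k v)\<close>, which pays for the dilation once that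
  logarithm is large; \<open>ln_coordinate_le\<close> derives this from a large
  \<open>infnorm\<close>. Exponents are therefore compared through positive test values, and their
  nonnegativity needs its own argument of Minkowski type. The fractions \<open>k / (d - k)\<close>
  originate in \<open>max_geo_mean_le_succ\<close>.\<close>

definition leibniz_det :: "nat \<Rightarrow> (nat \<Rightarrow> nat \<Rightarrow> real) \<Rightarrow> real" where
  "leibniz_det k M = (\<Sum>p | p permutes {..<k}. of_int (sign p) * (\<Prod>j<k. M (p j) j))"

lemma leibniz_det_cong:
  assumes "\<And>i j. i < k \<Longrightarrow> j < k \<Longrightarrow> M i j = N i j"
  shows "leibniz_det k M = leibniz_det k N"
  unfolding leibniz_det_def
proof (rule sum.cong)
  fix p assume "p \<in> {p. p permutes {..<k}}"
  then have "p j < k" if "j < k" for j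
    using that permutes_in_image[of p "{..<k}" j] by simp
  then show "of_int (sign p) * (\<Prod>j<k. M (p j) j) = of_int (sign p) * (\<Prod>j<k. N (p j) j)"
    using assms by simp
qed simp

lemma leibniz_det_permute_columns:
  assumes q: "q permutes {..<k}"
  shows "leibniz_det k (\<lambda>i j. M i (q j)) = of_int (sign q) * leibniz_det k M"
proof -
  have fin: "finite {..<k}" by simp
  have "leibniz_det k (\<lambda>i j. M i (q j)) =
      (\<Sum>p | p permutes {..<k}. of_int (sign (p \<circ> q)) * (\<Prod>j<k. M ((p \<circ> q) j) (q j)))"
    unfolding leibniz_det_def by (rule sum_permutations_compose_right[OF q])
  also have "\<dots> = (\<Sum>p | p permutes {..<k}. of_int (sign q) * (of_int (sign p) * (\<Prod>j<k. M (p j) j)))"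
  proof (rule sum.cong)
    fix p assume "p \<in> {p. p permutes {..<k}}"
    then have p: "p permutes {..<k}" by simp
    have "(\<Prod>j<k. M (p (q j)) (q j)) = (\<Prod>j<k. M (p j) j)"
      using prod.permute[OF q, of "\<lambda>j. M (p j) j"] by (simp add: o_def)
    moreover have "sign (p \<circ> q) = sign p * sign q"
      using p q fin by (simp add: sign_compose permutation_permutes exI[of _ "{..<k}"]
          permutes_imp_permutation[OF fin])
    ultimately show "of_int (sign (p \<circ> q)) * (\<Prod>j<k. M ((p \<circ> q) j) (q j)) =
        of_int (sign q) * (of_int (sign p) * (\<Prod>j<k. M (p j) j))" by simp
  qed simp
  finally show ?thesis
    by (simp add: leibniz_det_def sum_distrib_left)
qed

lemma leibniz_det_transpose:
  "leibniz_det k (\<lambda>i j. M j i) = leibniz_det k M"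
proof -
  have "leibniz_det k (\<lambda>i j. M j i) =
     (\<Sum>p | p permutes {..<k}. of_int (sign (inv p)) * (\<Prod>j<k. M j (inv p j)))"
    unfolding leibniz_det_def by (rule sum_permutations_inverse)
  also have "\<dots> = leibniz_det k M"
    unfolding leibniz_det_def
  proof (rule sum.cong)
    fix p assume "p \<in> {p. p permutes {..<k}}"
    then have p: "p permutes {..<k}" by simp
    have "(\<Prod>j<k. M j (inv p j)) = (\<Prod>j<k. M (p j) j)"
      using prod.permute[OF p, of "\<lambda>j. M j (inv p j)"] p
      by (simp add: o_def permutes_inverses)
    moreover have "sign (inv p) = sign p"
      using p by (intro sign_inverse permutes_imp_permutation[of "{..<k}"]) auto
    ultimately show "of_int (sign (inv p)) * (\<Prod>j<k. M j (inv p j)) =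
        of_int (sign p) * (\<Prod>j<k. M (p j) j)" by simp
  qed simp
  finally show ?thesis .
qed

lemma leibniz_det_equal_columns:
  assumes "a < k" "b < k" "a \<noteq> b" "\<And>i. M i a = M i b"
  shows "leibniz_det k M = 0"
proof -
  let ?q = "Transposition.transpose a b"
  have q: "?q permutes {..<k}" using assms by (intro permutes_swap_id) auto
  have "leibniz_det k (\<lambda>i j. M i (?q j)) = - leibniz_det k M"
    using leibniz_det_permute_columns[OF q, of M] assms by (simp add: sign_swap_id)
  moreover have "M i (?q j) = M i j" for i j
    using assms(4) by (simp add: Transposition.transpose_def)
  ultimately show ?thesis by simp
qed

lemma wedge_nth:
  "wedge zs $ I = (if card I = length zs
     then leibniz_det (length zs) (\<lambda>i j. zs ! i $ (sorted_list_of_set I ! j)) else 0)"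
  by (simp add: wedge_def leibniz_det_def)

lemma wedge_not_distinct:
  assumes "\<not> distinct zs" shows "wedge zs = 0"
proof -
  obtain a b where "a < length zs" "b < length zs" "a \<noteq> b" "zs ! a = zs ! b"
    using assms by (auto simp: distinct_conv_nth)
  then have "leibniz_det (length zs) (\<lambda>i j. zs ! i $ (sorted_list_of_set I ! j)) = 0" for I
    by (subst leibniz_det_transpose[symmetric], intro leibniz_det_equal_columns[of a _ b]) auto
  then show ?thesis by (simp add: vec_eq_iff wedge_nth)
qed

lemma wedge_in_exterior_power: "wedge zs \<in> exterior_power (length zs)"
  by (simp add: exterior_power_def wedge_nth)

section \<open>Cauchy-Binet formula and multilinearity\<close>

text \<open>An injection of \<open>{..<k}\<close> into the coordinates is determined by its image
  \<open>I\<close> and by the permutation relating it to the increasing enumeration of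
  \<open>I\<close>. This regroups a sum over injections into a sum over minors. The restriction
  makes the functions extensional, so that the correspondence is one to one.\<close>

lemma inj_functions_reindex:
  fixes k :: nat
  shows "bij_betw (\<lambda>(I, q). restrict (\<lambda>j. sorted_list_of_set I ! q j) {..<k})
     ({I :: 'n::{finite,linorder} set. card I = k} \<times> {q. q permutes {..<k}})
     {f \<in> {..<k} \<rightarrow>\<^sub>E UNIV. inj_on f {..<k}}"
proof (rule bij_betwI')
  have img: "(\<lambda>j. sorted_list_of_set I ! q j) ` {..<k} = I"
    if "card I = k" "q permutes {..<k}" for I :: "'n set" and q
  proof -
    have "(\<lambda>j. sorted_list_of_set I ! q j) ` {..<k} = (\<lambda>j. sorted_list_of_set I ! j) ` q ` {..<k}"
      by (simp add: image_image)
    also have "\<dots> = set (sorted_list_of_set I)"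
      using permutes_image[OF that(2)] that(1)
      by (auto simp: set_conv_nth)
    finally show ?thesis by simp
  qed
  fix x y assume x: "x \<in> {I :: 'n set. card I = k} \<times> {q. q permutes {..<k}}"
    and y: "y \<in> {I :: 'n set. card I = k} \<times> {q. q permutes {..<k}}"
  obtain I q I' q' where xy: "x = (I, q)" "y = (I', q')" by (cases x, cases y)
  have I: "card I = k" "q permutes {..<k}" "card I' = k" "q' permutes {..<k}" using x y xy by auto
  show "((case x of (I, q) \<Rightarrow> restrict (\<lambda>j. sorted_list_of_set I ! q j) {..<k}) =
      (case y of (I, q) \<Rightarrow> restrict (\<lambda>j. sorted_list_of_set I ! q j) {..<k})) = (x = y)"
  proof
    assume eq: "(case x of (I, q) \<Rightarrow> restrict (\<lambda>j. sorted_list_of_set I ! q j) {..<k}) =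
      (case y of (I, q) \<Rightarrow> restrict (\<lambda>j. sorted_list_of_set I ! q j) {..<k})"
    have e: "sorted_list_of_set I ! q j = sorted_list_of_set I' ! q' j" if "j < k" for j
      using fun_cong[OF eq, of j] that xy by simp
    have "I = I'"
      using img[OF I(1,2)] img[OF I(3,4)] e by (metis (no_types, lifting) image_cong lessThan_iff)
    moreover have "q j = q' j" for j
    proof (cases "j < k")
      case True
      then have "q j < k" "q' j < k"
        using permutes_in_image[OF I(2), of j] permutes_in_image[OF I(4), of j] by auto
      then show ?thesis
        using e[OF True] \<open>I = I'\<close> I nth_eq_iff_index_eq[of "sorted_list_of_set I" "q j" "q' j"]
        by simp
    next
      case False
      then show ?thesis using I by (simp add: permutes_def)
    qed
    ultimately show "x = y" using xy by auto
  qed simp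
  have "inj_on (\<lambda>j. sorted_list_of_set I ! q j) {..<k}"
    by (rule eq_card_imp_inj_on) (use I img[OF I(1,2)] in auto)
  then show "(case x of (I, q) \<Rightarrow> restrict (\<lambda>j. sorted_list_of_set I ! q j) {..<k})
      \<in> {f \<in> {..<k} \<rightarrow>\<^sub>E UNIV. inj_on f {..<k}}"
    using xy by (simp add: inj_on_def)
next
  fix f :: "nat \<Rightarrow> 'n" assume "f \<in> {f \<in> {..<k} \<rightarrow>\<^sub>E UNIV. inj_on f {..<k}}"
  then have f: "f \<in> extensional {..<k}" "inj_on f {..<k}" by (auto simp: PiE_def)
  define I where "I = f ` {..<k}"
  have cI: "card I = k" using f by (simp add: I_def card_image)
  define s where "s = sorted_list_of_set I"
  have s: "length s = k" "distinct s" "set s = I" using cI by (auto simp: s_def)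
  have bs: "bij_betw (\<lambda>j. s ! j) {..<k} I"
    using bij_betw_nth[of s "{..<k}" I] s by simp
  \<comment> \<open>Outside \<open>{..<k}\<close> the value is \<open>j\<close> itself, as
    \<open>permutes\<close> demands.\<close>
  define q where "q j = (if j < k then inv_into {..<k} (\<lambda>j. s ! j) (f j) else j)" for j
  have "bij_betw (inv_into {..<k} (\<lambda>j. s ! j) \<circ> f) {..<k} {..<k}"
    using f by (intro bij_betw_trans[OF _ bij_betw_inv_into[OF bs]]) (auto simp: bij_betw_def I_def)
  then have "bij_betw q {..<k} {..<k}"
    by (rule bij_betw_cong[THEN iffD1, rotated]) (auto simp: q_def)
  then have q: "q permutes {..<k}" by (rule bij_imp_permutes) (auto simp: q_def)
  have "f = restrict (\<lambda>j. s ! q j) {..<k}"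
  proof
    fix j show "f j = restrict (\<lambda>j. s ! q j) {..<k} j"
    proof (cases "j < k")
      case True
      then have "f j \<in> (\<lambda>j. s ! j) ` {..<k}" using bs by (auto simp: bij_betw_def I_def)
      then show ?thesis using True f_inv_into_f[of "f j" "\<lambda>j. s ! j" "{..<k}"] by (simp add: q_def)
    next
      case False then show ?thesis using f by (simp add: extensional_def)
    qed
  qed
  then show "\<exists>x\<in>{I. card I = k} \<times> {q. q permutes {..<k}}.
     f = (case x of (I, q) \<Rightarrow> restrict (\<lambda>j. sorted_list_of_set I ! q j) {..<k})"
    using cI q s_def by (intro bexI[of _ "(I, q)"]) auto
qed

text \<open>Expanding every inner product over the coordinates gives a sum over choice functions
  \<open>f\<close>, one coordinate per column. A repeated value of \<open>f\<close> produces two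
  equal columns and hence 0; the injective choices with image \<open>I\<close> add up to the product
  of the two minors at \<open>I\<close>.\<close>

lemma cauchy_binet_wedge:
  fixes zs ws :: "(real ^ 'n::{finite,linorder}) list"
  assumes len: "length zs = k" "length ws = k"
  shows "wedge zs \<bullet> wedge ws = leibniz_det k (\<lambda>i j. zs ! i \<bullet> ws ! j)"
proof -
  let ?F = "{..<k} \<rightarrow>\<^sub>E (UNIV :: 'n set)"
  let ?h = "\<lambda>f. (\<Prod>j<k. ws ! j $ f j) * leibniz_det k (\<lambda>i j. zs ! i $ f j)"
  have "leibniz_det k (\<lambda>i j. zs ! i \<bullet> ws ! j) =
      (\<Sum>p | p permutes {..<k}. of_int (sign p) * (\<Sum>f\<in>?F. \<Prod>j<k. zs ! p j $ f j * ws ! j $ f j))"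
    unfolding leibniz_det_def inner_vec_def by (simp add: prod_sum_PiE)
  also have "\<dots> = (\<Sum>f\<in>?F. \<Sum>p | p permutes {..<k}.
      (\<Prod>j<k. ws ! j $ f j) * (of_int (sign p) * (\<Prod>j<k. zs ! p j $ f j)))"
    by (subst sum.swap) (simp add: sum_distrib_left prod.distrib mult_ac)
  also have "\<dots> = (\<Sum>f\<in>?F. ?h f)"
    by (simp add: leibniz_det_def sum_distrib_left)
  also have "\<dots> = (\<Sum>f\<in>{f \<in> ?F. inj_on f {..<k}}. ?h f)"
  proof (rule sum.mono_neutral_right)
    show "finite ?F" by (intro finite_PiE) auto
    show "\<forall>f\<in>?F - {f \<in> ?F. inj_on f {..<k}}. ?h f = 0"
    proof
      fix f assume "f \<in> ?F - {f \<in> ?F. inj_on f {..<k}}"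
      then obtain a b where "a < k" "b < k" "a \<noteq> b" "f a = f b" by (auto simp: inj_on_def)
      then show "?h f = 0" using leibniz_det_equal_columns[of a k b "\<lambda>i j. zs ! i $ f j"] by simp
    qed
  qed auto
  also have "\<dots> = (\<Sum>(I, q)\<in>{I. card I = k} \<times> {q. q permutes {..<k}}.
      ?h (restrict (\<lambda>j. sorted_list_of_set I ! q j) {..<k}))"
    by (subst sum.reindex_bij_betw[OF inj_functions_reindex, symmetric]) (simp add: case_prod_unfold)
  also have "\<dots> = (\<Sum>(I, q)\<in>{I. card I = k} \<times> {q. q permutes {..<k}}.
      wedge zs $ I * (of_int (sign q) * (\<Prod>j<k. ws ! j $ (sorted_list_of_set I ! q j))))"
  proof (rule sum.cong[OF refl])
    fix x assume "x \<in> {I :: 'n set. card I = k} \<times> {q. q permutes {..<k}}"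
    then obtain I q where x: "x = (I, q)" and I: "card I = k" and q: "q permutes {..<k}" by auto
    have "leibniz_det k (\<lambda>i j. zs ! i $ restrict (\<lambda>j. sorted_list_of_set I ! q j) {..<k} j)
        = leibniz_det k (\<lambda>i j. zs ! i $ (sorted_list_of_set I ! q j))"
      by (rule leibniz_det_cong) simp
    also have "\<dots> = of_int (sign q) * wedge zs $ I"
      using leibniz_det_permute_columns[OF q, of "\<lambda>i j. zs ! i $ (sorted_list_of_set I ! j)"] I len
      by (simp add: wedge_nth)
    finally show "(case x of (I, q) \<Rightarrow> ?h (restrict (\<lambda>j. sorted_list_of_set I ! q j) {..<k})) =
        (case x of (I, q) \<Rightarrow> wedge zs $ I *
          (of_int (sign q) * (\<Prod>j<k. ws ! j $ (sorted_list_of_set I ! q j))))"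
      using x by simp
  qed
  also have "\<dots> = (\<Sum>I | card I = k. wedge zs $ I *
      leibniz_det k (\<lambda>i j. ws ! j $ (sorted_list_of_set I ! i)))"
    by (simp add: sum.cartesian_product[symmetric] leibniz_det_def sum_distrib_left)
  also have "\<dots> = (\<Sum>I | card I = k. wedge zs $ I * wedge ws $ I)"
    using len leibniz_det_transpose[of k "\<lambda>i j. ws ! i $ (sorted_list_of_set _ ! j)"]
    by (intro sum.cong) (simp_all add: wedge_nth)
  also have "\<dots> = wedge zs \<bullet> wedge ws"
    unfolding inner_vec_def using len
    by (intro sum.mono_neutral_cong_left) (auto simp: wedge_nth)
  finally show ?thesis by simp
qed

text \<open>In the Leibniz term of \<open>p\<close> the vector in slot \<open>a\<close> occurs in
  exactly one factor, the one at position \<open>inv p a\<close>; the remaining factors do not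
  involve \<open>w\<close>.\<close>

lemma wedge_update_linear:
  assumes "a < length ws"
  shows "linear (\<lambda>w. wedge (ws[a := w]))"
proof -
  have *: "wedge (ws[a := w]) $ I = (if card I = length ws then
      \<Sum>p | p permutes {..<length ws}. w $ (sorted_list_of_set I ! inv p a) *
        (of_int (sign p) * (\<Prod>j\<in>{..<length ws} - {inv p a}. ws ! p j $ (sorted_list_of_set I ! j)))
      else 0)" for w I
  proof -
    have "of_int (sign p) * (\<Prod>j<length ws. ws[a := w] ! p j $ (sorted_list_of_set I ! j)) =
      w $ (sorted_list_of_set I ! inv p a) *
        (of_int (sign p) * (\<Prod>j\<in>{..<length ws} - {inv p a}. ws ! p j $ (sorted_list_of_set I ! j)))"
      if p: "p permutes {..<length ws}" for p
    proof -
      have ia: "inv p a \<in> {..<length ws}"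
        using permutes_in_image[OF permutes_inv[OF p], of a] assms by simp
      have pa: "p (inv p a) = a" using permutes_inverses(1)[OF p] by simp
      have ne: "p j \<noteq> a" if "j \<noteq> inv p a" for j
        using that permutes_inverses(2)[OF p, of j] by auto
      have "(\<Prod>j<length ws. ws[a := w] ! p j $ (sorted_list_of_set I ! j)) =
         w $ (sorted_list_of_set I ! inv p a) *
         (\<Prod>j\<in>{..<length ws} - {inv p a}. ws[a := w] ! p j $ (sorted_list_of_set I ! j))"
        using assms ia pa by (subst prod.remove[of _ "inv p a"]) auto
      also have "(\<Prod>j\<in>{..<length ws} - {inv p a}. ws[a := w] ! p j $ (sorted_list_of_set I ! j)) =
         (\<Prod>j\<in>{..<length ws} - {inv p a}. ws ! p j $ (sorted_list_of_set I ! j))"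
        using ne by (intro prod.cong) (metis DiffE insertI1 nth_list_update_neq)+
      finally show ?thesis by simp
    qed
    then show ?thesis by (auto simp: wedge_def intro!: sum.cong)
  qed
  show ?thesis
    by (rule linearI)
       (auto simp: vec_eq_iff * algebra_simps sum.distrib sum_distrib_left)
qed

section \<open>Integrality, nondegeneracy and size of the pairing\<close>

text \<open>On generators the pairing is the determinant of an integer matrix by Cauchy-Binet, and
  it is additive in \<open>Z\<close>.\<close>

lemma inner_wedge_dual_Ints:
  assumes "Z \<in> exterior_lattice k \<Lambda>" "length ws = k" "\<And>w z. w \<in> set ws \<Longrightarrow> z \<in> \<Lambda> \<Longrightarrow> z \<bullet> w \<in> \<int>"
  shows "Z \<bullet> wedge ws \<in> \<int>"
  using assms(1) unfolding exterior_lattice_def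
proof (induction rule: group_closure.induct)
  case (base Z)
  show ?case
  \<comment> \<open>The base rule of \<open>group_closure\<close> admits 0 next to the
    generators.\<close>
  proof (cases "Z = 0")
    case False
    then obtain zs where zs: "Z = wedge zs" "length zs = k" "set zs \<subseteq> \<Lambda>" using base by auto
    have "leibniz_det k (\<lambda>i j. zs ! i \<bullet> ws ! j) \<in> \<int>"
      unfolding leibniz_det_def
    proof (intro Ints_sum Ints_mult Ints_of_int Ints_prod)
      fix p j assume "p \<in> {p. p permutes {..<k}}" "j \<in> {..<k}"
      then have "p j < k" "j < k" using permutes_in_image[of p "{..<k}" j] by auto
      then show "zs ! p j \<bullet> ws ! j \<in> \<int>"
        using zs assms(2) by (intro assms(3)) auto
    qed
    then show ?thesis using zs cauchy_binet_wedge[of zs k ws] assms(2) by auto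
  qed simp
qed (auto simp: inner_diff_left)

lemma leibniz_det_identity:
  assumes "\<And>i j. i < k \<Longrightarrow> j < k \<Longrightarrow> M i j = (if i = j then 1 else 0)"
  shows "leibniz_det k M = 1"
proof -
  have "leibniz_det k M = (\<Sum>p\<in>{id}. of_int (sign p) * (\<Prod>j<k. M (p j) j))"
    unfolding leibniz_det_def
  proof (rule sum.mono_neutral_right)
    show "\<forall>p\<in>{p. p permutes {..<k}} - {id}. of_int (sign p) * (\<Prod>j<k. M (p j) j) = 0"
    proof
      fix p assume "p \<in> {p. p permutes {..<k}} - {id}"
      then have p: "p permutes {..<k}" "p \<noteq> id" by auto
      then obtain j where j: "p j \<noteq> j" by (metis eq_id_iff)
      then have "j < k" "p j < k"
        using p(1) permutes_in_image[OF p(1), of j] by (auto simp: permutes_def)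
      then have "M (p j) j = 0" using assms j by simp
      then show "of_int (sign p) * (\<Prod>j<k. M (p j) j) = 0"
        using \<open>j < k\<close> by (auto intro!: prod_zero)
    qed
  qed (auto simp: permutes_id finite_permutations)
  then show ?thesis using assms by (simp add: sign_id)
qed

text \<open>Purpose: coordinates of an exterior vector become pairings with wedges of unit
  vectors.\<close>

lemma wedge_axis:
  fixes I :: "'n::{finite,linorder} set"
  shows "wedge (map (\<lambda>i. axis i 1) (sorted_list_of_set I)) = axis I 1"
proof -
  let ?s = "sorted_list_of_set I"
  let ?M = "\<lambda>J i j. (axis (?s ! i) 1 :: (real, 'n) vec) $ (sorted_list_of_set J ! j)"
  have eq: "wedge (map (\<lambda>i. axis i 1) ?s) $ J =
      (if card J = card I then leibniz_det (card I) (?M J) else 0)" for J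
    using leibniz_det_cong[of "card I"
        "\<lambda>i j. map (\<lambda>i. axis i 1) ?s ! i $ (sorted_list_of_set J ! j)" "?M J"]
    by (simp add: wedge_nth)
  have same: "leibniz_det (card I) (?M I) = 1"
    by (rule leibniz_det_identity) (auto simp: axis_def nth_eq_iff_index_eq)
  have diff: "leibniz_det (card I) (?M J) = 0" if J: "card J = card I" "J \<noteq> I" for J
  proof -
    \<comment> \<open>An index in \<open>J\<close> but not in \<open>I\<close> gives a zero column
      in the minor at \<open>J\<close>.\<close>
    have "\<not> J \<subseteq> I" using J card_subset_eq[of I J] by auto
    then obtain x where x: "x \<in> J" "x \<notin> I" by auto
    then have "x \<in> set (sorted_list_of_set J)" by simp
    then obtain j where j: "j < card I" "sorted_list_of_set J ! j = x"
      using J(1) unfolding in_set_conv_nth by auto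
    show ?thesis
      unfolding leibniz_det_def
    proof (intro sum.neutral ballI)
      fix p assume "p \<in> {p. p permutes {..<card I}}"
      then have "p j < length ?s" using permutes_in_image[of p "{..<card I}" j] j by auto
      then have "?s ! p j \<in> I" by (metis finite_code nth_mem set_sorted_list_of_set)
      then have "?M J (p j) j = 0" using j x by (auto simp: axis_def)
      then show "of_int (sign p) * (\<Prod>j<card I. ?M J (p j) j) = 0"
        using j(1) by (auto intro!: prod_zero)
    qed
  qed
  have "wedge (map (\<lambda>i. axis i 1) ?s) $ J = (axis I 1 :: real ^ 'n set) $ J" for J
    using same diff[of J] by (cases "J = I") (auto simp: eq axis_def[of I])
  then show ?thesis by (simp add: vec_eq_iff)
qed

text \<open>Wedges of a spanning family span the exterior power by multilinearity, so a vector
  orthogonal to all of them is 0. Repeated indices can be excluded because their wedges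
  vanish.\<close>

lemma exterior_power_wedge_pairing_nonzero:
  fixes c :: "'m \<Rightarrow> real ^ 'n::{finite,linorder}"
  assumes Z: "Z \<in> exterior_power k" "Z \<noteq> 0" and span: "span (range c) = UNIV"
  shows "\<exists>xs. length xs = k \<and> distinct xs \<and> Z \<bullet> wedge (map c xs) \<noteq> 0"
proof (rule ccontr)
  assume "\<not> ?thesis"
  then have dist: "Z \<bullet> wedge (map c xs) = 0" if "length xs = k" "distinct xs" for xs
    using that by blast
  have base: "Z \<bullet> wedge (map c xs) = 0" if "length xs = k" for xs
  proof (cases "distinct xs")
    case False
    then have "wedge (map c xs) = 0" by (intro wedge_not_distinct) (auto simp: distinct_map)
    then show ?thesis by simp
  qed (use dist that in auto)
  \<comment> \<open>The first \<open>l\<close> slots are arbitrary and the later ones still come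
    from the family. Each induction step frees one slot by linearity; at \<open>l = k\<close> no
    restriction is left.\<close>
  have "Z \<bullet> wedge ws = 0" if "length ws = k" "\<And>i. l \<le> i \<Longrightarrow> i < k \<Longrightarrow> ws ! i \<in> range c" "l \<le> k" for l ws
    using that
  proof (induction l arbitrary: ws)
    case 0
    then have "ws = map c (map (inv c) ws)"
      by (intro nth_equalityI) (auto simp: f_inv_into_f)
    then show ?case using base[of "map (inv c) ws"] 0 by simp
  next
    case (Suc l)
    let ?L = "\<lambda>w. Z \<bullet> wedge (ws[l := w])"
    have lin: "linear ?L"
      using linear_compose[OF wedge_update_linear[of l ws] bounded_linear.linear[OF bounded_linear_inner_right[of Z]]]
        Suc.prems by (simp add: o_def)
    have "?L w = 0" if "w \<in> range c" for w
    proof (rule Suc.IH)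
      fix i assume "l \<le> i" "i < k"
      then show "ws[l := w] ! i \<in> range c"
        using Suc.prems that by (cases "i = l") auto
    qed (use Suc.prems in auto)
    then have "?L (ws ! l) = 0"
      using linear_eq_on[OF lin linear_zero, of "ws ! l" "range c"] span by auto
    then show ?case by simp
  qed
  from this[of _ k] have all: "Z \<bullet> wedge ws = 0" if "length ws = k" for ws using that by auto
  have "Z $ I = 0" for I
  proof (cases "card I = k")
    case True
    then show ?thesis
      using all[of "map (\<lambda>i. axis i 1) (sorted_list_of_set I)"]
      by (simp add: wedge_axis inner_axis)
  qed (use Z in \<open>auto simp: exterior_power_def\<close>)
  then show False using Z by (simp add: vec_eq_iff)
qed

text \<open>The pairing with the corresponding dual wedge is the determinant of an identity
  matrix.\<close>

lemma wedge_nonzero: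
  assumes dual: "\<And>i j. b i \<bullet> c j = (if i = j then 1 else 0)" and "distinct xs"
  shows "wedge (map b xs) \<noteq> 0"
proof -
  have "wedge (map b xs) \<bullet> wedge (map c xs) = 1"
    using assms cauchy_binet_wedge[of "map b xs" "length xs" "map c xs"]
    by (simp add: leibniz_det_identity nth_eq_iff_index_eq)
  then show ?thesis by auto
qed

text \<open>The bound on an entry splits into a row factor and a column factor, so each of the
  \<open>fact (length xs)\<close> Leibniz terms has the same bound, whatever the
  permutation.\<close>

lemma abs_wedge_le:
  fixes b :: "'m \<Rightarrow> real ^ 'n::{finite,linorder}"
  assumes bound: "\<And>j i. \<bar>b j $ i\<bar> \<le> r j * v i"
    and v: "\<And>i. v i \<ge> 0" and xs: "distinct xs" and I: "card I = length xs"
  shows "\<bar>wedge (map b xs) $ I\<bar> \<le> fact (length xs) * (\<Prod>j\<in>set xs. r j) * (\<Prod>i\<in>I. v i)"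
proof -
  let ?k = "length xs"
  let ?s = "sorted_list_of_set I"
  have r: "r j * v i \<ge> 0" for i j using bound[of j i] by linarith
  have set_prod: "(\<Prod>j<length ys. f (ys ! j)) = (\<Prod>j\<in>set ys. f j)" if "distinct ys"
    for ys :: "'x list" and f :: "'x \<Rightarrow> real"
    using prod.reindex_bij_betw[OF bij_betw_nth[OF that refl refl], of f] by simp
  have "\<bar>of_int (sign p) * (\<Prod>j<?k. map b xs ! p j $ (?s ! j))\<bar> \<le> (\<Prod>j\<in>set xs. r j) * (\<Prod>i\<in>I. v i)"
    if p: "p permutes {..<?k}" for p
  proof -
    have pk: "p j < ?k" if "j < ?k" for j using permutes_in_image[OF p, of j] that by simp
    have "\<bar>of_int (sign p) * (\<Prod>j<?k. map b xs ! p j $ (?s ! j))\<bar> = (\<Prod>j<?k. \<bar>b (xs ! p j) $ (?s ! j)\<bar>)"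
      using pk by (simp add: abs_mult abs_prod sign_def)
    also have "\<dots> \<le> (\<Prod>j<?k. r (xs ! p j) * v (?s ! j))"
      by (intro prod_mono) (use bound in auto)
    also have "\<dots> = (\<Prod>j<?k. r (xs ! p j)) * (\<Prod>j<?k. v (?s ! j))" by (simp add: prod.distrib)
    also have "(\<Prod>j<?k. r (xs ! p j)) = (\<Prod>j<?k. r (xs ! j))"
      using prod.permute[OF p, of "\<lambda>j. r (xs ! j)"] by (simp add: o_def)
    also have "\<dots> = (\<Prod>j\<in>set xs. r j)" using xs by (rule set_prod)
    also have "(\<Prod>j<?k. v (?s ! j)) = (\<Prod>i\<in>I. v i)" using set_prod[of ?s v] I by simp
    finally show ?thesis .
  qed
  then have "\<bar>\<Sum>p | p permutes {..<?k}. of_int (sign p) * (\<Prod>j<?k. map b xs ! p j $ (?s ! j))\<bar>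
      \<le> of_nat (card {p. p permutes {..<?k}}) * ((\<Prod>j\<in>set xs. r j) * (\<Prod>i\<in>I. v i))"
    by (intro order_trans[OF sum_abs] sum_bounded_above) auto
  then show ?thesis using I by (simp add: wedge_def card_permutations mult.assoc)
qed

subsection \<open>Reduction of lattice bases\<close>

text \<open>Integral elementary moves stand in for unimodular base changes. Induction over the moves
  shows that they keep the determinant, the generated lattice and all vectors outside
  \<open>S\<close>, without handling integer matrices.\<close>

inductive transvections :: "'i set \<Rightarrow> ('i \<Rightarrow> 'a::real_vector) \<Rightarrow> ('i \<Rightarrow> 'a) \<Rightarrow> bool"
  for S a where
  transvections_refl: "transvections S a a"
| transvections_step: "transvections S a b \<Longrightarrow> i \<in> S \<Longrightarrow> j \<in> S \<Longrightarrow> i \<noteq> j \<Longrightarrow>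
    transvections S a (b(i := b i + real_of_int n *\<^sub>R b j))"

lemma transvections_trans:
  assumes "transvections S b c" "transvections S a b" shows "transvections S a c"
  using assms by induction (auto intro: transvections.intros)

lemma transvections_mono:
  assumes "transvections S a b" "S \<subseteq> T" shows "transvections T a b"
  using assms by induction (auto intro: transvections.intros)

lemma transvections_outside:
  assumes "transvections S a b" "i \<notin> S" shows "b i = a i"
  using assms by induction auto

lemma transvections_linear:
  assumes "transvections S a b" "linear f" shows "transvections S (\<lambda>i. f (a i)) (\<lambda>i. f (b i))"
  using assms
proof induction
  case (transvections_step b i j n)
  have "(\<lambda>k. f ((b(i := b i + real_of_int n *\<^sub>R b j)) k)) =
      (\<lambda>k. f (b k))(i := f (b i) + real_of_int n *\<^sub>R f (b j))"
    using transvections_step.prems by (auto simp: linear_add linear_scale)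
  then show ?case using transvections_step by (auto intro: transvections.transvections_step)
qed (rule transvections_refl)

text \<open>A move with \<open>n\<close> is undone by the move with \<open>-n\<close>, hence both
  directions. The sets \<open>H\<close> in use are a lattice, an orthogonal complement, and the
  vectors pairing integrally with a fixed one.\<close>

lemma transvections_subgroup_iff:
  assumes "transvections S a b"
    and H: "\<And>x y n. x \<in> H \<Longrightarrow> y \<in> H \<Longrightarrow> x + real_of_int n *\<^sub>R y \<in> H"
  shows "(\<forall>i\<in>S. a i \<in> H) \<longleftrightarrow> (\<forall>i\<in>S. b i \<in> H)"
  using assms(1)
proof induction
  case (transvections_step b i j n)
  have "(\<forall>k\<in>S. b k \<in> H) \<longleftrightarrow> (\<forall>k\<in>S. (b(i := b i + real_of_int n *\<^sub>R b j)) k \<in> H)"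
  proof (safe)
    fix k assume "\<forall>k\<in>S. b k \<in> H" "k \<in> S"
    then show "(b(i := b i + real_of_int n *\<^sub>R b j)) k \<in> H" using transvections_step.hyps H by auto
  next
    fix k assume all: "\<forall>k\<in>S. (b(i := b i + real_of_int n *\<^sub>R b j)) k \<in> H" and k: "k \<in> S"
    show "b k \<in> H"
    proof (cases "k = i")
      case True
      have "b i + real_of_int n *\<^sub>R b j \<in> H" "b j \<in> H"
        using bspec[OF all, of i] bspec[OF all, of j] transvections_step.hyps by auto
      then show ?thesis using H[of "b i + real_of_int n *\<^sub>R b j" "b j" "-n"] True by simp
    qed (use bspec[OF all k] in auto)
  qed
  then show ?case using transvections_step.IH by simp
qed simp

text \<open>The coefficients are real rather than integral so that the projection along a shortest
  vector is covered too.\<close>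

lemma det_add_multiples:
  fixes a :: "'n::finite \<Rightarrow> real ^ 'n"
  assumes "finite F" "s \<notin> F"
  shows "det (\<chi> i. if i \<in> F then a i + t i *\<^sub>R a s else a i) = det (\<chi> i. a i)"
  using assms
proof (induction F rule: finite_induct)
  case (insert x F)
  let ?A = "\<chi> i. if i \<in> F then a i + t i *\<^sub>R a s else a i"
  have "(\<chi> i. if i \<in> insert x F then a i + t i *\<^sub>R a s else a i) =
      (\<chi> k. if k = x then row x ?A + t x *s row s ?A else row k ?A)"
    using insert by (auto simp: vec_eq_iff row_def scalar_mult_eq_scaleR)
  then show ?case using insert det_row_operation[of x s ?A "t x"] by auto
qed simp

lemma transvections_det:
  fixes a :: "'n::finite \<Rightarrow> real ^ 'n"
  assumes "transvections S a b" shows "det (\<chi> i. b i) = det (\<chi> i. a i)"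
  using assms
proof induction
  case (transvections_step b i j n)
  have "(\<chi> k. (b(i := b i + real_of_int n *\<^sub>R b j)) k) =
      (\<chi> k. if k \<in> {i} then b k + real_of_int n *\<^sub>R b j else b k)"
    by (simp add: vec_eq_iff)
  then show ?case using transvections_step det_add_multiples[of "{i}" j b "\<lambda>_. real_of_int n"] by simp
qed simp

text \<open>Three moves exchange two vectors up to a sign. Thus a vector in any slot of
  \<open>S\<close> can be brought into slot \<open>s\<close>, where minimality is known.\<close>

lemma transvections_swap:
  assumes "s \<in> S" "j \<in> S" "s \<noteq> j"
  shows "\<exists>e. transvections S c e \<and> e s = c j"
proof -
  define c1 where "c1 = c(s := c s + real_of_int 1 *\<^sub>R c j)"
  define c2 where "c2 = c1(j := c1 j + real_of_int (-1) *\<^sub>R c1 s)"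
  define c3 where "c3 = c2(s := c2 s + real_of_int 1 *\<^sub>R c2 j)"
  have "transvections S c c3"
    unfolding c3_def c2_def c1_def using assms
    by (intro transvections_step transvections_refl) auto
  moreover have "c3 s = c j" using assms by (simp add: c1_def c2_def c3_def)
  ultimately show ?thesis by blast
qed

text \<open>Moves performed on linear images can be replayed on the preimages. This brings the
  reduction of a projected family back to the original lattice.\<close>

lemma transvections_lift:
  assumes "transvections S a' b'" "linear f" "\<And>i. i \<in> S \<Longrightarrow> a' i = f (b i)"
  shows "\<exists>c. transvections S b c \<and> (\<forall>i\<in>S. b' i = f (c i))"
  using assms(1)
proof induction
  case transvections_refl
  then show ?case using assms(3) by (auto intro: transvections.transvections_refl)
next
  case (transvections_step b' i j n)
  then obtain c where c: "transvections S b c" "\<forall>i\<in>S. b' i = f (c i)" by blast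
  then have "transvections S b (c(i := c i + real_of_int n *\<^sub>R c j))"
    using transvections_step by (intro transvections.transvections_step)
  moreover have "\<forall>k\<in>S. (b'(i := b' i + real_of_int n *\<^sub>R b' j)) k = f ((c(i := c i + real_of_int n *\<^sub>R c j)) k)"
    using c transvections_step.hyps assms(2) by (auto simp: linear_add linear_scale)
  ultimately show ?case by blast
qed

lemma transvections_add_multiples:
  assumes "finite F" "s \<notin> F"
  shows "transvections (insert s F) c (\<lambda>i. if i \<in> F then c i + real_of_int (n i) *\<^sub>R c s else c i)"
  using assms
proof (induction F rule: finite_induct)
  case (insert x F)
  let ?c = "\<lambda>i. if i \<in> F then c i + real_of_int (n i) *\<^sub>R c s else c i"
  have "(\<lambda>i. if i \<in> insert x F then c i + real_of_int (n i) *\<^sub>R c s else c i) =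
      ?c(x := ?c x + real_of_int (n x) *\<^sub>R ?c s)"
    using insert by (auto simp: fun_eq_iff)
  moreover have "transvections (insert s (insert x F)) c ?c"
    by (rule transvections_mono[OF insert.IH]) (use insert in auto)
  ultimately show ?case
    using insert transvections_step[of "insert s (insert x F)" c ?c x s "n x"] by (simp only: insert_iff simp_thms) auto
qed (auto intro: transvections.transvections_refl)

section \<open>Shortest vectors and Hermite reduction\<close>

text \<open>The inverse matrix recovers the integer coefficients by a bounded linear map, so a norm
  bound leaves finitely many of them.\<close>

lemma finite_lattice_vectors_norm_le:
  fixes a :: "'n::finite \<Rightarrow> real ^ 'n"
  assumes "det (\<chi> i. a i) \<noteq> 0"
  shows "finite {x \<in> range (\<lambda>m :: 'n \<Rightarrow> int. \<Sum>i\<in>UNIV. real_of_int (m i) *\<^sub>R a i). norm x \<le> R}"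
proof -
  let ?A = "\<chi> i. a i"
  let ?f = "\<lambda>m :: 'n \<Rightarrow> int. \<Sum>i\<in>UNIV. real_of_int (m i) *\<^sub>R a i"
  obtain B where B: "?A ** B = mat 1"
    using assms invertible_det_nz[of ?A] by (auto simp: invertible_def)
  have coord: "(?f m v* B) $ i = real_of_int (m i)" for m i
  proof -
    have "?f m = (\<chi> i. real_of_int (m i)) v* ?A"
      by (simp add: vec_eq_iff vector_matrix_mult_def mult.commute)
    then have "?f m v* B = (\<chi> i. real_of_int (m i))"
      by (simp add: vector_matrix_mul_assoc B)
    then show ?thesis by simp
  qed
  obtain K where K: "K > 0" "\<And>x. norm (transpose B *v x) \<le> K * norm x"
    using linear_bounded_pos[OF matrix_vector_mul_linear[of "transpose B"]] by (auto simp: mult.commute)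
  have "{x \<in> range ?f. norm x \<le> R} \<subseteq> ?f ` {m. \<forall>i. m i \<in> {-\<lceil>K * R\<rceil>..\<lceil>K * R\<rceil>}}"
  proof
    fix x assume "x \<in> {x \<in> range ?f. norm x \<le> R}"
    then obtain m where m: "x = ?f m" "norm x \<le> R" by auto
    have "\<bar>real_of_int (m i)\<bar> \<le> K * R" for i
    proof -
      have "\<bar>real_of_int (m i)\<bar> \<le> norm (x v* B)"
        using component_le_norm_cart[of "x v* B" i] coord[of m i] m by simp
      also have "\<dots> \<le> K * R" using K(2)[of x] K(1) m(2)
        by (simp add: order_trans[OF _ mult_left_mono[of "norm x" R K]])
      finally show ?thesis .
    qed
    then have "m i \<in> {-\<lceil>K * R\<rceil>..\<lceil>K * R\<rceil>}" for i
    proof -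
      have "\<bar>real_of_int (m i)\<bar> \<le> real_of_int \<lceil>K * R\<rceil>"
        using \<open>\<bar>real_of_int (m i)\<bar> \<le> K * R\<close> le_of_int_ceiling[of "K * R"] by linarith
      then show ?thesis by (simp add: abs_le_iff)
    qed
    then show "x \<in> ?f ` {m. \<forall>i. m i \<in> {-\<lceil>K * R\<rceil>..\<lceil>K * R\<rceil>}}" using m by auto
  qed
  moreover have "finite {m :: 'n \<Rightarrow> int. \<forall>i. m i \<in> {-\<lceil>K * R\<rceil>..\<lceil>K * R\<rceil>}}"
    using finite_PiE[of "UNIV :: 'n set" "\<lambda>_. {-\<lceil>K * R\<rceil>..\<lceil>K * R\<rceil>}"]
    by (simp add: PiE_def Pi_def extensional_def)
  ultimately show ?thesis by (meson finite_imageI finite_subset)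
qed

lemma transvections_minimal_vector:
  fixes a :: "'n::finite \<Rightarrow> real ^ 'n"
  assumes "det (\<chi> i. a i) \<noteq> 0"
  shows "\<exists>b. transvections S a b \<and> (\<forall>c. transvections S a c \<longrightarrow> norm (b s) \<le> norm (c s))"
proof -
  let ?f = "\<lambda>m :: 'n \<Rightarrow> int. \<Sum>i\<in>UNIV. real_of_int (m i) *\<^sub>R a i"
  \<comment> \<open>Vectors longer than \<open>a s\<close> cannot be minimal; cutting them off makes
    the set of candidates finite.\<close>
  let ?X = "{x. (\<exists>b. transvections S a b \<and> x = b s) \<and> norm x \<le> norm (a s)}"
  have "b s \<in> range ?f" if b: "transvections S a b" for b
  proof -
    have H: "x + real_of_int n *\<^sub>R y \<in> range ?f" if xy: "x \<in> range ?f" "y \<in> range ?f" for x y n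
    proof -
      obtain m k where "x = ?f m" "y = ?f k" using xy by auto
      then have "x + real_of_int n *\<^sub>R y = ?f (\<lambda>i. m i + n * k i)"
        by (simp add: scaleR_sum_right scaleR_add_left sum.distrib)
      then show ?thesis by (rule range_eqI[where x = "\<lambda>i. m i + n * k i"])
    qed
    have "a i = ?f (\<lambda>j. if j = i then 1 else 0)" for i
      by (simp add: if_distrib[of real_of_int] if_distrib[of "\<lambda>x. x *\<^sub>R _"] cong: if_cong)
    then have "a i \<in> range ?f" for i
      by (rule range_eqI[where x = "\<lambda>j. if j = i then 1 else 0"])
    then show ?thesis
      using transvections_subgroup_iff[OF transvections_mono[OF b subset_UNIV] H] by auto
  qed
  then have "finite ?X"
    by (intro finite_subset[OF _ finite_lattice_vectors_norm_le[OF assms, of "norm (a s)"]]) auto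
  moreover have "a s \<in> ?X" by (auto intro: transvections.transvections_refl)
  ultimately obtain x where x: "is_arg_min norm (\<lambda>x. x \<in> ?X) x"
    using ex_is_arg_min_if_finite[of ?X norm] by blast
  then obtain b where b: "transvections S a b" "x = b s" by (auto simp: is_arg_min_def)
  have "norm (b s) \<le> norm (c s)" if "transvections S a c" for c
  proof (cases "norm (c s) \<le> norm (a s)")
    case True
    then show ?thesis using x b(2) that by (force simp: is_arg_min_linorder)
  next
    case False
    then show ?thesis using x b(2) by (auto simp: is_arg_min_linorder)
  qed
  with b show ?thesis by blast
qed

text \<open>
  Hermite's argument: a shortest vector, the reduction of its orthogonal projection, and size
  reduction of the lifts. The lifts are not shorter than the shortest vector, so projecting them
  at most halves their norm.
\<close>

lemma reduced_family:
  fixes a :: "'n::finite \<Rightarrow> real ^ 'n"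
  assumes "det (\<chi> i. a i) \<noteq> 0"
    and "\<And>i. i \<notin> S \<Longrightarrow> norm (a i) = 1"
    and "\<And>i j. i \<notin> S \<Longrightarrow> i \<noteq> j \<Longrightarrow> a i \<bullet> a j = 0"
  shows "\<exists>b. transvections S a b \<and>
    (\<Prod>i\<in>S. norm (b i)) \<le> 2 ^ (card S)\<^sup>2 * \<bar>det (\<chi> i. a i)\<bar>"
  using assms
proof (induction "card S" arbitrary: S a)
  case 0
  then have S: "S = {}" by simp
  then have "orthogonal_matrix (\<chi> i. a i)"
    using 0 unfolding orthogonal_matrix_orthonormal_rows by (simp add: row_def orthogonal_def)
  then have "\<bar>det (\<chi> i. a i)\<bar> = 1" using det_orthogonal_matrix by fastforce
  then show ?case using S by (auto intro: transvections.transvections_refl)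
next
  case (Suc r)
  then obtain s where s: "s \<in> S" by (metis card_eq_0_iff ex_in_conv nat.distinct(1))
  define T where "T = S - {s}"
  have T: "S = insert s T" "s \<notin> T" "card T = r" "finite T"
    using s Suc.hyps(2) by (auto simp: T_def)
  obtain b where b: "transvections S a b"
    and min: "\<And>c. transvections S a c \<Longrightarrow> norm (b s) \<le> norm (c s)"
    using transvections_minimal_vector[OF Suc.prems(1)] by blast
  define \<beta> where "\<beta> = b s"
  have det_b: "det (\<chi> i. b i) = det (\<chi> i. a i)" by (rule transvections_det[OF b])
  have "\<beta> \<noteq> 0"
  proof
    assume "\<beta> = 0"
    then have "row s (\<chi> i. b i) = 0" by (simp add: row_def \<beta>_def vec_eq_iff)
    then show False using det_zero_row(1)[of s "\<chi> i. b i"] det_b Suc.prems(1) by simp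
  qed
  define f where "f x = x - ((x \<bullet> \<beta>) / (\<beta> \<bullet> \<beta>)) *\<^sub>R \<beta>" for x
  have lin: "linear f"
    unfolding f_def by (rule linearI) (auto simp: algebra_simps add_divide_distrib)
  have orth: "f x \<bullet> \<beta> = 0" for x
    using \<open>\<beta> \<noteq> 0\<close> by (simp add: f_def inner_diff_left)
  \<comment> \<open>Projecting the remaining vectors leaves the lattice, but it consists of row
    operations with real coefficients and so keeps the determinant.\<close>
  define g where "g i = (if i \<in> T then b i + (- (b i \<bullet> \<beta>) / (\<beta> \<bullet> \<beta>)) *\<^sub>R b s else b i)" for i
  have g: "g i = (if i \<in> T then f (b i) else b i)" for i
    by (simp add: g_def f_def \<beta>_def)
  have det_g: "det (\<chi> i. g i) = det (\<chi> i. b i)"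
    unfolding g_def using T by (intro det_add_multiples) auto
  \<comment> \<open>Slot \<open>s\<close> receives the unit vector along \<open>\<beta>\<close>. The
    family stays square with its part outside \<open>T\<close> orthonormal, so the induction
    hypothesis applies, and the determinant loses exactly the factor
    \<open>norm \<beta>\<close>.\<close>
  define a' where "a' = g(s := inverse (norm \<beta>) *\<^sub>R \<beta>)"
  have "(\<chi> i. a' i) = (\<chi> i. if i = s then inverse (norm \<beta>) *s g i else g i)"
    using T by (simp add: a'_def vec_eq_iff g \<beta>_def scalar_mult_eq_scaleR)
  then have "det (\<chi> i. a' i) = inverse (norm \<beta>) * det (\<chi> i. if i = s then g i else g i)"
    using det_row_mul[of s "inverse (norm \<beta>)" g g] by simp
  then have det_a': "det (\<chi> i. a' i) = inverse (norm \<beta>) * det (\<chi> i. a i)"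
    using det_g det_b by simp
  have outside: "b i = a i" if "i \<notin> S" for i using transvections_outside[OF b that] .
  have perp: "a i \<bullet> b j = 0" if "i \<notin> S" "j \<in> S" for i j
  proof -
    have "(\<forall>k\<in>S. a k \<in> {x. a i \<bullet> x = 0}) \<longleftrightarrow> (\<forall>k\<in>S. b k \<in> {x. a i \<bullet> x = 0})"
      by (rule transvections_subgroup_iff[OF b]) (auto simp: inner_add_right)
    moreover have "\<forall>k\<in>S. a k \<in> {x. a i \<bullet> x = 0}" using Suc.prems(3)[OF that(1)] that by (metis (mono_tags) mem_Collect_eq)
    ultimately show ?thesis using that by auto
  qed
  have perpf: "a i \<bullet> f (b j) = 0" if "i \<notin> S" "j \<in> T" for i j
    using perp[OF that(1), of j] perp[OF that(1) s] that T(1)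
    by (simp add: f_def inner_diff_right \<beta>_def)
  have "\<exists>b'. transvections T a' b' \<and>
      (\<Prod>i\<in>T. norm (b' i)) \<le> 2 ^ (card T)\<^sup>2 * \<bar>det (\<chi> i. a' i)\<bar>"
  proof (rule Suc.hyps(1))
    show "r = card T" using T by simp
    show "det (\<chi> i. a' i) \<noteq> 0" using det_a' Suc.prems(1) \<open>\<beta> \<noteq> 0\<close> by simp
    show "norm (a' i) = 1" if "i \<notin> T" for i
      using that T Suc.prems(2)[of i] outside[of i] \<open>\<beta> \<noteq> 0\<close> by (auto simp: a'_def g)
    show "a' i \<bullet> a' j = 0" if ij: "i \<notin> T" "i \<noteq> j" for i j
    proof (cases "i = s")
      case True
      then have "a' i = inverse (norm \<beta>) *\<^sub>R \<beta>" "a' j = (if j \<in> T then f (b j) else b j)"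
        using ij by (auto simp: a'_def g)
      moreover have "\<beta> \<bullet> b j = 0" if "j \<notin> T"
        using perp[of j s] outside[of j] that ij True T s by (auto simp: \<beta>_def inner_commute)
      ultimately show ?thesis using orth[of "b j"] by (simp add: inner_commute)
    next
      case False
      then have i: "i \<notin> S" using ij T by auto
      then have ai: "a' i = a i" using False ij outside by (simp add: a'_def g)
      consider "j = s" | "j \<in> T" | "j \<notin> S" using T by auto
      then show ?thesis
      proof cases
        case 1 then show ?thesis using ai perp[OF i s] by (simp add: a'_def \<beta>_def)
      next
        case 2
        then show ?thesis using ai perpf[OF i 2] T by (auto simp: a'_def g)
      next
        case 3
        then show ?thesis using ai outside[OF 3] Suc.prems(3)[OF i ij(2)] T by (auto simp: a'_def g)
      qed
    qed
  qed
  then obtain b' where b': "transvections T a' b'"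
    and prod_b': "(\<Prod>i\<in>T. norm (b' i)) \<le> 2 ^ r\<^sup>2 * \<bar>det (\<chi> i. a' i)\<bar>"
    using T by auto
  have "a' i = f (b i)" if "i \<in> T" for i using that T by (auto simp: a'_def g)
  from transvections_lift[OF b' lin this]
  obtain c where c: "transvections T b c" "\<And>i. i \<in> T \<Longrightarrow> b' i = f (c i)" by blast
  have cs: "c s = \<beta>" using transvections_outside[OF c(1) T(2)] by (simp add: \<beta>_def)
  \<comment> \<open>Rounding the coefficient along \<open>\<beta>\<close> is an integral move that
    leaves a component of at most half the length of \<open>\<beta>\<close>.\<close>
  define q where "q i = (c i \<bullet> \<beta>) / (\<beta> \<bullet> \<beta>)" for i
  define e where "e i = (if i \<in> T then c i + real_of_int (- round (q i)) *\<^sub>R c s else c i)" for i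
  have "transvections S c e"
    using transvections_add_multiples[OF T(4,2)] by (simp add: e_def[abs_def] T(1))
  then have ae: "transvections S a e"
    using transvections_trans[OF _ transvections_trans[OF transvections_mono[OF c(1)] b]] T(1) by auto
  have es: "e s = \<beta>" using T cs by (simp add: e_def)
  have norm_e: "norm (e i) \<le> 2 * norm (b' i)" if i: "i \<in> T" for i
  proof -
    obtain e' where "transvections S e e'" "e' s = e i"
      using transvections_swap[of s S i e] T i by auto
    then have le: "norm \<beta> \<le> norm (e i)"
      using min[OF transvections_trans[OF _ ae]] by (metis \<beta>_def)
    define \<theta> where "\<theta> = q i - real_of_int (round (q i))"
    have \<theta>: "\<bar>\<theta>\<bar> \<le> 1 / 2" using of_int_round_abs_le[of "q i"] unfolding \<theta>_def by linarith
    have "e i = f (c i) + \<theta> *\<^sub>R \<beta>"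
      using i cs by (simp add: e_def f_def \<theta>_def q_def algebra_simps)
    then have "(norm (e i))\<^sup>2 = (norm (b' i))\<^sup>2 + (\<bar>\<theta>\<bar> * norm \<beta>)\<^sup>2"
      using c(2)[OF i] orth[of "c i"]
      by (simp add: norm_add_Pythagorean orthogonal_def power_mult_distrib)
    also have "(\<bar>\<theta>\<bar> * norm \<beta>)\<^sup>2 \<le> (1 / 2 * norm (e i))\<^sup>2"
      using \<theta> le by (intro power_mono mult_mono) auto
    \<comment> \<open>The quarter on the right is absorbed on the left; the resulting factor 4/3 is
      rounded up to 4.\<close>
    finally have "(norm (e i))\<^sup>2 \<le> (norm (b' i))\<^sup>2 + (norm (e i))\<^sup>2 / 4"
      by (simp add: power_divide)
    then have "(norm (e i))\<^sup>2 \<le> 4 * (norm (b' i))\<^sup>2"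
      using zero_le_power2[of "norm (b' i)"] by linarith
    then have "(norm (e i))\<^sup>2 \<le> (2 * norm (b' i))\<^sup>2"
      by (simp add: power_mult_distrib)
    then show ?thesis by (rule power2_le_imp_le) simp
  qed
  have "(\<Prod>i\<in>S. norm (e i)) = norm \<beta> * (\<Prod>i\<in>T. norm (e i))"
    using T es by simp
  also have "\<dots> \<le> norm \<beta> * (\<Prod>i\<in>T. 2 * norm (b' i))"
    using norm_e by (intro mult_left_mono prod_mono) auto
  also have "\<dots> = norm \<beta> * 2 ^ r * (\<Prod>i\<in>T. norm (b' i))"
    using T by (simp add: prod.distrib)
  also have "\<dots> \<le> norm \<beta> * 2 ^ r * (2 ^ r\<^sup>2 * \<bar>det (\<chi> i. a' i)\<bar>)"
    using prod_b' by (intro mult_left_mono) auto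
  also have "\<dots> = 2 ^ (r + r\<^sup>2) * \<bar>det (\<chi> i. a i)\<bar>"
    using \<open>\<beta> \<noteq> 0\<close> by (simp add: det_a' abs_mult power_add)
  \<comment> \<open>With \<open>card S = r + 1\<close> this is \<open>r + r^2 <= (r + 1)^2\<close>,
    which explains the quadratic exponent.\<close>
  also have "\<dots> \<le> 2 ^ (card S)\<^sup>2 * \<bar>det (\<chi> i. a i)\<bar>"
    using Suc.hyps(2)[symmetric] by (intro mult_right_mono power_increasing) (auto simp: power2_eq_square)
  finally show ?case using ae by blast
qed

text \<open>The vector \<open>c j\<close> solves the linear system with right-hand side
  \<open>axis j 1\<close>. In Cramer's numerator only permutations with \<open>p j = i\<close>
  survive; there row \<open>j\<close> contributes 1 and every other row at most its norm.\<close>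

lemma cramer_dual_bound:
  fixes b c :: "'n::finite \<Rightarrow> real ^ 'n"
  assumes dual: "\<And>l. b l \<bullet> c j = (if l = j then 1 else 0)" and nz: "det (\<chi> l. b l) \<noteq> 0"
  shows "\<bar>c j $ i\<bar> \<le> fact CARD('n) * (\<Prod>l\<in>UNIV - {j}. norm (b l)) / \<bar>det (\<chi> l. b l)\<bar>"
proof -
  let ?B = "\<chi> l. b l"
  let ?M = "(\<chi> l m. if m = i then (axis j 1 :: real ^ 'n) $ l else ?B $ l $ m) :: real ^ 'n ^ 'n"
  have "?B *v c j = axis j 1"
    using dual by (auto simp: vec_eq_iff matrix_vector_mult_def inner_vec_def axis_def)
  then have eq: "c j $ i = det ?M / det ?B"
    using cramer[OF nz, of "c j" "axis j 1"] by (simp add: vec_eq_iff)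
  have leibniz_term: "\<bar>of_int (sign p) * (\<Prod>l\<in>UNIV. ?M $ l $ p l)\<bar> \<le> (\<Prod>l\<in>UNIV - {j}. norm (b l))"
    if p: "p permutes UNIV" for p
  proof (cases "p j = i")
    case True
    have "\<bar>of_int (sign p) * (\<Prod>l\<in>UNIV. ?M $ l $ p l)\<bar> = (\<Prod>l\<in>UNIV. \<bar>?M $ l $ p l\<bar>)"
      by (simp add: abs_mult abs_prod sign_def)
    also have "\<dots> = \<bar>?M $ j $ p j\<bar> * (\<Prod>l\<in>UNIV - {j}. \<bar>?M $ l $ p l\<bar>)"
      by (rule prod.remove) auto
    also have "\<dots> \<le> 1 * (\<Prod>l\<in>UNIV - {j}. norm (b l))"
      using True by (intro mult_mono prod_mono prod_nonneg)
        (auto simp: axis_def component_le_norm_cart)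
    finally show ?thesis by simp
  next
    case False
    obtain l where l: "p l = i" using permutes_surj[OF p] by (metis surjD)
    then have "?M $ l $ p l = 0" using False by (auto simp: axis_def)
    then have "(\<Prod>l\<in>UNIV. ?M $ l $ p l) = 0" by (intro prod_zero bexI[of _ l]) simp_all
    then have "\<bar>of_int (sign p) * (\<Prod>l\<in>UNIV. ?M $ l $ p l)\<bar> = 0" by simp
    then show ?thesis by (metis prod_nonneg norm_ge_zero)
  qed
  have "\<bar>det ?M\<bar> \<le> (\<Sum>p | p permutes (UNIV :: 'n set). (\<Prod>l\<in>UNIV - {j}. norm (b l)))"
    unfolding det_def by (intro order_trans[OF sum_abs] sum_mono leibniz_term) auto
  also have "\<dots> = fact CARD('n) * (\<Prod>l\<in>UNIV - {j}. norm (b l))"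
    by (simp add: card_permutations)
  finally show ?thesis unfolding eq by (simp add: abs_divide divide_right_mono)
qed

subsection \<open>Lattice points and reduced bases\<close>

definition hits :: "nat \<Rightarrow> (real ^ 'n::{finite,linorder}) set \<Rightarrow> (real, 'n) vec \<Rightarrow> bool" where
  "hits k \<Lambda> v \<longleftrightarrow> (\<exists>Z \<in> exterior_lattice k \<Lambda>. Z \<noteq> 0 \<and> Z \<in> parallelepiped k v)"

text \<open>Coordinate \<open>i\<close> is the product of the other \<open>v $ j\<close>, that is,
  the bound of the box of order \<open>d - 1\<close> at the index set omitting \<open>i\<close>.
  Boxes of order \<open>d - 1\<close> thus correspond to boxes of order 1 in the dual.\<close>

definition complementary :: "real ^ 'n \<Rightarrow> real ^ 'n" where
  "complementary v = (\<chi> i. (\<Prod>j\<in>UNIV. v $ j) / v $ i)"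

lemma hits_mono:
  assumes "hits k \<Lambda> v" "\<And>i. \<bar>v $ i\<bar> \<le> \<bar>w $ i\<bar>"
  shows "hits k \<Lambda> w"
proof -
  have "(\<Prod>i\<in>I. \<bar>v $ i\<bar>) \<le> (\<Prod>i\<in>I. \<bar>w $ i\<bar>)" for I using assms(2) by (intro prod_mono) auto
  then show ?thesis
    using assms(1) unfolding hits_def parallelepiped_def by simp (meson order_trans)
qed

text \<open>The wedge of the vectors in \<open>J\<close> is the witness. Dilating \<open>v\<close>
  by \<open>t\<close> multiplies every bound of order \<open>k\<close> by \<open>t ^ k\<close>,
  which absorbs the Leibniz factor and the product of the \<open>r j\<close>.\<close>

lemma wedge_hits:
  fixes b :: "'m \<Rightarrow> real ^ 'n::{finite,linorder}"
  assumes dual: "\<And>i j. b i \<bullet> c j = (if i = j then 1 else 0)"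
    and b: "range b \<subseteq> \<Lambda>" and bound: "\<And>j i. \<bar>b j $ i\<bar> \<le> r j * v $ i" and v: "\<And>i. v $ i > 0"
    and J: "finite J" "card J = k" and t: "t > 0" "fact k * (\<Prod>j\<in>J. r j) \<le> t ^ k"
  shows "hits k \<Lambda> (t *\<^sub>R v)"
proof -
  obtain xs where xs: "set xs = J" "distinct xs" "length xs = k"
    using finite_distinct_list[OF J(1)] J(2) distinct_card by metis
  have "\<bar>wedge (map b xs) $ I\<bar> \<le> (\<Prod>i\<in>I. \<bar>(t *\<^sub>R v) $ i\<bar>)" if I: "card I = k" for I
  proof -
    have "\<bar>wedge (map b xs) $ I\<bar> \<le> fact k * (\<Prod>j\<in>J. r j) * (\<Prod>i\<in>I. v $ i)"
      using abs_wedge_le[OF bound _ xs(2)] xs I v by (simp add: less_imp_le)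
    also have "\<dots> \<le> t ^ k * (\<Prod>i\<in>I. v $ i)"
      using t v by (intro mult_right_mono prod_nonneg) (auto simp: less_imp_le)
    also have "\<dots> = (\<Prod>i\<in>I. \<bar>(t *\<^sub>R v) $ i\<bar>)"
      using t(1) v I by (simp add: prod.distrib abs_mult abs_of_pos)
    finally show ?thesis .
  qed
  then have "wedge (map b xs) \<in> parallelepiped k (t *\<^sub>R v)"
    using wedge_in_exterior_power[of "map b xs"] xs by (simp add: parallelepiped_def)
  moreover have "wedge (map b xs) \<in> exterior_lattice k \<Lambda>"
    unfolding exterior_lattice_def using xs b
    by (intro group_closure.base) (use b in \<open>fastforce intro!: exI[of _ "map b xs"]\<close>)
  ultimately show ?thesis
    using wedge_nonzero[OF dual xs(2)] by (auto simp: hits_def)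
qed

text \<open>Some wedge of the \<open>c j\<close> pairs with the lattice point to a nonzero integer,
  hence at least 1 in absolute value. The factor \<open>2 ^ CARD('n)\<close> counts all coordinates
  of the exterior algebra. It is applied with \<open>u = 1 / v\<close>, \<open>q = 1\<close> to the
  lattice and with \<open>u = v\<close>, \<open>q\<close> the product of the coordinates of
  \<open>v\<close>, to the dual.\<close>

lemma hits_pairing:
  fixes c :: "'m \<Rightarrow> real ^ 'n::{finite,linorder}"
  assumes hits: "hits k \<Lambda> v" and span: "span (range c) = UNIV"
    and int: "\<And>j z. z \<in> \<Lambda> \<Longrightarrow> z \<bullet> c j \<in> \<int>"
    and bound: "\<And>j i. \<bar>c j $ i\<bar> \<le> r j * u i" and r: "\<And>j. r j \<ge> 0" and u: "\<And>i. u i \<ge> 0"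
    and q: "\<And>I. card I = k \<Longrightarrow> (\<Prod>i\<in>I. \<bar>v $ i\<bar>) * (\<Prod>i\<in>I. u i) \<le> q" "q \<ge> 0"
  shows "\<exists>J. card J = k \<and> 1 \<le> 2 ^ CARD('n) * (fact k * (\<Prod>j\<in>J. r j) * q)"
proof -
  obtain Z where Z: "Z \<in> exterior_lattice k \<Lambda>" "Z \<noteq> 0" "Z \<in> parallelepiped k v"
    using hits by (auto simp: hits_def)
  then have Zp: "Z \<in> exterior_power k" by (simp add: parallelepiped_def)
  obtain xs where xs: "length xs = k" "distinct xs" "Z \<bullet> wedge (map c xs) \<noteq> 0"
    using exterior_power_wedge_pairing_nonzero[OF Zp Z(2) span] by blast
  have "Z \<bullet> wedge (map c xs) \<in> \<int>"
    using inner_wedge_dual_Ints[OF Z(1), of "map c xs"] xs(1) int by auto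
  then have "1 \<le> \<bar>Z \<bullet> wedge (map c xs)\<bar>"
    using xs(3) by (rule Ints_nonzero_abs_ge1)
  also have "\<dots> \<le> (\<Sum>I\<in>UNIV. \<bar>Z $ I * wedge (map c xs) $ I\<bar>)"
    unfolding inner_vec_def by (simp add: sum_abs)
  also have "\<dots> \<le> of_nat (card (UNIV :: 'n set set)) * (fact k * (\<Prod>j\<in>set xs. r j) * q)"
  proof (rule sum_bounded_above)
    fix I :: "'n set"
    show "\<bar>Z $ I * wedge (map c xs) $ I\<bar> \<le> fact k * (\<Prod>j\<in>set xs. r j) * q"
    proof (cases "card I = k")
      case True
      have "\<bar>Z $ I * wedge (map c xs) $ I\<bar> \<le>
          (\<Prod>i\<in>I. \<bar>v $ i\<bar>) * (fact k * (\<Prod>j\<in>set xs. r j) * (\<Prod>i\<in>I. u i))"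
        unfolding abs_mult
        using Z(3) True abs_wedge_le[OF bound u xs(2)] xs(1)
        by (intro mult_mono prod_nonneg) (auto simp: parallelepiped_def)
      also have "\<dots> = fact k * (\<Prod>j\<in>set xs. r j) * ((\<Prod>i\<in>I. \<bar>v $ i\<bar>) * (\<Prod>i\<in>I. u i))"
        by simp
      also have "\<dots> \<le> fact k * (\<Prod>j\<in>set xs. r j) * q"
        using q(1)[OF True] r by (intro mult_left_mono mult_nonneg_nonneg prod_nonneg) auto
      finally show ?thesis .
    next
      case False
      then have "Z $ I = 0" using Zp by (simp add: exterior_power_def)
      then show ?thesis using r q(2) by (simp add: prod_nonneg)
    qed
  qed
  also have "card (UNIV :: 'n set set) = 2 ^ CARD('n)"
    using card_Pow[of "UNIV :: 'n set"] by (simp add: Pow_UNIV)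
  finally show ?thesis
    using xs distinct_card[OF xs(2)] by (intro exI[of _ "set xs"]) simp
qed

lemma biorthogonal_span:
  fixes b c :: "'n::finite \<Rightarrow> real ^ 'n"
  assumes "\<And>i j. b i \<bullet> c j = (if i = j then 1 else 0)"
  shows "span (range c) = UNIV"
proof -
  let ?B = "\<chi> i. b i" and ?C = "\<chi> i j. c j $ i"
  have "?B ** ?C = mat 1"
    using assms by (simp add: vec_eq_iff matrix_matrix_mult_def mat_def inner_vec_def)
  then have CB: "?C ** ?B = mat 1" using matrix_left_right_inverse by blast
  have "x \<in> span (range c)" for x
  proof -
    have "x = ?C *v (?B *v x)" by (simp add: matrix_vector_mul_assoc CB)
    also have "\<dots> = (\<Sum>j\<in>UNIV. (?B *v x) $ j *\<^sub>R c j)"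
      by (simp add: vec_eq_iff matrix_vector_mult_def mult.commute)
    finally show ?thesis
      by (metis (no_types, lifting) rangeI span_base span_scale span_sum)
  qed
  then show ?thesis by auto
qed

text \<open>The scaling \<open>D\<close> turns the box into the unit cube; the scaled lattice is
  reduced there and carried back by \<open>E\<close>. Scaling the dual family the opposite way
  preserves the pairing, so Cramer's bound acquires the factor \<open>1 / v $ i\<close>, and the
  determinant \<open>1 / V\<close> contributes \<open>V\<close>.\<close>

lemma reduced_basis:
  fixes v :: "real ^ 'n::finite"
  assumes A: "lattice_basis A \<Lambda>" "\<bar>det A\<bar> = 1" and v: "\<And>i. v $ i > 0"
  defines "V \<equiv> \<Prod>i\<in>UNIV. v $ i"
  obtains b c :: "'n \<Rightarrow> real ^ 'n" and n :: "'n \<Rightarrow> real"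
    where "range b \<subseteq> \<Lambda>" "range c \<subseteq> dual_lattice \<Lambda>"
    "\<And>i j. b i \<bullet> c j = (if i = j then 1 else 0)" "\<And>j. n j > 0"
    "(\<Prod>j\<in>UNIV. n j) * V \<le> 2 ^ (CARD('n))\<^sup>2"
    "\<And>j i. \<bar>b j $ i\<bar> \<le> n j * v $ i"
    "\<And>j i. \<bar>c j $ i\<bar> \<le> fact CARD('n) * (\<Prod>l\<in>UNIV - {j}. n l) * V / v $ i"
proof -
  have V: "V > 0" using v by (simp add: V_def prod_pos)
  define D where "D x = (\<chi> i. x $ i / v $ i)" for x :: "real ^ 'n"
  define E where "E x = (\<chi> i. x $ i * v $ i)" for x :: "real ^ 'n"
  have ED: "E (D x) = x" for x using v by (simp add: D_def E_def vec_eq_iff less_imp_neq[THEN not_sym])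
  have linE: "linear E" by (rule linearI) (auto simp: E_def vec_eq_iff algebra_simps)
  define a where "a i = D (column i A)" for i
  have "transpose (\<chi> i. a i) = (\<chi> j. (1 / v $ j) *s A $ j)"
    by (simp add: transpose_def a_def D_def column_def vec_eq_iff)
  then have "det (\<chi> i. a i) = (\<Prod>j\<in>UNIV. 1 / v $ j) * det (\<chi> j. A $ j)"
    using det_rows_mul[of "\<lambda>j. 1 / v $ j" "\<lambda>j. A $ j"] by (metis det_transpose)
  then have det_a: "\<bar>det (\<chi> i. a i)\<bar> = 1 / V"
    using A(2) V by (simp add: V_def prod_dividef abs_mult)
  then have "det (\<chi> i. a i) \<noteq> 0" using V by auto
  from reduced_family[OF this, of UNIV] obtain b where b: "transvections UNIV a b"
    and prod_b: "(\<Prod>i\<in>UNIV. norm (b i)) \<le> 2 ^ (CARD('n))\<^sup>2 * (1 / V)"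
    using det_a by auto
  have det_b: "\<bar>det (\<chi> i. b i)\<bar> = 1 / V" using transvections_det[OF b] det_a by simp
  then have nz: "det (\<chi> i. b i) \<noteq> 0" using V by auto
  then obtain C where C: "(\<chi> i. b i) ** C = mat 1"
    using invertible_det_nz[of "\<chi> i. b i"] by (auto simp: invertible_def)
  define c where "c j = column j C" for j
  have dual: "b i \<bullet> c j = (if i = j then 1 else 0)" for i j
    using arg_cong[OF C, of "\<lambda>M. M $ i $ j"]
    by (simp add: matrix_matrix_mult_def mat_def inner_vec_def c_def column_def)
  define n where "n j = norm (b j)" for j
  have n: "n j > 0" for j using dual[of j j] by (auto simp: n_def)
  define b0 where "b0 i = E (b i)" for i
  define c0 where "c0 j = D (c j)" for j
  have dual0: "b0 i \<bullet> c0 j = (if i = j then 1 else 0)" for i j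
    using dual[of i j] v
    by (simp add: b0_def c0_def D_def E_def inner_vec_def less_imp_neq[THEN not_sym])
  have tv: "transvections UNIV (\<lambda>i. column i A) b0"
    using transvections_linear[OF b linE] by (simp add: a_def ED b0_def[abs_def])
  have \<Lambda>: "\<Lambda> = range (\<lambda>m :: int ^ 'n. A *v (\<chi> i. real_of_int (m $ i)))"
    using A by (simp add: lattice_basis_def)
  have \<Lambda>_add: "x + real_of_int k *\<^sub>R y \<in> \<Lambda>" if "x \<in> \<Lambda>" "y \<in> \<Lambda>" for x y k
  proof -
    obtain m l :: "int ^ 'n" where "x = A *v (\<chi> i. real_of_int (m $ i))"
      "y = A *v (\<chi> i. real_of_int (l $ i))" using \<open>x \<in> \<Lambda>\<close> \<open>y \<in> \<Lambda>\<close> \<Lambda> by auto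
    then have "x + real_of_int k *\<^sub>R y = A *v (\<chi> i. real_of_int ((\<chi> i. m $ i + k * l $ i) $ i))"
      by (simp add: vec_eq_iff matrix_vector_mult_def algebra_simps sum.distrib sum_distrib_left)
    then show ?thesis using \<Lambda> by blast
  qed
  have col: "column i A \<in> \<Lambda>" for i
  proof -
    have "column i A = A *v (\<chi> j. real_of_int ((axis i 1 :: int ^ 'n) $ j))"
      using matrix_vector_mult_basis[of A i]
      by (simp add: axis_def if_distrib[of real_of_int] cong: if_cong)
    then show ?thesis using \<Lambda> by blast
  qed
  have b0\<Lambda>: "range b0 \<subseteq> \<Lambda>"
    using transvections_subgroup_iff[OF tv \<Lambda>_add] col by auto
  have c0\<Lambda>: "range c0 \<subseteq> dual_lattice \<Lambda>"
  proof -
    have "c0 j \<bullet> z \<in> \<int>" if z: "z \<in> \<Lambda>" for j z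
    proof -
      have "(\<forall>i\<in>UNIV. column i A \<in> {x. c0 j \<bullet> x \<in> \<int>}) \<longleftrightarrow> (\<forall>i\<in>UNIV. b0 i \<in> {x. c0 j \<bullet> x \<in> \<int>})"
        by (rule transvections_subgroup_iff[OF tv]) (auto simp: inner_add_right)
      moreover have "c0 j \<bullet> b0 i \<in> \<int>" for i
        using dual0[of i j] by (simp add: inner_commute[of "c0 j"])
      ultimately have "\<forall>i\<in>UNIV. column i A \<in> {x. c0 j \<bullet> x \<in> \<int>}" by simp
      then have col_int: "c0 j \<bullet> column i A \<in> \<int>" for i by simp
      obtain m :: "int ^ 'n" where "z = A *v (\<chi> i. real_of_int (m $ i))" using z \<Lambda> by auto
      then have "z = (\<Sum>i\<in>UNIV. real_of_int (m $ i) *\<^sub>R column i A)"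
        by (simp add: matrix_mult_sum scalar_mult_eq_scaleR)
      then show ?thesis using col_int by (auto simp: inner_sum_right intro!: Ints_sum Ints_mult)
    qed
    then show ?thesis by (auto simp: dual_lattice_def)
  qed
  have "\<bar>b0 j $ i\<bar> \<le> n j * v $ i" for j i
    using component_le_norm_cart[of "b j" i] v[of i]
    by (simp add: b0_def E_def n_def abs_mult mult_right_mono)
  moreover have "\<bar>c0 j $ i\<bar> \<le> fact CARD('n) * (\<Prod>l\<in>UNIV - {j}. n l) * V / v $ i" for j i
    using cramer_dual_bound[of b c j i, OF dual nz] v[of i] V
    by (simp add: c0_def D_def n_def det_b divide_right_mono)
  moreover have "(\<Prod>j\<in>UNIV. n j) * V \<le> 2 ^ (CARD('n))\<^sup>2"
    using prod_b V by (simp add: n_def field_simps)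
  ultimately show ?thesis
    by (intro that[OF b0\<Lambda> c0\<Lambda> dual0 n])
qed

text \<open>From here on the lattice enters only through products of the \<open>n j\<close>, with
  one constant valid for all \<open>v\<close> and all orders. The last two clauses treat the dual
  through the same \<open>n j\<close>.\<close>

lemma reduced_profile:
  fixes \<Lambda> :: "(real ^ 'n::{finite,linorder}) set"
  assumes "full_rank_lattice \<Lambda>" "covolume \<Lambda> = 1"
  shows "\<exists>C\<ge>1. \<forall>v. (\<forall>i. v $ i > 0) \<longrightarrow> (\<exists>n :: 'n \<Rightarrow> real. (\<forall>j. n j > 0) \<and>
     (\<Prod>j\<in>UNIV. n j) * (\<Prod>i\<in>UNIV. v $ i) \<le> C \<and>
     (\<forall>k. hits k \<Lambda> v \<longrightarrow> (\<exists>J. card J = k \<and> (\<Prod>j\<in>J. n j) \<le> C)) \<and>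
     (\<forall>J t. t > 0 \<longrightarrow> C * (\<Prod>j\<in>J. n j) \<le> t ^ card J \<longrightarrow> hits (card J) \<Lambda> (t *\<^sub>R v)) \<and>
     (hits 1 (dual_lattice \<Lambda>) (complementary v) \<longrightarrow> (\<exists>j. 1 \<le> C * (\<Prod>i\<in>UNIV. v $ i) * n j)) \<and>
     (\<forall>j t. t > 0 \<longrightarrow> C * (\<Prod>l\<in>UNIV - {j}. n l) \<le> t \<longrightarrow>
        hits 1 (dual_lattice \<Lambda>) (t *\<^sub>R complementary v)))"
  (is "\<exists>C\<ge>1. \<forall>v. ?pos v \<longrightarrow> (\<exists>n. ?P C v n)")
proof -
  obtain A where A: "lattice_basis A \<Lambda>" using assms(1) by (auto simp: full_rank_lattice_def)
  have det: "\<bar>det A\<bar> = 1" using covolume_eq[OF A] assms(2) by simp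
  let ?d = "CARD('n)"
  define F where "F = (fact ?d :: real)"
  define C0 where "C0 = (2 :: real) ^ ?d\<^sup>2"
  \<comment> \<open>The power of 2 counts coordinates, the single \<open>F\<close> bounds the
    Leibniz terms of a wedge, and \<open>F * C0\<close> bounds each of at most \<open>d\<close> dual
    vectors.\<close>
  define C where "C = 2 ^ ?d * (F * (F * C0) ^ ?d)"
  have F: "F \<ge> 1" by (simp add: F_def)
  have C0: "C0 \<ge> 1" by (simp add: C0_def)
  have FC0: "F * C0 \<ge> 1" using mult_mono[OF F C0] F by simp
  have "?d \<noteq> 0" by simp
  then have pw: "F * C0 \<le> (F * C0) ^ ?d" using FC0 self_le_power[of "F * C0" ?d] by simp
  have p2: "(2 :: real) ^ ?d \<ge> 1" by simp
  have C1: "C \<ge> F * C0" and C2: "C \<ge> 2 ^ ?d"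
  proof -
    have "1 * (1 * (F * C0)) \<le> 2 ^ ?d * (F * (F * C0) ^ ?d)"
      using F FC0 pw p2 by (intro mult_mono) auto
    then show "C \<ge> F * C0" by (simp add: C_def)
    have "2 ^ ?d * (1 * 1) \<le> 2 ^ ?d * (F * (F * C0) ^ ?d)"
      using F FC0 pw by (intro mult_mono) auto
    then show "C \<ge> 2 ^ ?d" by (simp add: C_def)
  qed
  have CF: "C \<ge> F" "C \<ge> C0" "C \<ge> 1"
    using C1 mult_left_mono[OF C0, of F] mult_right_mono[OF F, of C0] F C0 by linarith+
  show ?thesis
  proof (intro exI[of _ C] conjI allI impI)
    show "C \<ge> 1" by fact
    fix v :: "(real, 'n) vec" assume v: "\<forall>i. v $ i > 0"
    define V where "V = (\<Prod>i\<in>UNIV. v $ i)"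
    have V: "V > 0" using v by (simp add: V_def prod_pos)
    obtain b c :: "'n \<Rightarrow> (real, 'n) vec" and n :: "'n \<Rightarrow> real" where b\<Lambda>: "range b \<subseteq> \<Lambda>" and c\<Lambda>: "range c \<subseteq> dual_lattice \<Lambda>"
      and dual: "\<And>i j. b i \<bullet> c j = (if i = j then 1 else 0)" and n: "\<And>j. n j > 0"
      and prod_n: "(\<Prod>j\<in>UNIV. n j) * V \<le> C0"
      and b: "\<And>j i. \<bar>b j $ i\<bar> \<le> n j * v $ i"
      and c: "\<And>j i. \<bar>c j $ i\<bar> \<le> F * (\<Prod>l\<in>UNIV - {j}. n l) * V / v $ i"
      by (rule reduced_basis[OF A det spec[OF v], folded V_def C0_def F_def]) (rule that)
    have dual': "c i \<bullet> b j = (if i = j then 1 else 0)" for i j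
      using dual[of j i] by (auto simp: inner_commute)
    have w: "complementary v $ i = V / v $ i" for i by (simp add: complementary_def V_def)
    have wpos: "complementary v $ i > 0" for i using v V w by simp
    show "\<exists>n. ?P C v n"
    proof (intro exI[of _ n] conjI allI impI)
      show "n j > 0" for j by fact
      show "(\<Prod>j\<in>UNIV. n j) * (\<Prod>i\<in>UNIV. v $ i) \<le> C"
        using prod_n CF by (simp add: V_def)
    next
      fix k assume hit: "hits k \<Lambda> v"
      \<comment> \<open>Hermite's bound replaces the product of the other norms in Cramer's estimate
        by \<open>C0 / (n j * V)\<close>.\<close>
      define r where "r j = F * C0 / n j" for j
      have bound: "\<bar>c j $ i\<bar> \<le> r j * (1 / v $ i)" for j i
      proof -
        have "(\<Prod>l\<in>UNIV. n l) = n j * (\<Prod>l\<in>UNIV - {j}. n l)" by (rule prod.remove) auto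
        then have "(\<Prod>l\<in>UNIV - {j}. n l) * V \<le> C0 / n j"
          using prod_n n[of j] by (simp add: field_simps)
        then have "F * ((\<Prod>l\<in>UNIV - {j}. n l) * V) \<le> F * (C0 / n j)"
          using F by (intro mult_left_mono) auto
        then have "F * (\<Prod>l\<in>UNIV - {j}. n l) * V / v $ i \<le> r j / v $ i"
          using v by (intro divide_right_mono) (auto simp: r_def less_imp_le)
        then show ?thesis using c[of j i] by simp
      qed
      have "\<exists>J. card J = k \<and> 1 \<le> 2 ^ ?d * (fact k * (\<Prod>j\<in>J. r j) * 1)"
      proof (rule hits_pairing[OF hit biorthogonal_span[OF dual] _ bound])
        show "z \<bullet> c j \<in> \<int>" if "z \<in> \<Lambda>" for z j
          using subsetD[OF c\<Lambda> rangeI[of c j]] that by (simp add: dual_lattice_def inner_commute)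
        show "r j \<ge> 0" for j using F C0 n[of j] by (simp add: r_def)
        show "1 / v $ i \<ge> 0" for i using spec[OF v, of i] by simp
        have "(\<Prod>i\<in>I. \<bar>v $ i\<bar>) * (\<Prod>i\<in>I. 1 / v $ i) = 1" for I
          using v by (simp add: prod.distrib[symmetric] less_imp_neq[THEN not_sym] abs_of_pos)
        then show "(\<Prod>i\<in>I. \<bar>v $ i\<bar>) * (\<Prod>i\<in>I. 1 / v $ i) \<le> 1" for I by simp
      qed simp
      then obtain J where J: "card J = k" "1 \<le> 2 ^ ?d * (fact k * (\<Prod>j\<in>J. r j) * 1)" by blast
      have k: "k \<le> ?d" using J(1) by (metis card_mono finite subset_UNIV)
      have pos: "(\<Prod>j\<in>J. n j) > 0" using n by (simp add: prod_pos)
      have "(\<Prod>j\<in>J. r j) = (F * C0) ^ k / (\<Prod>j\<in>J. n j)"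
        by (simp add: r_def prod_dividef J(1))
      then have "1 \<le> 2 ^ ?d * (fact k * (F * C0) ^ k) / (\<Prod>j\<in>J. n j)"
        using J(2) by simp
      then have "(\<Prod>j\<in>J. n j) \<le> 2 ^ ?d * (fact k * (F * C0) ^ k)"
        using pos by (simp only: le_divide_eq_1_pos)
      also have "\<dots> \<le> C"
        unfolding C_def
      proof (intro mult_left_mono mult_mono)
        show "fact k \<le> F" unfolding F_def using k by (rule fact_mono)
        show "(F * C0) ^ k \<le> (F * C0) ^ ?d" using k FC0 by (rule power_increasing)
      qed (use F FC0 in simp_all)
      finally show "\<exists>J. card J = k \<and> (\<Prod>j\<in>J. n j) \<le> C" using J(1) by blast
    next
      fix J t assume t: "t > (0 :: real)" "C * (\<Prod>j\<in>J. n j) \<le> t ^ card J"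
      have "fact (card J) \<le> F" unfolding F_def by (intro fact_mono card_mono) auto
      then have "fact (card J) * (\<Prod>j\<in>J. n j) \<le> C * (\<Prod>j\<in>J. n j)"
        using CF n by (intro mult_right_mono prod_nonneg) (simp_all add: less_imp_le)
      then have "fact (card J) * (\<Prod>j\<in>J. n j) \<le> t ^ card J" using t(2) by linarith
      then show "hits (card J) \<Lambda> (t *\<^sub>R v)"
        using spec[OF v] t by (intro wedge_hits[OF dual b\<Lambda> b]) auto
    next
      assume hit: "hits 1 (dual_lattice \<Lambda>) (complementary v)"
      have "\<exists>J. card J = 1 \<and> 1 \<le> 2 ^ ?d * (fact 1 * (\<Prod>j\<in>J. n j) * V)"
      proof (rule hits_pairing[OF hit biorthogonal_span[OF dual'] _ b])
        show "z \<bullet> b j \<in> \<int>" if "z \<in> dual_lattice \<Lambda>" for z j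
          using subsetD[OF b\<Lambda> rangeI[of b j]] that by (simp add: dual_lattice_def)
        show "n j \<ge> 0" for j using n[of j] by simp
        show "v $ i \<ge> 0" for i using spec[OF v, of i] by simp
        show "V \<ge> 0" using V by simp
        show "(\<Prod>i\<in>I. \<bar>complementary v $ i\<bar>) * (\<Prod>i\<in>I. v $ i) \<le> V" if I: "card I = 1" for I
        proof -
          obtain i where "I = {i}" using card_1_singletonE[OF I] by blast
          then show ?thesis using spec[OF v, of i] V by (simp add: w abs_of_pos)
        qed
      qed
      then obtain J where J: "card J = 1" "1 \<le> 2 ^ ?d * (fact 1 * (\<Prod>j\<in>J. n j) * V)" by blast
      obtain j where "J = {j}" using card_1_singletonE[OF J(1)] by blast
      then have "1 \<le> 2 ^ ?d * (n j * V)" using J by simp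
      also have "\<dots> \<le> C * (n j * V)" using C2 n[of j] V by (intro mult_right_mono) auto
      finally show "\<exists>j. 1 \<le> C * (\<Prod>i\<in>UNIV. v $ i) * n j"
        by (intro exI[of _ j]) (simp add: V_def mult_ac)
    next
      fix j t assume t: "t > (0 :: real)" "C * (\<Prod>l\<in>UNIV - {j}. n l) \<le> t"
      have "F * (\<Prod>l\<in>UNIV - {j}. n l) \<le> C * (\<Prod>l\<in>UNIV - {j}. n l)"
        using CF n by (intro mult_right_mono prod_nonneg) (simp_all add: less_imp_le)
      then have "F * (\<Prod>l\<in>UNIV - {j}. n l) \<le> t" using t(2) by linarith
      then show "hits 1 (dual_lattice \<Lambda>) (t *\<^sub>R complementary v)"
        using c wpos t
        by (intro wedge_hits[OF dual' c\<Lambda>, where r = "\<lambda>j. F * (\<Prod>l\<in>UNIV - {j}. n l)" and J = "{j}"])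
          (simp_all add: w)
    qed
  qed
qed

subsection \<open>Logarithms of the means\<close>

lemma geo_mean_pos:
  fixes v :: "real ^ 'n::finite"
  assumes "\<And>i. v $ i > 0" shows "geo_mean v > 0"
  unfolding geo_mean_def using assms by (intro prod_pos) (simp add: less_imp_neq[THEN not_sym])

lemma ln_abs_powr:
  fixes x :: real
  assumes "x > 0" shows "ln (\<bar>x\<bar> powr a) = a * ln x"
  using assms by (simp add: ln_powr)

lemma sum_ln_eq_geo_mean:
  fixes v :: "real ^ 'n::finite"
  assumes "\<And>i. v $ i > 0"
  shows "(\<Sum>i\<in>UNIV. ln (v $ i)) = real CARD('n) * ln (geo_mean v)"
proof -
  have "ln (geo_mean v) = (\<Sum>i\<in>UNIV. ln (\<bar>v $ i\<bar> powr (1 / real CARD('n))))"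
    unfolding geo_mean_def using assms by (intro ln_prod) (auto simp: less_imp_neq[THEN not_sym])
  also have "\<dots> = (\<Sum>i\<in>UNIV. ln (v $ i) / real CARD('n))"
  proof (rule sum.cong[OF refl])
    fix i show "ln (\<bar>v $ i\<bar> powr (1 / real CARD('n))) = ln (v $ i) / real CARD('n)"
      unfolding ln_abs_powr[OF assms] by simp
  qed
  also have "\<dots> = (\<Sum>i\<in>UNIV. ln (v $ i)) / real CARD('n)" by (simp add: sum_divide_distrib)
  finally have eq: "ln (geo_mean v) = (\<Sum>i\<in>UNIV. ln (v $ i)) / real CARD('n)" .
  show ?thesis unfolding eq by simp
qed

text \<open>All later arguments about the maximum use only this description: every
  \<open>k\<close>-subset obeys the bound on its sum of logarithms, and one subset attains
  it.\<close>

lemma max_geo_mean_ln: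
  fixes v :: "real ^ 'n::finite"
  assumes v: "\<And>i. v $ i > 0" and k: "1 \<le> k" "k \<le> CARD('n)"
  shows max_geo_mean_pos: "max_geo_mean k v > 0"
    and sum_ln_le: "card I = k \<Longrightarrow> (\<Sum>i\<in>I. ln (v $ i)) \<le> real k * ln (max_geo_mean k v)"
    and sum_ln_attained: "\<exists>I. card I = k \<and> (\<Sum>i\<in>I. ln (v $ i)) = real k * ln (max_geo_mean k v)"
proof -
  let ?f = "\<lambda>I. \<Prod>i\<in>I. \<bar>v $ i\<bar> powr (1 / real k)"
  let ?A = "{I :: 'n set. card I = k}"
  have fpos: "?f I > 0" for I
  proof (rule prod_pos)
    fix i show "\<bar>v $ i\<bar> powr (1 / real k) > 0" using v[of i] by simp
  qed
  have ln_f: "(\<Sum>i\<in>I. ln (v $ i)) = real k * ln (?f I)" for I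
  proof -
    have "ln (?f I) = (\<Sum>i\<in>I. ln (\<bar>v $ i\<bar> powr (1 / real k)))"
    proof (rule ln_prod[OF finite])
      fix i show "\<bar>v $ i\<bar> powr (1 / real k) \<noteq> 0" using v[of i] by simp
    qed
    also have "\<dots> = (\<Sum>i\<in>I. ln (v $ i) / real k)"
    proof (rule sum.cong[OF refl])
      fix i show "ln (\<bar>v $ i\<bar> powr (1 / real k)) = ln (v $ i) / real k"
        unfolding ln_abs_powr[OF v] by simp
    qed
    also have "\<dots> = (\<Sum>i\<in>I. ln (v $ i)) / real k" by (simp add: sum_divide_distrib)
    finally have eq: "ln (?f I) = (\<Sum>i\<in>I. ln (v $ i)) / real k" .
    show ?thesis unfolding eq using k by simp
  qed
  obtain I0 :: "'n set" where "card I0 = k" by (rule obtain_subset_with_card_n[OF k(2)])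
  then have "?f I0 \<in> ?f ` ?A" by (intro imageI CollectI)
  then have ne: "?f ` ?A \<noteq> {}" by (metis empty_iff)
  have "max_geo_mean k v \<in> ?f ` ?A"
    unfolding max_geo_mean_def by (rule Max_in[OF _ ne]) simp
  then obtain I where I: "max_geo_mean k v = ?f I" "I \<in> ?A" by (rule imageE)
  show pos: "max_geo_mean k v > 0" unfolding I(1) by (rule fpos)
  show "\<exists>I. card I = k \<and> (\<Sum>i\<in>I. ln (v $ i)) = real k * ln (max_geo_mean k v)"
    using I(2) by (intro exI[of _ I] conjI) (simp_all only: ln_f I(1) mem_Collect_eq)
  show "(\<Sum>i\<in>I. ln (v $ i)) \<le> real k * ln (max_geo_mean k v)" if "card I = k" for I
  proof -
    have "?f I \<le> max_geo_mean k v"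
      unfolding max_geo_mean_def using that by (intro Max_ge imageI CollectI) simp_all
    then have "ln (?f I) \<le> ln (max_geo_mean k v)" using fpos[of I] by (rule ln_mono)
    then show ?thesis unfolding ln_f by (intro mult_left_mono) auto
  qed
qed

lemma ln_geo_mean_scale:
  fixes v :: "real ^ 'n::finite"
  assumes "\<And>i. v $ i > 0"
  shows "ln (geo_mean (exp \<tau> *\<^sub>R v)) = \<tau> + ln (geo_mean v)"
proof -
  have "real CARD('n) * ln (geo_mean (exp \<tau> *\<^sub>R v)) = (\<Sum>i\<in>UNIV. ln ((exp \<tau> *\<^sub>R v) $ i))"
    using assms by (intro sum_ln_eq_geo_mean[symmetric]) simp
  also have "\<dots> = real CARD('n) * (\<tau> + ln (geo_mean v))"
    using assms sum_ln_eq_geo_mean[of v]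
    by (simp add: ln_mult less_imp_neq[THEN not_sym] sum.distrib algebra_simps)
  finally show ?thesis by simp
qed

lemma ln_max_geo_mean_scale:
  fixes v :: "real ^ 'n::finite"
  assumes v: "\<And>i. v $ i > 0" and k: "1 \<le> k" "k \<le> CARD('n)"
  shows "ln (max_geo_mean k (exp \<tau> *\<^sub>R v)) = \<tau> + ln (max_geo_mean k v)"
proof -
  have w: "(exp \<tau> *\<^sub>R v) $ i > 0" for i using v by simp
  have sums: "(\<Sum>i\<in>I. ln ((exp \<tau> *\<^sub>R v) $ i)) = real k * \<tau> + (\<Sum>i\<in>I. ln (v $ i))" if "card I = k" for I
    using v that by (simp add: ln_mult less_imp_neq[THEN not_sym] sum.distrib)
  obtain I where I: "card I = k" "(\<Sum>i\<in>I. ln (v $ i)) = real k * ln (max_geo_mean k v)"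
    using sum_ln_attained[OF v k] by blast
  obtain J where J: "card J = k"
    "(\<Sum>i\<in>J. ln ((exp \<tau> *\<^sub>R v) $ i)) = real k * ln (max_geo_mean k (exp \<tau> *\<^sub>R v))"
    using sum_ln_attained[OF w k] by blast
  have "real k * ln (max_geo_mean k (exp \<tau> *\<^sub>R v)) = real k * (\<tau> + ln (max_geo_mean k v))"
    using sum_ln_le[OF w k I(1)] sum_ln_le[OF v k J(1)] sums[OF I(1)] sums[OF J(1)] I(2) J(2)
    by (simp add: algebra_simps)
  then show ?thesis using k by simp
qed

section \<open>Comparison of maximal means\<close>

text \<open>Removing any one index from a maximizing set of size \<open>k + 1\<close> leaves a
  competitor of size \<open>k\<close>; summing over the removed index gives the claim.\<close>

lemma max_geo_mean_succ_le:
  fixes v :: "real ^ 'n::finite"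
  assumes v: "\<And>i. v $ i > 0" and k: "1 \<le> k" "k + 1 \<le> CARD('n)"
  shows "ln (max_geo_mean (k + 1) v) \<le> ln (max_geo_mean k v)"
proof -
  let ?x = "\<lambda>i. ln (v $ i)"
  let ?m = "ln (max_geo_mean k v)"
  obtain I where I: "card I = k + 1" "(\<Sum>i\<in>I. ?x i) = real (k + 1) * ln (max_geo_mean (k + 1) v)"
    using sum_ln_attained[OF v, of "k + 1"] k by auto
  have "(\<Sum>j\<in>I. ?x j) - real k * ?m \<le> ?x i" if "i \<in> I" for i
  proof -
    have "(\<Sum>j\<in>I - {i}. ?x j) \<le> real k * ?m"
      using that I k by (intro sum_ln_le[OF v]) auto
    then show ?thesis using sum.remove[of I i ?x] that by (simp add: card_gt_0_iff)
  qed
  then have "real (card I) * ((\<Sum>j\<in>I. ?x j) - real k * ?m) \<le> (\<Sum>i\<in>I. ?x i)"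
    by (intro sum_bounded_below) auto
  then have "real (k + 1) * (real k * ln (max_geo_mean (k + 1) v)) \<le> real (k + 1) * (real k * ?m)"
    using I by (simp add: algebra_simps)
  then show ?thesis using k by (simp add: mult_le_cancel_left)
qed

text \<open>Adding any outside index to a maximizing set of size \<open>k\<close> gives a competitor
  of size \<open>k + 1\<close>. Summing over all \<open>d - k\<close> outside indices brings in
  their total, which is known from \<open>geo_mean\<close>.\<close>

lemma max_geo_mean_le_succ:
  fixes v :: "real ^ 'n::finite"
  assumes v: "\<And>i. v $ i > 0" and k: "1 \<le> k" "k + 1 \<le> CARD('n)"
  defines "d \<equiv> real CARD('n)"
  shows "real k * (d - real k - 1) * ln (max_geo_mean k v) \<le>
    (d - real k) * (real k + 1) * ln (max_geo_mean (k + 1) v) - d * ln (geo_mean v)"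
proof -
  let ?x = "\<lambda>i. ln (v $ i)"
  obtain I where I: "card I = k" "(\<Sum>i\<in>I. ?x i) = real k * ln (max_geo_mean k v)"
    using sum_ln_attained[OF v, of k] k by auto
  have "?x j \<le> real (k + 1) * ln (max_geo_mean (k + 1) v) - (\<Sum>i\<in>I. ?x i)" if "j \<in> - I" for j
    using sum_ln_le[OF v, of "k + 1" "insert j I"] k I that by simp
  then have "(\<Sum>j\<in>-I. ?x j) \<le>
      real (card (- I)) * (real (k + 1) * ln (max_geo_mean (k + 1) v) - (\<Sum>i\<in>I. ?x i))"
    by (intro sum_bounded_above) auto
  moreover have "real (card (- I)) = d - real k"
    using k I by (simp add: Compl_eq_Diff_UNIV card_Diff_subset of_nat_diff d_def)
  moreover have "(\<Sum>j\<in>-I. ?x j) = d * ln (geo_mean v) - (\<Sum>i\<in>I. ?x i)"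
    using sum.subset_diff[of I UNIV ?x] sum_ln_eq_geo_mean[OF v] by (simp add: Compl_eq_Diff_UNIV d_def)
  ultimately show ?thesis using I(2) by (simp add: algebra_simps)
qed

text \<open>The relation with \<open>geo_mean\<close> fixes the average \<open>L\<close> of the
  logarithms outside a maximizing set \<open>I\<close>. By exchange, members of \<open>I\<close> are
  at least as large as outsiders, hence at least \<open>L\<close>; as their sum is fixed, none can
  be too large.\<close>

lemma ln_coordinate_le:
  fixes v :: "real ^ 'n::finite"
  assumes v: "\<And>i. v $ i > 0" and k: "1 \<le> k" "k < CARD('n)"
    and G: "ln (geo_mean v) = - \<gamma> * ln (max_geo_mean k v)"
  defines "d \<equiv> real CARD('n)"
  shows "ln (v $ i) \<le> (real k + (real k - 1) * (d * \<gamma> + real k) / (d - real k)) * ln (max_geo_mean k v)"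
proof -
  let ?x = "\<lambda>i. ln (v $ i)"
  let ?m = "ln (max_geo_mean k v)"
  obtain I where I: "card I = k" "(\<Sum>i\<in>I. ?x i) = real k * ?m"
    using sum_ln_attained[OF v, of k] k by auto
  have dk: "d - real k > 0" using k by (simp add: d_def)
  have exch: "?x j \<le> ?x i" if ij: "i \<in> I" "j \<notin> I" for i j
  proof -
    have "card (insert j (I - {i})) = k" using ij I k by simp
    then have "(\<Sum>l\<in>insert j (I - {i}). ?x l) \<le> real k * ?m"
      using k by (intro sum_ln_le[OF v]) auto
    then show ?thesis using sum.remove[of I i ?x] ij I by simp
  qed
  \<comment> \<open>Solves \<open>d * ln (geo_mean v) - real k * ?m = (d - real k) * L\<close> for
    \<open>L = - q * ?m\<close>.\<close>
  define q where "q = (d * \<gamma> + real k) / (d - real k)"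
  have q: "(d - real k) * q = d * \<gamma> + real k" using dk by (simp add: q_def)
  define L where "L = - q * ?m"
  have "(d - real k) * L = - ((d - real k) * q) * ?m" by (simp add: L_def)
  then have "(d - real k) * L = - (d * \<gamma> + real k) * ?m" unfolding q .
  then have compl: "(\<Sum>j\<in>-I. ?x j) = (d - real k) * L"
    using sum.subset_diff[of I UNIV ?x] sum_ln_eq_geo_mean[OF v] I(2) G
    by (simp add: Compl_eq_Diff_UNIV d_def algebra_simps)
  have L: "L \<le> ?x i" if i: "i \<in> I" for i
  proof -
    have "(\<Sum>j\<in>-I. ?x j) \<le> real (card (- I)) * ?x i"
      using exch[OF i] by (intro sum_bounded_above) auto
    moreover have "real (card (- I)) = d - real k"
      using k I by (simp add: Compl_eq_Diff_UNIV card_Diff_subset of_nat_diff d_def)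
    ultimately show ?thesis using compl dk by (simp add: mult_le_cancel_left)
  qed
  have top: "?x i \<le> real k * ?m - (real k - 1) * L" if i: "i \<in> I" for i
  proof -
    have "real (card (I - {i})) * L \<le> (\<Sum>j\<in>I - {i}. ?x j)"
      using L by (intro sum_bounded_below) auto
    then show ?thesis using sum.remove[of I i ?x] i I k by (simp add: of_nat_diff)
  qed
  have "?x i \<le> real k * ?m - (real k - 1) * L"
  proof (cases "i \<in> I")
    case False
    obtain l where "l \<in> I" using I(1) k by fastforce
    then show ?thesis using exch[OF _ False] top by (meson order_trans)
  qed (rule top)
  also have "\<dots> = (real k + (real k - 1) * q) * ?m"
    by (simp add: L_def left_diff_distrib distrib_right)
  finally show ?thesis by (simp add: q_def)
qed

text \<open>For \<open>\<gamma> \<ge> 0\<close> the coefficient in \<open>ln_coordinate_le\<close>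
  is positive, so a huge coordinate forces a huge maximal mean.\<close>

lemma max_geo_mean_large:
  assumes k: "1 \<le> k" "k < CARD('n::finite)" and \<gamma>: "\<gamma> \<ge> 0"
  shows "\<exists>T. \<forall>v :: real ^ 'n. (\<forall>i. v $ i > 0) \<longrightarrow> infnorm v > T \<longrightarrow>
    ln (geo_mean v) = - \<gamma> * ln (max_geo_mean k v) \<longrightarrow> ln (max_geo_mean k v) > R"
proof -
  define d where "d = real CARD('n)"
  define a where "a = real k + (real k - 1) * (d * \<gamma> + real k) / (d - real k)"
  have "(real k - 1) * (d * \<gamma> + real k) / (d - real k) \<ge> 0"
    using k \<gamma> by (auto intro!: divide_nonneg_nonneg mult_nonneg_nonneg simp: d_def)
  then have a: "a > 0" using k by (simp add: a_def)
  have "ln (max_geo_mean k v) > R" if v: "\<forall>i. v $ i > 0" and T: "infnorm v > exp (a * R)"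
    and G: "ln (geo_mean v) = - \<gamma> * ln (max_geo_mean k v)" for v :: "real ^ 'n"
  proof -
    have "{\<bar>v $ i\<bar> |i. i \<in> UNIV} = range (\<lambda>i. \<bar>v $ i\<bar>)" by blast
    then have "infnorm v = Max (range (\<lambda>i. \<bar>v $ i\<bar>))"
      using cSup_eq_Max[of "range (\<lambda>i. \<bar>v $ i\<bar>)"] unfolding infnorm_cart by simp
    also have "\<dots> \<in> range (\<lambda>i. \<bar>v $ i\<bar>)" by (intro Max_in) auto
    finally obtain i where "infnorm v = \<bar>v $ i\<bar>" by blast
    then have "infnorm v = v $ i" using spec[OF v, of i] by simp
    then have "a * R < ln (v $ i)" using T spec[OF v, of i] ln_less_cancel_iff[of "exp (a * R)" "v $ i"] by simp
    also have "\<dots> \<le> a * ln (max_geo_mean k v)"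
      unfolding a_def d_def by (rule ln_coordinate_le) (use v k G in auto)
    finally show ?thesis using a by simp
  qed
  then show ?thesis by blast
qed

lemma max_geo_mean_less_infnorm:
  fixes v :: "real ^ 'n::finite"
  assumes v: "\<And>i. v $ i > 0" and k: "1 \<le> k" "k \<le> CARD('n)"
  shows "ln (max_geo_mean k v) < infnorm v"
proof -
  obtain I where I: "card I = k" "(\<Sum>i\<in>I. ln (v $ i)) = real k * ln (max_geo_mean k v)"
    using sum_ln_attained[OF v k] by blast
  have "ln (v $ i) < infnorm v" for i
  proof -
    have "ln (v $ i) < v $ i" using v[of i] by (rule ln_less_self)
    also have "\<dots> \<le> infnorm v" using component_le_infnorm_cart[of v i] v[of i] by simp
    finally show ?thesis .
  qed
  then have "(\<Sum>i\<in>I. ln (v $ i)) < real (card I) * infnorm v"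
    using I(1) k by (intro sum_bounded_above_strict) auto
  then show ?thesis using I k by simp
qed

subsection \<open>Transference of lattice points\<close>

text \<open>
  The \<open>y j\<close> play the role of the logarithms of the successive minima of \<open>\<Lambda>\<close> with respect to the box
  with half-sides \<open>v\<close>, all relations holding up to the additive constant \<open>c\<close>.
\<close>

definition log_profile ::
    "real \<Rightarrow> (real ^ 'n::{finite,linorder}) set \<Rightarrow> (real, 'n) vec \<Rightarrow> ('n \<Rightarrow> real) \<Rightarrow> bool" where
  "log_profile c \<Lambda> v y \<longleftrightarrow>
     (\<Sum>j\<in>UNIV. y j) + real CARD('n) * ln (geo_mean v) \<le> c \<and>
     (\<forall>k. hits k \<Lambda> v \<longrightarrow> (\<exists>J. card J = k \<and> (\<Sum>j\<in>J. y j) \<le> c)) \<and>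
     (\<forall>J \<tau>. c + (\<Sum>j\<in>J. y j) \<le> real (card J) * \<tau> \<longrightarrow> hits (card J) \<Lambda> (exp \<tau> *\<^sub>R v)) \<and>
     (hits 1 (dual_lattice \<Lambda>) (complementary v) \<longrightarrow>
        (\<exists>j. 0 \<le> c + real CARD('n) * ln (geo_mean v) + y j)) \<and>
     (\<forall>j \<tau>. c + (\<Sum>l\<in>UNIV - {j}. y l) \<le> \<tau> \<longrightarrow>
        hits 1 (dual_lattice \<Lambda>) (exp \<tau> *\<^sub>R complementary v))"

lemma log_profile_exists:
  fixes \<Lambda> :: "(real ^ 'n::{finite,linorder}) set"
  assumes "full_rank_lattice \<Lambda>" "covolume \<Lambda> = 1"
  shows "\<exists>c\<ge>0. \<forall>v. (\<forall>i. v $ i > 0) \<longrightarrow> (\<exists>y. log_profile c \<Lambda> v y)"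
proof -
  obtain C where C: "C \<ge> 1" and prof: "\<And>v. (\<forall>i. v $ i > 0) \<Longrightarrow> \<exists>n :: 'n \<Rightarrow> real. (\<forall>j. n j > 0) \<and>
     (\<Prod>j\<in>UNIV. n j) * (\<Prod>i\<in>UNIV. v $ i) \<le> C \<and>
     (\<forall>k. hits k \<Lambda> v \<longrightarrow> (\<exists>J. card J = k \<and> (\<Prod>j\<in>J. n j) \<le> C)) \<and>
     (\<forall>J t. t > 0 \<longrightarrow> C * (\<Prod>j\<in>J. n j) \<le> t ^ card J \<longrightarrow> hits (card J) \<Lambda> (t *\<^sub>R v)) \<and>
     (hits 1 (dual_lattice \<Lambda>) (complementary v) \<longrightarrow> (\<exists>j. 1 \<le> C * (\<Prod>i\<in>UNIV. v $ i) * n j)) \<and>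
     (\<forall>j t. t > 0 \<longrightarrow> C * (\<Prod>l\<in>UNIV - {j}. n l) \<le> t \<longrightarrow>
        hits 1 (dual_lattice \<Lambda>) (t *\<^sub>R complementary v))"
    using reduced_profile[OF assms] by blast
  show ?thesis
  proof (intro exI[of _ "ln C"] conjI allI impI)
    show "ln C \<ge> 0" using C by simp
    fix v :: "(real, 'n) vec" assume "\<forall>i. v $ i > 0"
    then have v: "\<And>i. v $ i > 0" by simp
    let ?V = "\<Prod>i\<in>UNIV. v $ i"
    obtain n :: "'n \<Rightarrow> real" where n: "\<And>j. n j > 0" and
      n1: "(\<Prod>j\<in>UNIV. n j) * ?V \<le> C" and
      n2: "\<And>k. hits k \<Lambda> v \<Longrightarrow> \<exists>J. card J = k \<and> (\<Prod>j\<in>J. n j) \<le> C" and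
      n3: "\<And>J t. t > 0 \<Longrightarrow> C * (\<Prod>j\<in>J. n j) \<le> t ^ card J \<Longrightarrow> hits (card J) \<Lambda> (t *\<^sub>R v)" and
      n4: "hits 1 (dual_lattice \<Lambda>) (complementary v) \<Longrightarrow> \<exists>j. 1 \<le> C * ?V * n j" and
      n5: "\<And>j t. t > 0 \<Longrightarrow> C * (\<Prod>l\<in>UNIV - {j}. n l) \<le> t \<Longrightarrow>
        hits 1 (dual_lattice \<Lambda>) (t *\<^sub>R complementary v)"
      using prof[of v] v by metis
    define y where "y j = ln (n j)" for j
    have npos: "(\<Prod>j\<in>J. n j) > 0" for J using n by (simp add: prod_pos)
    have sum_y: "(\<Sum>j\<in>J. y j) = ln (\<Prod>j\<in>J. n j)" for J
      unfolding y_def using n by (intro ln_prod[symmetric]) (simp_all add: less_imp_neq[THEN not_sym])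
    have V: "?V > 0" using v by (simp add: prod_pos)
    have lnV: "real CARD('n) * ln (geo_mean v) = ln ?V"
      using sum_ln_eq_geo_mean[OF v] v
      by (subst ln_prod) (simp_all add: less_imp_neq[THEN not_sym])
    have "(\<Sum>j\<in>UNIV. y j) + real CARD('n) * ln (geo_mean v) \<le> ln C"
    proof -
      have "(\<Sum>j\<in>UNIV. y j) + real CARD('n) * ln (geo_mean v) = ln ((\<Prod>j\<in>UNIV. n j) * ?V)"
        using npos[of UNIV] V by (simp add: sum_y lnV ln_mult_pos)
      also have "\<dots> \<le> ln C" using n1 npos[of UNIV] V C by (subst ln_le_cancel_iff) auto
      finally show ?thesis .
    qed
    moreover have "\<exists>J. card J = k \<and> (\<Sum>j\<in>J. y j) \<le> ln C" if hit: "hits k \<Lambda> v" for k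
    proof -
      obtain J where "card J = k" "(\<Prod>j\<in>J. n j) \<le> C" using n2[OF hit] by blast
      then show ?thesis using npos[of J] C by (intro exI[of _ J]) (simp add: sum_y)
    qed
    moreover have "hits (card J) \<Lambda> (exp \<tau> *\<^sub>R v)"
      if "ln C + (\<Sum>j\<in>J. y j) \<le> real (card J) * \<tau>" for J \<tau>
    proof (rule n3)
      have "ln (C * (\<Prod>j\<in>J. n j)) \<le> ln (exp \<tau> ^ card J)"
        using that npos[of J] C by (simp add: sum_y ln_mult_pos exp_of_nat_mult[symmetric])
      then show "C * (\<Prod>j\<in>J. n j) \<le> exp \<tau> ^ card J"
        using npos[of J] C by (subst (asm) ln_le_cancel_iff) auto
    qed simp
    moreover have "\<exists>j. 0 \<le> ln C + real CARD('n) * ln (geo_mean v) + y j"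
      if hit: "hits 1 (dual_lattice \<Lambda>) (complementary v)"
    proof -
      obtain j where j: "1 \<le> C * ?V * n j" using n4[OF hit] by blast
      then have "0 \<le> ln (C * ?V * n j)" by simp
      also have "\<dots> = ln C + ln ?V + y j"
        using C V n[of j] by (simp add: ln_mult_pos y_def)
      finally show ?thesis using lnV by auto
    qed
    moreover have "hits 1 (dual_lattice \<Lambda>) (exp \<tau> *\<^sub>R complementary v)"
      if "ln C + (\<Sum>l\<in>UNIV - {j}. y l) \<le> \<tau>" for j \<tau>
    proof (rule n5)
      have "ln (C * (\<Prod>l\<in>UNIV - {j}. n l)) \<le> ln (exp \<tau>)"
        using that npos[of "UNIV - {j}"] C by (simp add: sum_y ln_mult_pos)
      then show "C * (\<Prod>l\<in>UNIV - {j}. n l) \<le> exp \<tau>"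
        using npos[of "UNIV - {j}"] C by (subst (asm) ln_le_cancel_iff) auto
    qed simp
    ultimately show "\<exists>y. log_profile (ln C) \<Lambda> v y"
      unfolding log_profile_def by (intro exI[of _ y]) simp
  qed
qed

lemma
  fixes \<Lambda> :: "(real ^ 'n::{finite,linorder}) set"
  assumes "log_profile c \<Lambda> v y"
  shows log_profile_sum: "(\<Sum>j\<in>UNIV. y j) + real CARD('n) * ln (geo_mean v) \<le> c"
    and log_profile_hits: "hits k \<Lambda> v \<Longrightarrow> \<exists>J. card J = k \<and> (\<Sum>j\<in>J. y j) \<le> c"
    and log_profile_hitsI:
      "c + (\<Sum>j\<in>J. y j) \<le> real (card J) * \<tau> \<Longrightarrow> hits (card J) \<Lambda> (exp \<tau> *\<^sub>R v)"
    and log_profile_dual_hits: "hits 1 (dual_lattice \<Lambda>) (complementary v) \<Longrightarrow>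
      \<exists>j. 0 \<le> c + real CARD('n) * ln (geo_mean v) + y j"
    and log_profile_dual_hitsI: "c + (\<Sum>l\<in>UNIV - {j}. y l) \<le> \<tau> \<Longrightarrow>
      hits 1 (dual_lattice \<Lambda>) (exp \<tau> *\<^sub>R complementary v)"
  using assms unfolding log_profile_def by simp_all

section \<open>Changing the order and passing to the dual\<close>

lemma hits_pred:
  fixes \<Lambda> :: "(real ^ 'n::{finite,linorder}) set"
  assumes "full_rank_lattice \<Lambda>" "covolume \<Lambda> = 1"
  obtains c where "c \<ge> 0" "\<And>v k. (\<And>i. v $ i > 0) \<Longrightarrow> 1 \<le> k \<Longrightarrow>
    hits (k + 1) \<Lambda> v \<Longrightarrow> hits k \<Lambda> (exp c *\<^sub>R v)"
proof -
  obtain c where c: "c \<ge> 0" and prof: "\<And>v. \<forall>i. v $ i > 0 \<Longrightarrow> \<exists>y. log_profile c \<Lambda> v y"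
    using log_profile_exists[OF assms(1,2)] by blast
  show thesis
  \<comment> \<open>One \<open>c\<close> bounds the remaining sum, the other is the loss in turning
    it back into a lattice point.\<close>
  proof (rule that[of "2 * c"])
    show "2 * c \<ge> 0" using c by simp
    fix v :: "(real, 'n) vec" and k
    assume v: "\<And>i. v $ i > 0" and k: "1 \<le> k" and hit: "hits (k + 1) \<Lambda> v"
    obtain y where y: "log_profile c \<Lambda> v y" using prof[of v] v by blast
    obtain J where J: "card J = k + 1" "(\<Sum>j\<in>J. y j) \<le> c" using log_profile_hits[OF y hit] by blast
    then have "J \<noteq> {}" by auto
    then obtain j where j: "j \<in> J" "\<And>i. i \<in> J \<Longrightarrow> y i \<le> y j"
      using obtains_MAX[of J y] Max_ge[of "y ` J"] by (metis finite finite_imageI imageI)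
    have "(\<Sum>i\<in>J - {j}. y i) \<le> c"
    \<comment> \<open>Dropping a negative term raises the sum, but if the largest term is negative
      then so are all others and the rest is at most 0.\<close>
    proof (cases "y j \<ge> 0")
      case True
      then show ?thesis using J(2) sum.remove[of J j y] j(1) by simp
    next
      case False
      then have "(\<Sum>i\<in>J - {j}. y i) \<le> 0"
        using j(2) by (intro sum_nonpos) (meson DiffD1 le_cases order_trans)
      then show ?thesis using c by simp
    qed
    moreover have "1 * (2 * c) \<le> real k * (2 * c)" using k c by (intro mult_right_mono) auto
    moreover have cJ: "card (J - {j}) = k" using J j by simp
    ultimately show "hits k \<Lambda> (exp (2 * c) *\<^sub>R v)"
      using log_profile_hitsI[OF y, of "J - {j}" "2 * c"] by simp
  qed
qed

text \<open>The smallest \<open>y j\<close> outside \<open>J\<close> is at most the average there,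
  and the total of all \<open>y j\<close> is at most \<open>c - d * ln (geo_mean v)\<close>; this
  yields the divisor \<open>d - k\<close>. The divisor \<open>k + 1\<close> appears because a
  dilation acts \<open>k + 1\<close> times on a wedge of that order.\<close>

lemma hits_succ:
  fixes \<Lambda> :: "(real ^ 'n::{finite,linorder}) set"
  assumes "full_rank_lattice \<Lambda>" "covolume \<Lambda> = 1"
  defines "d \<equiv> real CARD('n)"
  obtains c where "c \<ge> 0" "\<And>v k. (\<And>i. v $ i > 0) \<Longrightarrow> 1 \<le> k \<Longrightarrow> k < CARD('n) \<Longrightarrow>
    hits k \<Lambda> v \<Longrightarrow>
    hits (k + 1) \<Lambda> (exp (c - d * ln (geo_mean v) / ((d - real k) * (real k + 1))) *\<^sub>R v)"
proof -
  obtain c where c: "c \<ge> 0" and prof: "\<And>v. \<forall>i. v $ i > 0 \<Longrightarrow> \<exists>y. log_profile c \<Lambda> v y"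
    using log_profile_exists[OF assms(1,2)] by blast
  show thesis
  proof (rule that[of "2 * c"])
    show "2 * c \<ge> 0" using c by simp
    fix v :: "(real, 'n) vec" and k
    assume v: "\<And>i. v $ i > 0" and k: "1 \<le> k" "k < CARD('n)" and hit: "hits k \<Lambda> v"
    obtain y where y: "log_profile c \<Lambda> v y" using prof[of v] v by blast
    obtain J where J: "card J = k" "(\<Sum>j\<in>J. y j) \<le> c" using log_profile_hits[OF y hit] by blast
    then have "J \<noteq> UNIV" using k by auto
    then have "- J \<noteq> {}" by blast
    then obtain j where j: "j \<in> - J" "\<And>i. i \<in> - J \<Longrightarrow> y j \<le> y i"
      using obtains_MIN[of "- J" y] Min_le[of "y ` (- J)"] by (metis finite finite_imageI imageI)
    let ?S = "\<Sum>j\<in>J. y j"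
    define e where "e = d - real k"
    have e: "e \<ge> 1" using k by (simp add: e_def d_def)
    have "real (card (- J)) * y j \<le> (\<Sum>i\<in>- J. y i)"
      using j by (intro sum_bounded_below) auto
    also have "real (card (- J)) = e"
      using k J by (simp add: Compl_eq_Diff_UNIV card_Diff_subset of_nat_diff d_def e_def)
    also have "(\<Sum>i\<in>- J. y i) = (\<Sum>i\<in>UNIV. y i) - ?S"
      using sum.subset_diff[of J UNIV y] by (simp add: Compl_eq_Diff_UNIV)
    finally have "e * y j \<le> c - d * ln (geo_mean v) - ?S"
      using log_profile_sum[OF y] by (simp add: d_def)
    moreover have "(e - 1) * ?S \<le> (e - 1) * c" using e J(2) by (intro mult_left_mono) auto
    ultimately have "e * (?S + y j) \<le> e * c - d * ln (geo_mean v)" by (simp add: algebra_simps)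
    then have "?S + y j \<le> (e * c - d * ln (geo_mean v)) / e"
      using e by (simp add: pos_le_divide_eq mult.commute)
    also have "\<dots> = c - d * ln (geo_mean v) / e" using e by (simp add: diff_divide_distrib)
    finally have "c + (?S + y j) \<le> 2 * c - d * ln (geo_mean v) / e" by simp
    also have "\<dots> \<le> real (k + 1) * (2 * c) - d * ln (geo_mean v) / e"
      using mult_right_mono[of 1 "real (k + 1)" "2 * c"] c by simp
    also have "\<dots> = real (k + 1) * (2 * c - d * ln (geo_mean v) / (e * (real k + 1)))"
    proof -
      have cancel: "K * (X / (e * K)) = X / e" if "K \<noteq> 0" for K X :: real using that by simp
      have "real (k + 1) * (d * ln (geo_mean v) / (e * (real k + 1))) = d * ln (geo_mean v) / e"
        using cancel[of "real (k + 1)" "d * ln (geo_mean v)"] by (simp only: of_nat_add of_nat_1)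
      then show ?thesis by (simp only: right_diff_distrib)
    qed
    finally have "c + (\<Sum>i\<in>insert j J. y i) \<le>
        real (card (insert j J)) * (2 * c - d * ln (geo_mean v) / (e * (real k + 1)))"
      using j(1) J(1) by (simp add: add.commute)
    from log_profile_hitsI[OF y this] show "hits (k + 1) \<Lambda>
       (exp (2 * c - d * ln (geo_mean v) / ((d - real k) * (real k + 1))) *\<^sub>R v)"
      using j(1) J(1) by (simp add: e_def)
  qed
qed

text \<open>A Minkowski type statement: once the geometric mean is normalized, a bounded dilation
  captures a lattice point. At \<open>k = CARD('n)\<close> the wedge of the whole basis works, and
  \<open>hits_pred\<close> descends from there.\<close>

lemma hits_dirichlet:
  fixes \<Lambda> :: "(real ^ 'n::{finite,linorder}) set"
  assumes \<Lambda>: "full_rank_lattice \<Lambda>" "covolume \<Lambda> = 1" and k: "1 \<le> k" "k \<le> CARD('n)"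
  shows "\<exists>c\<ge>0. \<forall>v. (\<forall>i. v $ i > 0) \<longrightarrow> hits k \<Lambda> (exp (c - ln (geo_mean v)) *\<^sub>R v)"
  using k(2,1)
proof (induction k rule: inc_induct)
  case base
  obtain c where c: "c \<ge> 0" and prof: "\<And>v. \<forall>i. v $ i > 0 \<Longrightarrow> \<exists>y. log_profile c \<Lambda> v y"
    using log_profile_exists[OF \<Lambda>] by blast
  have "hits CARD('n) \<Lambda> (exp (2 * c - ln (geo_mean v)) *\<^sub>R v)" if v: "\<forall>i. v $ i > 0" for v
  proof -
    obtain y where y: "log_profile c \<Lambda> v y" using prof[of v] v by blast
    have "1 * (2 * c) \<le> real CARD('n) * (2 * c)" using c by (intro mult_right_mono) auto
    then have "c + (\<Sum>j\<in>UNIV. y j) \<le> real CARD('n) * (2 * c - ln (geo_mean v))"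
      using log_profile_sum[OF y] by (simp add: right_diff_distrib)
    then show ?thesis using log_profile_hitsI[OF y, of UNIV] by simp
  qed
  then show ?case using c by (intro exI[of _ "2 * c"]) auto
next
  case (step m)
  obtain c where c: "c \<ge> 0" "\<forall>v. (\<forall>i. v $ i > 0) \<longrightarrow> hits (Suc m) \<Lambda> (exp (c - ln (geo_mean v)) *\<^sub>R v)"
    using step by auto
  obtain c' where c': "c' \<ge> 0" "\<And>v k. (\<And>i. v $ i > 0) \<Longrightarrow> 1 \<le> k \<Longrightarrow>
    hits (k + 1) \<Lambda> v \<Longrightarrow> hits k \<Lambda> (exp c' *\<^sub>R v)"
    using hits_pred[OF \<Lambda>] by blast
  have "hits m \<Lambda> (exp (c + c' - ln (geo_mean v)) *\<^sub>R v)" if v: "\<forall>i. v $ i > 0" for v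
  proof -
    have "hits m \<Lambda> (exp c' *\<^sub>R (exp (c - ln (geo_mean v)) *\<^sub>R v))"
      using c(2) v step.prems by (intro c'(2)) simp_all
    then show ?thesis by (simp add: exp_add[symmetric] algebra_simps)
  qed
  then show ?case using c c' by (intro exI[of _ "c + c'"]) auto
qed

text \<open>A set \<open>J\<close> of size \<open>d - 1\<close> omits a single \<open>j\<close>, and
  the dual vector of that index is the witness. Conversely, a lower bound on \<open>y j\<close>
  together with the upper bound on the total bounds the sum of the others by
  \<open>2 * c\<close>.\<close>

lemma hits_dual:
  fixes \<Lambda> :: "(real ^ 'n::{finite,linorder}) set"
  assumes "full_rank_lattice \<Lambda>" "covolume \<Lambda> = 1" and d: "CARD('n) \<ge> 2"
  obtains c where "c \<ge> 0"
    "\<And>v. (\<And>i. v $ i > 0) \<Longrightarrow> hits (CARD('n) - 1) \<Lambda> v \<Longrightarrow>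
      hits 1 (dual_lattice \<Lambda>) (exp c *\<^sub>R complementary v)"
    "\<And>v. (\<And>i. v $ i > 0) \<Longrightarrow> hits 1 (dual_lattice \<Lambda>) (complementary v) \<Longrightarrow>
      hits (CARD('n) - 1) \<Lambda> (exp c *\<^sub>R v)"
proof -
  obtain c where c: "c \<ge> 0" and prof: "\<And>v. \<forall>i. v $ i > 0 \<Longrightarrow> \<exists>y. log_profile c \<Lambda> v y"
    using log_profile_exists[OF assms(1,2)] by blast
  show thesis
  proof (rule that[of "3 * c"])
    show "3 * c \<ge> 0" using c by simp
  next
    fix v :: "(real, 'n) vec"
    assume v: "\<And>i. v $ i > 0" and hit: "hits (CARD('n) - 1) \<Lambda> v"
    obtain y where y: "log_profile c \<Lambda> v y" using prof[of v] v by blast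
    obtain J where J: "card J = CARD('n) - 1" "(\<Sum>j\<in>J. y j) \<le> c" using log_profile_hits[OF y hit] by blast
    have "card (- J) = 1" using J(1) d by (simp add: Compl_eq_Diff_UNIV card_Diff_subset)
    then obtain j where "- J = {j}" using card_1_singletonE by blast
    then have "J = UNIV - {j}" by auto
    then show "hits 1 (dual_lattice \<Lambda>) (exp (3 * c) *\<^sub>R complementary v)"
      using log_profile_dual_hitsI[OF y, of j "3 * c"] J(2) c by simp
  next
    fix v :: "(real, 'n) vec"
    assume v: "\<And>i. v $ i > 0" and hit: "hits 1 (dual_lattice \<Lambda>) (complementary v)"
    obtain y where y: "log_profile c \<Lambda> v y" using prof[of v] v by blast
    obtain j where j: "0 \<le> c + real CARD('n) * ln (geo_mean v) + y j" using log_profile_dual_hits[OF y hit] by blast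
    have card: "card (UNIV - {j}) = CARD('n) - 1" by (simp add: card_Diff_subset)
    have "(\<Sum>l\<in>UNIV - {j}. y l) \<le> 2 * c"
      using log_profile_sum[OF y] j sum.remove[of UNIV j y] by simp
    moreover have "1 * (3 * c) \<le> real (CARD('n) - 1) * (3 * c)"
      using d c by (intro mult_right_mono) auto
    ultimately show "hits (CARD('n) - 1) \<Lambda> (exp (3 * c) *\<^sub>R v)"
      using log_profile_hitsI[OF y, of "UNIV - {j}" "3 * c"] unfolding card by simp
  qed
qed

subsection \<open>Exponents\<close>

lemma geo_mean_eq_powr_iff:
  fixes v :: "real ^ 'n::finite"
  assumes v: "\<And>i. v $ i > 0" and k: "1 \<le> k" "k \<le> CARD('n)"
  shows "geo_mean v = max_geo_mean k v powr (- \<gamma>) \<longleftrightarrow>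
    ln (geo_mean v) = - \<gamma> * ln (max_geo_mean k v)"
proof -
  have G: "geo_mean v > 0" using v by (rule geo_mean_pos)
  have M: "max_geo_mean k v > 0" using v k by (rule max_geo_mean_pos)
  then have "max_geo_mean k v powr (- \<gamma>) > 0" by simp
  then have "geo_mean v = max_geo_mean k v powr (- \<gamma>) \<longleftrightarrow>
      ln (geo_mean v) = ln (max_geo_mean k v powr (- \<gamma>))"
    using G by (metis ln_inj_iff)
  then show ?thesis using M by (simp add: ln_powr)
qed

lemma infnorm_le_scaled:
  assumes "\<tau> \<ge> 0" shows "infnorm v \<le> infnorm (exp \<tau> *\<^sub>R v)"
  using assms mult_right_mono[of 1 "exp \<tau>" "infnorm v"]
  by (simp add: infnorm_mul infnorm_pos_le)

text \<open>
  An inequality in place of the equation suffices because enlarging \<open>v\<close> by a scalar factor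
  keeps the lattice point and increases \<open>geo_mean v\<close> until equality holds.
\<close>

lemma Omega_exponent_geI:
  fixes \<Lambda> :: "(real ^ 'n::{finite,linorder}) set"
  assumes k: "1 \<le> k" "k \<le> CARD('n)" and \<delta>: "\<delta> > -1"
    and ex: "\<And>T. \<exists>v. (\<forall>i. v $ i > 0) \<and> infnorm v > T \<and>
      ln (geo_mean v) \<le> - \<delta> * ln (max_geo_mean k v) \<and> hits k \<Lambda> v"
  shows "ereal \<delta> \<le> Omega_exponent k \<Lambda>"
  unfolding Omega_exponent_def
proof (intro Sup_upper imageI CollectI allI)
  fix T
  obtain v where v: "\<And>i. v $ i > 0" and T: "infnorm v > T"
    and le: "ln (geo_mean v) \<le> - \<delta> * ln (max_geo_mean k v)" and hit: "hits k \<Lambda> v"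
    using ex[of T] by blast
  \<comment> \<open>Solution of \<open>\<tau> + ln (geo_mean v) = - \<delta> * (\<tau> + ln
    (max_geo_mean k v))\<close>; it exists because \<open>1 + \<delta> > 0\<close>.\<close>
  define \<tau> where "\<tau> = (- \<delta> * ln (max_geo_mean k v) - ln (geo_mean v)) / (1 + \<delta>)"
  have \<tau>: "\<tau> \<ge> 0" using le \<delta> by (simp add: \<tau>_def)
  let ?w = "exp \<tau> *\<^sub>R v"
  have w: "?w $ i > 0" for i using v by simp
  have "\<tau> * (1 + \<delta>) = - \<delta> * ln (max_geo_mean k v) - ln (geo_mean v)"
    using \<delta> by (simp add: \<tau>_def)
  then have "\<tau> + ln (geo_mean v) = - \<delta> * (\<tau> + ln (max_geo_mean k v))"
    by (simp add: algebra_simps)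
  then have "geo_mean ?w = max_geo_mean k ?w powr (- \<delta>)"
    using geo_mean_eq_powr_iff[OF w k] ln_geo_mean_scale[OF v] ln_max_geo_mean_scale[OF v k] by simp
  moreover have "hits k \<Lambda> ?w"
  proof (rule hits_mono[OF hit])
    fix i show "\<bar>v $ i\<bar> \<le> \<bar>?w $ i\<bar>"
      using v[of i] mult_right_mono[of 1 "exp \<tau>" "v $ i"] \<tau> by simp
  qed
  moreover have "infnorm ?w > T" using T infnorm_le_scaled[OF \<tau>, of v] by simp
  ultimately show "\<exists>v. (\<forall>i. v $ i > 0) \<and> infnorm v > T \<and>
     geo_mean v = max_geo_mean k v powr (- \<delta>) \<and>
     (\<exists>Z \<in> exterior_lattice k \<Lambda>. Z \<noteq> 0 \<and> Z \<in> parallelepiped k v)"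
    using w unfolding hits_def by blast
qed

text \<open>The strict gap \<open>\<gamma> > \<delta>\<close> is kept as room for additive errors.
  Nonnegativity of \<open>\<delta>\<close> makes \<open>max_geo_mean_large\<close> available, so the
  mean is large and not only the norm.\<close>

lemma Omega_exponent_gtD:
  fixes \<Lambda> :: "(real ^ 'n::{finite,linorder}) set"
  assumes k: "1 \<le> k" "k < CARD('n)" and \<delta>: "0 \<le> \<delta>" and gt: "ereal \<delta> < Omega_exponent k \<Lambda>"
  obtains \<gamma> where "\<gamma> > \<delta>" "\<And>R. \<exists>v. (\<forall>i. v $ i > 0) \<and> infnorm v > R \<and> ln (max_geo_mean k v) > R \<and>
      ln (geo_mean v) = - \<gamma> * ln (max_geo_mean k v) \<and> hits k \<Lambda> v"
proof -
  obtain \<gamma> where \<gamma>: "\<gamma> > \<delta>" and ex: "\<And>T. \<exists>v. (\<forall>i. v $ i > 0) \<and> infnorm v > T \<and>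
     geo_mean v = max_geo_mean k v powr (- \<gamma>) \<and> hits k \<Lambda> v"
    using gt unfolding Omega_exponent_def less_Sup_iff hits_def by auto
  show thesis
  proof (rule that[OF \<gamma>])
    fix R
    obtain T where T: "\<And>v :: (real, 'n) vec. (\<forall>i. v $ i > 0) \<Longrightarrow> infnorm v > T \<Longrightarrow>
        ln (geo_mean v) = - \<gamma> * ln (max_geo_mean k v) \<Longrightarrow> ln (max_geo_mean k v) > R"
      using max_geo_mean_large[OF k, of \<gamma> R] \<gamma> \<delta> by auto
    obtain v where v: "\<And>i. v $ i > 0" "infnorm v > max R T"
      "geo_mean v = max_geo_mean k v powr (- \<gamma>)" "hits k \<Lambda> v"
      using ex[of "max R T"] by blast
    have "ln (geo_mean v) = - \<gamma> * ln (max_geo_mean k v)"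
      using geo_mean_eq_powr_iff[OF v(1), of k \<gamma>] v(3) k by simp
    then show "\<exists>v. (\<forall>i. v $ i > 0) \<and> infnorm v > R \<and> ln (max_geo_mean k v) > R \<and>
      ln (geo_mean v) = - \<gamma> * ln (max_geo_mean k v) \<and> hits k \<Lambda> v"
      using T[of v] v by (intro exI[of _ v]) simp
  qed
qed

text \<open>Real test values cover infinite exponents as well; \<open>0 \<le> y\<close> makes any
  separating value positive.\<close>

lemma ereal_le_by_pos_reals:
  fixes x y :: ereal
  assumes "0 \<le> y" "\<And>\<delta>. 0 < \<delta> \<Longrightarrow> ereal \<delta> < x \<Longrightarrow> ereal \<delta> \<le> y"
  shows "x \<le> y"
proof (rule ccontr)
  assume "\<not> x \<le> y"
  then have "y < x" by simp
  then obtain \<delta> where \<delta>: "y < ereal \<delta>" "ereal \<delta> < x" using ereal_dense2 by blast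
  then have "0 < ereal \<delta>" using assms(1) by (metis order_le_less_trans)
  then show False using assms(2)[of \<delta>] \<delta> by simp
qed

text \<open>For a slightly negative \<open>\<delta>\<close> the right-hand side
  \<open>- \<delta> * ln (max_geo_mean k v)\<close> grows without bound on boxes of geometric mean
  1, so it absorbs the bounded dilation of \<open>hits_dirichlet\<close>.\<close>

lemma Omega_exponent_nonneg:
  fixes \<Lambda> :: "(real ^ 'n::{finite,linorder}) set"
  assumes \<Lambda>: "full_rank_lattice \<Lambda>" "covolume \<Lambda> = 1" and k: "1 \<le> k" "k < CARD('n)"
  shows "0 \<le> Omega_exponent k \<Lambda>"
proof (rule ccontr)
  assume "\<not> ?thesis"
  then have "Omega_exponent k \<Lambda> < 0" by simp
  then obtain r where r: "Omega_exponent k \<Lambda> < ereal r" "ereal r < 0"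
    using ereal_dense2 by blast
  \<comment> \<open>The maximum with \<open>-1/2\<close> secures \<open>\<delta> > -1\<close>, as
    \<open>Omega_exponent_geI\<close> requires.\<close>
  define \<delta> where "\<delta> = max r (- (1 / 2))"
  have \<delta>: "\<delta> > -1" "\<delta> < 0" "r \<le> \<delta>" using r by (auto simp: \<delta>_def)
  obtain c where c: "c \<ge> 0" "\<And>v. (\<forall>i. v $ i > 0) \<Longrightarrow> hits k \<Lambda> (exp (c - ln (geo_mean v)) *\<^sub>R v)"
    using hits_dirichlet[OF \<Lambda> k(1)] k(2) by auto
  let ?d = "real CARD('n)"
  have "ereal \<delta> \<le> Omega_exponent k \<Lambda>"
  proof (rule Omega_exponent_geI)
    fix T :: real
    \<comment> \<open>The factor \<open>k\<close> compensates the \<open>k\<close>-th root in the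
      maximal mean, which will exceed both \<open>\<bar>T\<bar>\<close> and
      \<open>c / - \<delta>\<close>.\<close>
    define R where "R = real k * max \<bar>T\<bar> (c / - \<delta>)"
    have R: "R \<ge> 0" by (simp add: R_def)
    obtain i0 :: 'n where True by simp
    \<comment> \<open>One long side balanced by \<open>d - 1\<close> short ones: the geometric mean
      is 1, while every maximal mean with \<open>k < d\<close> is large.\<close>
    define v where "v = (\<chi> i. if i = i0 then exp ((?d - 1) * R) else exp (- R))"
    have v: "v $ i > 0" for i by (simp add: v_def)
    have ln_v: "ln (v $ i) = (if i = i0 then (?d - 1) * R else - R)" for i by (simp add: v_def)
    have sum_v: "(\<Sum>i\<in>insert i0 I. ln (v $ i)) = (?d - 1) * R - real (card I) * R" if "i0 \<notin> I" for I
    proof -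
      have "(\<Sum>i\<in>I. ln (v $ i)) = (\<Sum>i\<in>I. - R)" using that by (intro sum.cong) (auto simp: ln_v)
      then show ?thesis using that by (simp add: ln_v)
    qed
    have "insert i0 (UNIV - {i0}) = UNIV" by auto
    then have "?d * ln (geo_mean v) = 0"
      using sum_v[of "UNIV - {i0}"] sum_ln_eq_geo_mean[OF v]
      by (simp add: card_Diff_subset of_nat_diff Suc_leI)
    then have G: "ln (geo_mean v) = 0" by simp
    have "k - 1 \<le> card (UNIV - {i0})" using k by (simp add: card_Diff_subset)
    then obtain I where I: "I \<subseteq> UNIV - {i0}" "card I = k - 1"
      by (rule obtain_subset_with_card_n)
    have i0: "i0 \<notin> I" using I by blast
    have "(?d - 1) * R - (real k - 1) * R \<le> real k * ln (max_geo_mean k v)"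
      using sum_v[OF i0] sum_ln_le[OF v, of k "insert i0 I"] i0 I k by (simp add: of_nat_diff)
    moreover have "R \<le> (?d - real k) * R" using mult_right_mono[of 1 "?d - real k" R] R k by simp
    ultimately have "R \<le> real k * ln (max_geo_mean k v)" by (simp add: algebra_simps)
    then have m: "max \<bar>T\<bar> (c / - \<delta>) \<le> ln (max_geo_mean k v)" using k by (simp add: R_def)
    let ?w = "exp c *\<^sub>R v"
    have w: "?w $ i > 0" for i using v by simp
    have M: "ln (max_geo_mean k ?w) = c + ln (max_geo_mean k v)"
      using ln_max_geo_mean_scale[OF v, of k c] k by simp
    have "\<bar>T\<bar> \<le> ln (max_geo_mean k v)" using m by simp
    moreover have "ln (max_geo_mean k ?w) < infnorm ?w"
      using k by (intro max_geo_mean_less_infnorm[OF w]) auto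
    ultimately have "T < infnorm ?w" using M c(1) by linarith
    moreover have "c \<le> - \<delta> * (c + ln (max_geo_mean k v))"
    proof -
      have "c = - \<delta> * (c / - \<delta>)" using \<delta> by simp
      also have "\<dots> \<le> - \<delta> * (c + ln (max_geo_mean k v))"
        using m c \<delta> by (intro mult_left_mono) auto
      finally show ?thesis .
    qed
    moreover have "hits k \<Lambda> ?w" using c(2)[of v] v G by simp
    ultimately show "\<exists>v. (\<forall>i. v $ i > 0) \<and> infnorm v > T \<and>
      ln (geo_mean v) \<le> - \<delta> * ln (max_geo_mean k v) \<and> hits k \<Lambda> v"
      using w M ln_geo_mean_scale[OF v, of c] G by (intro exI[of _ ?w]) simp
  qed (use k \<delta> in auto)
  then show False using r(1) \<delta>(3) by (meson ereal_less_eq(3) leD le_less_trans order_less_le_trans)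
qed

section \<open>Transference between neighbouring orders\<close>

text \<open>Write \<open>p\<close> for \<open>- ln (geo_mean v)\<close>. Inserting
  \<open>m1 \<le> p / \<gamma>\<close> into \<open>max_geo_mean_le_succ\<close> gives
  \<open>N * mk \<le> q * p\<close>, so up to the bounded dilation the same box witnesses every
  exponent below \<open>N / q\<close> at order \<open>k\<close>.\<close>

lemma Omega_exponent_pred:
  fixes \<Lambda> :: "(real ^ 'n::{finite,linorder}) set"
  assumes \<Lambda>: "full_rank_lattice \<Lambda>" "covolume \<Lambda> = 1" and k: "1 \<le> k" "k + 1 < CARD('n)"
    and \<gamma>: "0 < \<gamma>" "ereal \<gamma> < Omega_exponent (k + 1) \<Lambda>"
  defines "d \<equiv> real CARD('n)"
  shows "ereal (real k * (d - real k - 1) / ((d - real k) * (real k + 1) / \<gamma> + d)) \<le> Omega_exponent k \<Lambda>"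
proof -
  define q where "q = (d - real k) * (real k + 1) / \<gamma> + d"
  define N where "N = real k * (d - real k - 1)"
  have dk: "d - real k > 1" using k by (simp add: d_def)
  have d: "d > 0" using dk by simp
  have q: "q > 0" unfolding q_def using dk d \<gamma> by (intro add_nonneg_pos) auto
  have N: "N > 0" using k dk by (simp add: N_def)
  obtain \<gamma>' where \<gamma>': "\<gamma>' > \<gamma>" and ex: "\<And>R. \<exists>v. (\<forall>i. v $ i > 0) \<and> infnorm v > R \<and>
      ln (max_geo_mean (k + 1) v) > R \<and>
      ln (geo_mean v) = - \<gamma>' * ln (max_geo_mean (k + 1) v) \<and> hits (k + 1) \<Lambda> v"
    using Omega_exponent_gtD[of "k + 1" \<gamma> \<Lambda>] k \<gamma> by auto
  obtain c where c: "c \<ge> 0" "\<And>v k. (\<And>i. v $ i > 0) \<Longrightarrow> 1 \<le> k \<Longrightarrow>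
    hits (k + 1) \<Lambda> v \<Longrightarrow> hits k \<Lambda> (exp c *\<^sub>R v)"
    using hits_pred[OF \<Lambda>] by blast
  have "ereal (N / q) \<le> Omega_exponent k \<Lambda>"
  proof (rule ereal_le_by_pos_reals)
    show "0 \<le> Omega_exponent k \<Lambda>" using Omega_exponent_nonneg[OF \<Lambda>] k by simp
    fix \<delta> assume \<delta>: "0 < \<delta>" "ereal \<delta> < ereal (N / q)"
    then have slack: "N - \<delta> * q > 0" using q by (simp add: pos_less_divide_eq)
    show "ereal \<delta> \<le> Omega_exponent k \<Lambda>"
    proof (rule Omega_exponent_geI)
      fix T :: real
      \<comment> \<open>Since \<open>p \<ge> \<gamma> * m1\<close>, this makes
        \<open>p * (N - \<delta> * q)\<close> at least the cost
        \<open>N * (c * (1 + \<delta>))\<close> of the dilation by \<open>exp c\<close>.\<close>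
      define R where "R = max \<bar>T\<bar> (N * (c * (1 + \<delta>)) / (N - \<delta> * q) / \<gamma>)"
      obtain v where v: "\<And>i. v $ i > 0" and T: "infnorm v > R"
        and m: "ln (max_geo_mean (k + 1) v) > R"
        and G: "ln (geo_mean v) = - \<gamma>' * ln (max_geo_mean (k + 1) v)" and hit: "hits (k + 1) \<Lambda> v"
        using ex[of R] by blast
      let ?w = "exp c *\<^sub>R v"
      have w: "?w $ i > 0" for i using v by simp
      define p where "p = - ln (geo_mean v)"
      define m1 where "m1 = ln (max_geo_mean (k + 1) v)"
      define mk where "mk = ln (max_geo_mean k v)"
      have "R \<ge> 0" by (simp add: R_def)
      then have m1: "m1 > 0" using m unfolding m1_def by linarith
      have pm: "p \<ge> \<gamma> * m1" using G \<gamma>' m1 by (simp add: p_def m1_def)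
      have "R * \<gamma> \<le> \<gamma> * m1" using m \<gamma> by (simp add: m1_def mult.commute)
      moreover have "N * (c * (1 + \<delta>)) / (N - \<delta> * q) = N * (c * (1 + \<delta>)) / (N - \<delta> * q) / \<gamma> * \<gamma>"
        using \<gamma> by simp
      moreover have "\<dots> \<le> R * \<gamma>" using \<gamma> by (intro mult_right_mono) (auto simp: R_def)
      ultimately have "N * (c * (1 + \<delta>)) / (N - \<delta> * q) \<le> p" using pm by linarith
      then have p: "N * (c * (1 + \<delta>)) \<le> p * (N - \<delta> * q)" using slack by (simp add: pos_divide_le_eq)
      have "N * mk \<le> (d - real k) * (real k + 1) * m1 + d * p"
        using max_geo_mean_le_succ[OF v, of k] k by (simp add: d_def N_def mk_def m1_def p_def)
      also have "\<dots> \<le> (d - real k) * (real k + 1) * (p / \<gamma>) + d * p"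
        using pm \<gamma> dk by (intro add_right_mono mult_left_mono) (auto simp: pos_le_divide_eq mult.commute)
      also have "\<dots> = q * p" 
        by (simp only: q_def distrib_right[of "(d - real k) * (real k + 1) / \<gamma>"]
            times_divide_eq_left times_divide_eq_right)
      finally have "N * mk \<le> q * p" .
      then have "\<delta> * (N * mk) \<le> \<delta> * (q * p)" using \<delta> by (intro mult_left_mono) auto
      then have "N * (c * (1 + \<delta>) + \<delta> * mk) \<le> N * p" using p by (simp add: algebra_simps)
      then have "c * (1 + \<delta>) + \<delta> * mk \<le> p" using N by simp
      then have "ln (geo_mean ?w) \<le> - \<delta> * ln (max_geo_mean k ?w)"
        using ln_geo_mean_scale[OF v, of c] ln_max_geo_mean_scale[OF v, of k c] k
        by (simp add: p_def mk_def algebra_simps)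
      moreover have "infnorm ?w > T"
      proof -
        have "T \<le> R" unfolding R_def by linarith
        then show ?thesis using T infnorm_le_scaled[OF c(1), of v] by linarith
      qed
      ultimately show "\<exists>v. (\<forall>i. v $ i > 0) \<and> infnorm v > T \<and>
          ln (geo_mean v) \<le> - \<delta> * ln (max_geo_mean k v) \<and> hits k \<Lambda> v"
        using w c(2)[OF v k(1) hit] by (intro exI[of _ ?w]) simp
    qed (use k \<delta> in auto)
  qed
  then show ?thesis by (simp add: N_def q_def)
qed

text \<open>The dilation in \<open>hits_succ\<close> costs only the fraction
  \<open>1 - \<eta>\<close> of \<open>p = - ln (geo_mean v)\<close>, apart from a constant. The new
  logarithm of the geometric mean is \<open>c - \<eta> * p\<close>, while that of the maximal mean
  is at most linear in \<open>p\<close>; a positive ratio remains.\<close>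

lemma Omega_exponent_succ_pos:
  fixes \<Lambda> :: "(real ^ 'n::{finite,linorder}) set"
  assumes \<Lambda>: "full_rank_lattice \<Lambda>" "covolume \<Lambda> = 1" and k: "1 \<le> k" "k + 1 < CARD('n)"
    and pos: "0 < Omega_exponent k \<Lambda>"
  shows "0 < Omega_exponent (k + 1) \<Lambda>"
proof -
  define d where "d = real CARD('n)"
  define e where "e = (d - real k) * (real k + 1)"
  \<comment> \<open>This is \<open>1 - d / e\<close>, with \<open>d / e\<close> the coefficient of
    the dilation in \<open>hits_succ\<close>; it is positive because
    \<open>k + 1 < d\<close>.\<close>
  define \<eta> where "\<eta> = real k * (d - real k - 1) / e"
  have dk: "d - real k > 1" using k by (simp add: d_def)
  have e: "e > 0" using dk k by (simp add: e_def)
  have e_eq: "e = d + real k * (d - real k - 1)" by (simp add: e_def algebra_simps)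
  have \<eta>: "0 < \<eta>" "\<eta> \<le> 1" "d / e = 1 - \<eta>"
  proof -
    show "0 < \<eta>" using k dk e by (simp add: \<eta>_def)
    have "d / e + \<eta> = e / e" unfolding \<eta>_def add_divide_distrib[symmetric] e_eq[symmetric] ..
    then show "d / e = 1 - \<eta>" using e by simp
    moreover have "d / e > 0" using e dk by simp
    ultimately show "\<eta> \<le> 1" by simp
  qed
  obtain \<gamma> where \<gamma>: "\<gamma> > 0" and ex: "\<And>R. \<exists>v. (\<forall>i. v $ i > 0) \<and> infnorm v > R \<and>
      ln (max_geo_mean k v) > R \<and>
      ln (geo_mean v) = - \<gamma> * ln (max_geo_mean k v) \<and> hits k \<Lambda> v"
    using Omega_exponent_gtD[of k 0 \<Lambda>] k pos by (auto simp: zero_ereal_def)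
  obtain c where c: "c \<ge> 0" "\<And>v k. (\<And>i. v $ i > 0) \<Longrightarrow> 1 \<le> k \<Longrightarrow> k < CARD('n) \<Longrightarrow> hits k \<Lambda> v \<Longrightarrow>
    hits (k + 1) \<Lambda> (exp (c - d * ln (geo_mean v) / ((d - real k) * (real k + 1))) *\<^sub>R v)"
    using hits_succ[OF \<Lambda>] unfolding d_def by blast
  \<comment> \<open>Here \<open>1 / \<gamma>\<close> comes from \<open>mk = p / \<gamma>\<close>,
    and 2 from bounding both \<open>c\<close> and \<open>(1 - \<eta>) * p\<close> by
    \<open>p\<close>.\<close>
  define a where "a = 1 / \<gamma> + 2"
  have a: "a > 0" using \<gamma> by (simp add: a_def add_pos_pos)
  \<comment> \<open>Half of \<open>\<eta> * p\<close> is reserved for \<open>c\<close>, the other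
    half bounds \<open>\<delta>\<close> times the maximal mean's logarithm.\<close>
  define \<delta> where "\<delta> = \<eta> / (2 * a)"
  have \<delta>: "\<delta> > 0" using \<eta> a by (simp add: \<delta>_def)
  have "ereal \<delta> \<le> Omega_exponent (k + 1) \<Lambda>"
  proof (rule Omega_exponent_geI)
    fix T :: real
    define R where "R = max \<bar>T\<bar> (2 * c / \<eta> / \<gamma>)"
    obtain v where v: "\<And>i. v $ i > 0" and T: "infnorm v > R" and m: "ln (max_geo_mean k v) > R"
      and G: "ln (geo_mean v) = - \<gamma> * ln (max_geo_mean k v)" and hit: "hits k \<Lambda> v"
      using ex[of R] by blast
    define p where "p = - ln (geo_mean v)"
    define mk where "mk = ln (max_geo_mean k v)"
    have mk: "mk = p / \<gamma>" using G \<gamma> by (simp add: p_def mk_def)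
    have "R \<le> p / \<gamma>" using m mk by (simp add: mk_def)
    then have "2 * c / \<eta> / \<gamma> \<le> p / \<gamma>" by (simp add: R_def)
    then have "2 * c / \<eta> \<le> p" using \<gamma> unfolding divide_le_cancel by blast
    then have pc: "2 * c \<le> \<eta> * p" using \<eta> by (simp add: pos_divide_le_eq mult.commute)
    have "0 \<le> \<eta> * p" using pc c(1) by linarith
    then have p: "p \<ge> 0" using \<eta>(1) by (simp add: zero_le_mult_iff)
    have cp: "c \<le> p" using pc c mult_right_mono[OF \<eta>(2) p] by simp
    define \<tau> where "\<tau> = c + (1 - \<eta>) * p"
    have \<tau>: "\<tau> \<ge> 0" using c \<eta> p by (simp add: \<tau>_def)
    have "c - d * ln (geo_mean v) / e = c + d / e * p" by (simp add: p_def)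
    then have \<tau>_eq: "c - d * ln (geo_mean v) / e = \<tau>" by (simp add: \<eta>(3) \<tau>_def)
    let ?w = "exp \<tau> *\<^sub>R v"
    have w: "?w $ i > 0" for i using v by simp
    have hit': "hits (k + 1) \<Lambda> ?w"
      using c(2)[OF v k(1) _ hit] k \<tau>_eq by (simp add: e_def)
    have "ln (max_geo_mean (k + 1) ?w) \<le> \<tau> + mk"
      using ln_max_geo_mean_scale[OF v, of "k + 1" \<tau>] max_geo_mean_succ_le[OF v, of k] k
      by (simp add: mk_def)
    also have "\<dots> \<le> a * p"
    proof -
      have "(1 - \<eta>) * p \<le> 1 * p" using \<eta> p by (intro mult_right_mono) auto
      then have "\<tau> + mk \<le> p + p + p / \<gamma>" using cp by (simp add: \<tau>_def mk)
      then show ?thesis by (simp add: a_def algebra_simps)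
    qed
    finally have "\<delta> * ln (max_geo_mean (k + 1) ?w) \<le> \<delta> * (a * p)"
      using \<delta> by (intro mult_left_mono) auto
    also have "\<dots> = \<eta> * p / 2" using a by (simp add: \<delta>_def)
    finally have "\<delta> * ln (max_geo_mean (k + 1) ?w) \<le> \<eta> * p / 2" .
    moreover have "ln (geo_mean ?w) = c - \<eta> * p"
      using ln_geo_mean_scale[OF v, of \<tau>] by (simp add: p_def \<tau>_def algebra_simps)
    ultimately have "ln (geo_mean ?w) \<le> - \<delta> * ln (max_geo_mean (k + 1) ?w)"
      using pc by simp
    moreover have "infnorm ?w > T"
    proof -
      have "T \<le> R" unfolding R_def by linarith
      then show ?thesis using T infnorm_le_scaled[OF \<tau>, of v] by linarith
    qed
    ultimately show "\<exists>v. (\<forall>i. v $ i > 0) \<and> infnorm v > T \<and>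
          ln (geo_mean v) \<le> - \<delta> * ln (max_geo_mean (k + 1) v) \<and> hits (k + 1) \<Lambda> v"
      using w hit' by (intro exI[of _ ?w]) simp
  qed (use k \<delta> in auto)
  then show ?thesis using \<delta> by (metis ereal_less(2) order_less_le_trans)
qed

subsection \<open>Duality and transference of exponents\<close>

lemma
  fixes v :: "real ^ 'n::finite"
  assumes v: "\<And>i. v $ i > 0"
  shows complementary_pos: "complementary v $ i > 0"
    and ln_complementary: "ln (complementary v $ i) = (\<Sum>j\<in>UNIV - {i}. ln (v $ j))"
proof -
  have V: "(\<Prod>j\<in>UNIV. v $ j) > 0" using v by (intro prod_pos) simp
  then show "complementary v $ i > 0" using v by (simp add: complementary_def)
  have "ln (complementary v $ i) = ln (\<Prod>j\<in>UNIV. v $ j) - ln (v $ i)"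
    using V v[of i] by (simp add: complementary_def ln_divide_pos)
  also have "ln (\<Prod>j\<in>UNIV. v $ j) = (\<Sum>j\<in>UNIV. ln (v $ j))"
    by (rule ln_prod[OF finite]) (metis v less_irrefl)
  also have "\<dots> = ln (v $ i) + (\<Sum>j\<in>UNIV - {i}. ln (v $ j))"
    by (rule sum.remove) auto
  finally show "ln (complementary v $ i) = (\<Sum>j\<in>UNIV - {i}. ln (v $ j))" by simp
qed

lemma ln_geo_mean_complementary:
  fixes v :: "real ^ 'n::finite"
  assumes v: "\<And>i. v $ i > 0"
  shows "ln (geo_mean (complementary v)) = (real CARD('n) - 1) * ln (geo_mean v)"
proof -
  have "real CARD('n) * ln (geo_mean (complementary v)) = (\<Sum>i\<in>UNIV. ln (complementary v $ i))"
    using complementary_pos[OF v] by (rule sum_ln_eq_geo_mean[symmetric])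
  also have "\<dots> = (\<Sum>i\<in>UNIV. (\<Sum>j\<in>UNIV. ln (v $ j)) - ln (v $ i))"
    unfolding ln_complementary[OF v] by (simp add: sum_diff1)
  also have "\<dots> = real CARD('n) * ((real CARD('n) - 1) * ln (geo_mean v))"
    unfolding sum_subtractf sum_constant sum_ln_eq_geo_mean[OF v] by (simp add: algebra_simps)
  finally show ?thesis by simp
qed

text \<open>Coordinates of \<open>complementary v\<close> are products over sets of size
  \<open>d - 1\<close>. As in \<open>ln_geo_mean_complementary\<close>, the logarithm is multiplied
  by \<open>d - 1\<close>, so the exponent relating the two means does not change.\<close>

lemma ln_max_geo_mean_complementary:
  fixes v :: "real ^ 'n::finite"
  assumes v: "\<And>i. v $ i > 0" and d: "CARD('n) \<ge> 2"
  shows "ln (max_geo_mean 1 (complementary v)) =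
    (real CARD('n) - 1) * ln (max_geo_mean (CARD('n) - 1) v)"
proof (rule antisym)
  note w = complementary_pos[OF v]
  have d1: "1 \<le> CARD('n) - 1" "CARD('n) - 1 \<le> CARD('n)" "real (CARD('n) - 1) = real CARD('n) - 1"
    using d by (auto simp: of_nat_diff)
  obtain I where I: "card I = 1"
    "(\<Sum>i\<in>I. ln (complementary v $ i)) = real 1 * ln (max_geo_mean 1 (complementary v))"
    using sum_ln_attained[OF w, of 1] d by auto
  obtain i where i: "I = {i}" using card_1_singletonE[OF I(1)] by blast
  have "ln (max_geo_mean 1 (complementary v)) = (\<Sum>j\<in>UNIV - {i}. ln (v $ j))"
    using I(2) i ln_complementary[OF v, of i] by simp
  also have "\<dots> \<le> real (CARD('n) - 1) * ln (max_geo_mean (CARD('n) - 1) v)"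
    using d1 by (intro sum_ln_le[OF v]) (auto simp: card_Diff_subset)
  finally show "ln (max_geo_mean 1 (complementary v)) \<le>
    (real CARD('n) - 1) * ln (max_geo_mean (CARD('n) - 1) v)" unfolding d1(3) .
  obtain J where J: "card J = CARD('n) - 1"
    "(\<Sum>i\<in>J. ln (v $ i)) = real (CARD('n) - 1) * ln (max_geo_mean (CARD('n) - 1) v)"
    using sum_ln_attained[OF v d1(1,2)] by blast
  have "card (- J) = 1" using J(1) d by (simp add: Compl_eq_Diff_UNIV card_Diff_subset)
  then obtain j where "- J = {j}" using card_1_singletonE by blast
  then have "J = UNIV - {j}" by auto
  then have "(real CARD('n) - 1) * ln (max_geo_mean (CARD('n) - 1) v) = ln (complementary v $ j)"
    using J(2) ln_complementary[OF v, of j] d1(3) by simp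
  also have "\<dots> \<le> ln (max_geo_mean 1 (complementary v))"
    using sum_ln_le[OF w, of 1 "{j}"] d by simp
  finally show "(real CARD('n) - 1) * ln (max_geo_mean (CARD('n) - 1) v) \<le>
    ln (max_geo_mean 1 (complementary v))" .
qed

lemma complementary_surj:
  fixes w :: "real ^ 'n::finite"
  assumes w: "\<And>i. w $ i > 0" and d: "CARD('n) \<ge> 2"
  obtains v where "\<And>i. v $ i > 0" "complementary v = w"
proof -
  define n where "n = real CARD('n)"
  have n: "n - 1 > 0" using d by (simp add: n_def)
  define Y where "Y = (\<Sum>i\<in>UNIV. ln (w $ i))"
  \<comment> \<open>In logarithms each given coordinate is the sum of all unknowns but one. Adding
    these equations shows that the unknowns sum to \<open>Y / (n - 1)\<close>.\<close>
  define v where "v = (\<chi> i. exp (Y / (n - 1) - ln (w $ i)))"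
  have v: "v $ i > 0" for i by (simp add: v_def)
  have "complementary v $ i = w $ i" for i
  proof -
    have "ln (complementary v $ i) = (\<Sum>j\<in>UNIV - {i}. Y / (n - 1) - ln (w $ j))"
      using ln_complementary[OF v, of i] by (simp add: v_def)
    also have "\<dots> = real (card (UNIV - {i})) * (Y / (n - 1)) - (\<Sum>j\<in>UNIV - {i}. ln (w $ j))"
      by (simp only: sum_subtractf sum_constant)
    also have "real (card (UNIV - {i})) = n - 1"
      using d by (simp add: card_Diff_subset of_nat_diff n_def)
    also have "(\<Sum>j\<in>UNIV - {i}. ln (w $ j)) = Y - ln (w $ i)"
      by (simp add: sum_diff1 Y_def)
    finally have "ln (complementary v $ i) = ln (w $ i)" using n by simp
    then show ?thesis using complementary_pos[OF v, of i] w[of i] by simp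
  qed
  then show thesis using that[OF v] by (simp add: vec_eq_iff)
qed

text \<open>The passage \<open>v\<close> to \<open>complementary v\<close> keeps the exponent and is
  onto the positive vectors, so \<open>hits_dual\<close> transfers witnesses both ways, up to a
  dilation paid for by the gap \<open>\<gamma> - \<delta>\<close>.\<close>

lemma Omega_exponent_dual:
  fixes \<Lambda> :: "(real ^ 'n::{finite,linorder}) set"
  assumes \<Lambda>: "full_rank_lattice \<Lambda>" "covolume \<Lambda> = 1"
    and \<Lambda>': "full_rank_lattice (dual_lattice \<Lambda>)" "covolume (dual_lattice \<Lambda>) = 1"
    and d: "CARD('n) \<ge> 2"
  shows "Omega_exponent (CARD('n) - 1) \<Lambda> = Omega_exponent 1 (dual_lattice \<Lambda>)"
proof -
  let ?k = "CARD('n) - 1"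
  define r where "r = real CARD('n) - 1"
  have r: "r \<ge> 1" using d by (simp add: r_def)
  have k: "1 \<le> ?k" "?k < CARD('n)" "1 < CARD('n)" using d by auto
  obtain c where c: "c \<ge> 0" and
    to_dual: "\<And>v. (\<And>i. v $ i > 0) \<Longrightarrow> hits ?k \<Lambda> v \<Longrightarrow>
      hits 1 (dual_lattice \<Lambda>) (exp c *\<^sub>R complementary v)" and
    from_dual: "\<And>v. (\<And>i. v $ i > 0) \<Longrightarrow> hits 1 (dual_lattice \<Lambda>) (complementary v) \<Longrightarrow>
      hits ?k \<Lambda> (exp c *\<^sub>R v)"
    using hits_dual[OF \<Lambda> d] by blast
  show ?thesis
  proof (rule antisym; rule ereal_le_by_pos_reals)
    show "0 \<le> Omega_exponent 1 (dual_lattice \<Lambda>)" using Omega_exponent_nonneg[OF \<Lambda>'] k by simp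
    show "0 \<le> Omega_exponent ?k \<Lambda>" using Omega_exponent_nonneg[OF \<Lambda>] k by simp
  next
    fix \<delta> assume \<delta>: "0 < \<delta>" "ereal \<delta> < Omega_exponent ?k \<Lambda>"
    obtain \<gamma> where \<gamma>: "\<gamma> > \<delta>" and ex: "\<And>R. \<exists>v. (\<forall>i. v $ i > 0) \<and> infnorm v > R \<and>
        ln (max_geo_mean ?k v) > R \<and> ln (geo_mean v) = - \<gamma> * ln (max_geo_mean ?k v) \<and> hits ?k \<Lambda> v"
      using Omega_exponent_gtD[of ?k \<delta> \<Lambda>] k \<delta> by auto
    show "ereal \<delta> \<le> Omega_exponent 1 (dual_lattice \<Lambda>)"
    proof (rule Omega_exponent_geI)
      fix T :: real
      \<comment> \<open>The dilation by \<open>exp c\<close> is harmless as soon as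
        \<open>c * (1 + \<delta>) \<le> m1 * (\<gamma> - \<delta>)\<close>.\<close>
      define R where "R = max \<bar>T\<bar> (c * (1 + \<delta>) / (\<gamma> - \<delta>))"
      obtain v where v: "\<And>i. v $ i > 0" and m: "ln (max_geo_mean ?k v) > R"
        and G: "ln (geo_mean v) = - \<gamma> * ln (max_geo_mean ?k v)" and hit: "hits ?k \<Lambda> v"
        using ex[of R] by blast
      define m1 where "m1 = r * ln (max_geo_mean ?k v)"
      have "R \<ge> 0" by (simp add: R_def)
      then have "1 * ln (max_geo_mean ?k v) \<le> m1"
        unfolding m1_def using m r by (intro mult_right_mono) auto
      then have "R \<le> m1" using m by simp
      then have m1: "\<bar>T\<bar> \<le> m1" "c * (1 + \<delta>) / (\<gamma> - \<delta>) \<le> m1" by (auto simp: R_def)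
      then have m1': "c * (1 + \<delta>) \<le> m1 * (\<gamma> - \<delta>)" using \<gamma> by (simp add: pos_divide_le_eq)
      note w = complementary_pos[OF v]
      let ?w = "exp c *\<^sub>R complementary v"
      have w': "?w $ i > 0" for i using w by simp
      have lnM: "ln (max_geo_mean 1 ?w) = c + m1"
        using ln_max_geo_mean_scale[OF w, of 1 c] ln_max_geo_mean_complementary[OF v d] k
        by (simp add: m1_def r_def)
      have lnG: "ln (geo_mean ?w) = c - \<gamma> * m1"
        using ln_geo_mean_scale[OF w, of c] ln_geo_mean_complementary[OF v] G
        by (simp add: m1_def r_def)
      have "ln (geo_mean ?w) \<le> - \<delta> * ln (max_geo_mean 1 ?w)"
        unfolding lnM lnG using m1' by (simp add: algebra_simps)
      moreover have "infnorm ?w > T"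
        using max_geo_mean_less_infnorm[OF w', of 1] k m1(1) c unfolding lnM by simp
      ultimately show "\<exists>v. (\<forall>i. v $ i > 0) \<and> infnorm v > T \<and>
          ln (geo_mean v) \<le> - \<delta> * ln (max_geo_mean 1 v) \<and> hits 1 (dual_lattice \<Lambda>) v"
        using w' to_dual[OF v hit] by (intro exI[of _ ?w]) simp
    qed (use k \<delta> in auto)
  next
    fix \<delta> assume \<delta>: "0 < \<delta>" "ereal \<delta> < Omega_exponent 1 (dual_lattice \<Lambda>)"
    obtain \<gamma> where \<gamma>: "\<gamma> > \<delta>" and ex: "\<And>R. \<exists>v. (\<forall>i. v $ i > 0) \<and> infnorm v > R \<and>
        ln (max_geo_mean 1 v) > R \<and> ln (geo_mean v) = - \<gamma> * ln (max_geo_mean 1 v) \<and>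
        hits 1 (dual_lattice \<Lambda>) v"
      using Omega_exponent_gtD[of 1 \<delta> "dual_lattice \<Lambda>"] k \<delta> by auto
    show "ereal \<delta> \<le> Omega_exponent ?k \<Lambda>"
    proof (rule Omega_exponent_geI)
      fix T :: real
      \<comment> \<open>The extra factor \<open>r\<close> is lost again on returning from
        \<open>w\<close> to \<open>v\<close>.\<close>
      define R where "R = r * max \<bar>T\<bar> (c * (1 + \<delta>) / (\<gamma> - \<delta>))"
      obtain w where w: "\<And>i. w $ i > 0" and m: "ln (max_geo_mean 1 w) > R"
        and G: "ln (geo_mean w) = - \<gamma> * ln (max_geo_mean 1 w)" and hit: "hits 1 (dual_lattice \<Lambda>) w"
        using ex[of R] by blast
      obtain v where v: "\<And>i. v $ i > 0" and vw: "complementary v = w"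
        using complementary_surj[OF w d] by blast
      define m1 where "m1 = ln (max_geo_mean ?k v)"
      have rm: "r * m1 = ln (max_geo_mean 1 w)"
        using ln_max_geo_mean_complementary[OF v d] by (simp add: vw m1_def r_def)
      then have "r * max \<bar>T\<bar> (c * (1 + \<delta>) / (\<gamma> - \<delta>)) \<le> r * m1" using m by (simp add: R_def)
      then have "max \<bar>T\<bar> (c * (1 + \<delta>) / (\<gamma> - \<delta>)) \<le> m1" using r by simp
      then have m1: "\<bar>T\<bar> \<le> m1" "c * (1 + \<delta>) / (\<gamma> - \<delta>) \<le> m1" by auto
      then have m1': "c * (1 + \<delta>) \<le> m1 * (\<gamma> - \<delta>)" using \<gamma> by (simp add: pos_divide_le_eq)
      let ?w = "exp c *\<^sub>R v"
      have w': "?w $ i > 0" for i using v by simp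
      have lnM: "ln (max_geo_mean ?k ?w) = c + m1"
        using ln_max_geo_mean_scale[OF v, of ?k c] k by (simp add: m1_def)
      have "r * ln (geo_mean v) = - \<gamma> * (r * m1)"
        unfolding rm using ln_geo_mean_complementary[OF v] G by (simp add: vw r_def)
      then have "r * ln (geo_mean v) = r * (- \<gamma> * m1)" by simp
      then have "ln (geo_mean v) = - \<gamma> * m1" using r by (subst (asm) mult_cancel_left) auto
      then have lnG: "ln (geo_mean ?w) = c - \<gamma> * m1" using ln_geo_mean_scale[OF v, of c] by simp
      have "ln (geo_mean ?w) \<le> - \<delta> * ln (max_geo_mean ?k ?w)"
        unfolding lnM lnG using m1' by (simp add: algebra_simps)
      moreover have "infnorm ?w > T"
        using max_geo_mean_less_infnorm[OF w', of ?k] k m1(1) c unfolding lnM by simp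
      ultimately show "\<exists>v. (\<forall>i. v $ i > 0) \<and> infnorm v > T \<and>
          ln (geo_mean v) \<le> - \<delta> * ln (max_geo_mean ?k v) \<and> hits ?k \<Lambda> v"
        using w' from_dual[OF v] hit vw by (intro exI[of _ ?w]) simp
    qed (use k \<delta> in auto)
  qed
qed

text \<open>The inverse transpose of a basis matrix generates the dual, so covolume 1 is
  inherited.\<close>

lemma dual_lattice_basis:
  fixes \<Lambda> :: "(real ^ 'n::finite) set"
  assumes A: "lattice_basis A \<Lambda>"
  shows "\<exists>B. lattice_basis B (dual_lattice \<Lambda>) \<and> det B * det A = 1"
proof -
  obtain A' where A': "A ** A' = mat 1" "A' ** A = mat 1"
    using A by (auto simp: lattice_basis_def invertible_def)
  have \<Lambda>: "\<Lambda> = range (\<lambda>m :: int ^ 'n. A *v (\<chi> i. real_of_int (m $ i)))"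
    using A by (simp add: lattice_basis_def)
  have "det A' * det A = det (mat 1 :: real ^ 'n ^ 'n)" using A'(2) by (metis det_mul)
  then have det: "det (transpose A') * det A = 1" by (simp add: det_transpose)
  have "dual_lattice \<Lambda> = range (\<lambda>m :: int ^ 'n. transpose A' *v (\<chi> i. real_of_int (m $ i)))"
  proof (intro set_eqI iffI)
    fix w assume w: "w \<in> dual_lattice \<Lambda>"
    have "\<exists>l. (w v* A) $ i = real_of_int l" for i
    proof -
      have "A *v (\<chi> j. real_of_int ((axis i 1 :: int ^ 'n) $ j)) \<in> \<Lambda>" using \<Lambda> by blast
      moreover have "(\<chi> j. real_of_int ((axis i 1 :: int ^ 'n) $ j)) = axis i 1"
        by (auto simp: vec_eq_iff axis_def)
      ultimately have "w \<bullet> (A *v axis i 1) \<in> \<int>" using w by (simp add: dual_lattice_def)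
      then have "(w v* A) $ i \<in> \<int>" by (simp add: dot_lmul_matrix[symmetric] inner_axis)
      then show ?thesis by (auto elim: Ints_cases)
    qed
    then obtain l where "\<And>i. (w v* A) $ i = real_of_int (l i)" by metis
    then have "w v* A = (\<chi> i. real_of_int ((\<chi> i. l i) $ i))" by (simp add: vec_eq_iff)
    moreover have "w = (w v* A) v* A'" by (simp add: vector_matrix_mul_assoc A')
    ultimately have "w = transpose A' *v (\<chi> i. real_of_int ((\<chi> i. l i) $ i))" by simp
    then show "w \<in> range (\<lambda>m :: int ^ 'n. transpose A' *v (\<chi> i. real_of_int (m $ i)))" by blast
  next
    fix w assume "w \<in> range (\<lambda>m :: int ^ 'n. transpose A' *v (\<chi> i. real_of_int (m $ i)))"
    then obtain m :: "int ^ 'n" where m: "w = (\<chi> i. real_of_int (m $ i)) v* A'" by auto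
    have "w \<bullet> z \<in> \<int>" if z: "z \<in> \<Lambda>" for z
    proof -
      obtain l :: "int ^ 'n" where "z = A *v (\<chi> i. real_of_int (l $ i))" using z \<Lambda> by auto
      then have "w \<bullet> z = (\<chi> i. real_of_int (m $ i)) \<bullet> (\<chi> i. real_of_int (l $ i))"
        by (simp add: m dot_lmul_matrix matrix_vector_mul_assoc A')
      then show ?thesis by (auto simp: inner_vec_def intro!: Ints_sum Ints_mult)
    qed
    then show "w \<in> dual_lattice \<Lambda>" by (simp add: dual_lattice_def)
  qed
  moreover have "invertible (transpose A')" using det by (auto simp: invertible_det_nz)
  ultimately show ?thesis using det by (auto simp: lattice_basis_def)
qed

section \<open>Vanishing of exponents and the chain of inequalities\<close>

lemma Omega_exponent_all_pos_iff:
  fixes \<Lambda> :: "(real ^ 'n::{finite,linorder}) set"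
  assumes \<Lambda>: "full_rank_lattice \<Lambda>" "covolume \<Lambda> = 1" and k: "1 \<le> k" "k < CARD('n)"
  shows "0 < Omega_exponent k \<Lambda> \<longleftrightarrow> 0 < Omega_exponent 1 \<Lambda>"
  using k
proof (induction k rule: dec_induct)
  case (step k)
  define d where "d = real CARD('n)"
  have "0 < Omega_exponent (k + 1) \<Lambda> \<longleftrightarrow> 0 < Omega_exponent k \<Lambda>"
  proof
    assume "0 < Omega_exponent (k + 1) \<Lambda>"
    then obtain \<gamma> where \<gamma>: "0 < ereal \<gamma>" "ereal \<gamma> < Omega_exponent (k + 1) \<Lambda>"
      using ereal_dense2 by blast
    have dk: "d - real k > 1" using step.prems by (simp add: d_def)
    then have "d > 0" by simp
    have "(d - real k) * (real k + 1) / \<gamma> \<ge> 0" using dk \<gamma> by simp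
    then have "(d - real k) * (real k + 1) / \<gamma> + d > 0" using \<open>d > 0\<close> by simp
    then have "real k * (d - real k - 1) / ((d - real k) * (real k + 1) / \<gamma> + d) > 0"
      using dk step by (intro divide_pos_pos mult_pos_pos) auto
    moreover have "ereal (real k * (d - real k - 1) / ((d - real k) * (real k + 1) / \<gamma> + d))
        \<le> Omega_exponent k \<Lambda>"
      using Omega_exponent_pred[OF \<Lambda>, of k \<gamma>] step \<gamma> by (simp add: d_def)
    ultimately show "0 < Omega_exponent k \<Lambda>" by (metis ereal_less(2) order_less_le_trans)
  qed (use Omega_exponent_succ_pos[OF \<Lambda>, of k] step in simp)
  then show ?case using step by simp
qed simp

text \<open>This is the bound of \<open>Omega_exponent_pred\<close> in symmetric form:
  \<open>1 / x \<le> q / N\<close> becomes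
  \<open>a * (1 + 1 / x) \<le> b * (1 + 1 / \<gamma>)\<close> for every positive real
  \<open>\<gamma>\<close> below the exponent of order \<open>k + 1\<close>. The rest is the passage
  from such \<open>\<gamma>\<close> to a possibly infinite exponent.\<close>

lemma Omega_exponent_transference:
  fixes \<Lambda> :: "(real ^ 'n::{finite,linorder}) set"
  assumes \<Lambda>: "full_rank_lattice \<Lambda>" "covolume \<Lambda> = 1" and k: "1 \<le> k" "k + 1 < CARD('n)"
    and pos: "0 < Omega_exponent k \<Lambda>" "0 < Omega_exponent (k + 1) \<Lambda>"
  defines "d \<equiv> real CARD('n)"
  shows "ereal (real k / (d - real k)) * (1 + inverse (Omega_exponent k \<Lambda>)) \<le>
    ereal (real (k + 1) / (d - real (k + 1))) * (1 + inverse (Omega_exponent (k + 1) \<Lambda>))"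
proof -
  let ?x = "Omega_exponent k \<Lambda>" and ?y = "Omega_exponent (k + 1) \<Lambda>"
  define a where "a = real k / (d - real k)"
  define b where "b = real (k + 1) / (d - real (k + 1))"
  have dk: "d - real k > 1" using k by (simp add: d_def)
  have a: "a > 0" and ab: "a < b"
  proof -
    show "a > 0" using k dk by (simp add: a_def)
    show "a < b" unfolding a_def b_def using k dk by (intro frac_less2) auto
  qed
  have y_inv: "0 \<le> inverse ?y" using pos(2) by (cases ?y) auto
  show ?thesis
  proof (cases "?x = \<infinity>")
    \<comment> \<open>The inverse of an infinite exponent is 0, and \<open>a < b\<close> already
      suffices.\<close>
    case True
    have "ereal a * (1 + inverse ?x) = ereal a * 1" using True by simp
    also have "\<dots> \<le> ereal b * (1 + inverse ?y)"
      using a ab y_inv by (intro ereal_mult_mono) (auto intro: add_increasing2)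
    finally show ?thesis by (simp add: a_def b_def)
  next
    case False
    then obtain x where x: "?x = ereal x" "x > 0" using pos by (cases ?x) auto
    \<comment> \<open>Chosen so that \<open>b * (1 + s) = a * (1 + 1 / x)\<close>; the claim reduces
      to \<open>s\<close> being at most the inverse of \<open>?y\<close>.\<close>
    define s where "s = a * (1 + 1 / x) / b - 1"
    have key: "s \<le> 1 / \<gamma>" if \<gamma>: "0 < \<gamma>" "ereal \<gamma> < ?y" for \<gamma>
    proof -
      define q where "q = (d - real k) * (real k + 1) / \<gamma> + d"
      define N where "N = real k * (d - real k - 1)"
      have "(d - real k) * (real k + 1) / \<gamma> \<ge> 0" using dk \<gamma> by simp
      then have q: "q > 0" using dk by (simp add: q_def)
      have N: "N > 0" using k dk by (simp add: N_def)
      have "N / q \<le> x"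
        using Omega_exponent_pred[OF \<Lambda> k \<gamma>] x by (simp add: d_def q_def N_def)
      then have "1 / x \<le> q / N" using N q x(2) by (simp add: field_simps)
      then have "a * (1 + 1 / x) \<le> a * (1 + q / N)" using a by (intro mult_left_mono) auto
      also have "\<dots> = b * (1 + 1 / \<gamma>)"
      proof -
        define E where "E = (d - real k) * (real k + 1)"
        \<comment> \<open>This identity joins the 1 and \<open>q / N\<close> into one multiple of
          \<open>1 + 1 / \<gamma>\<close>.\<close>
        have "N + d = E" by (simp add: N_def E_def algebra_simps)
        moreover have "q = E / \<gamma> + d" by (simp only: q_def E_def)
        moreover have "E * (1 + 1 / \<gamma>) = E + E / \<gamma>" by (simp add: distrib_left)
        ultimately have "N + q = E * (1 + 1 / \<gamma>)" by linarith
        then have "1 + q / N = E * (1 + 1 / \<gamma>) / N" using N by (metis add_divide_distrib divide_self less_irrefl)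
        then have "a * (1 + q / N) = a * E / N * (1 + 1 / \<gamma>)" by simp
        moreover have "a * E = real k * (real k + 1)" using dk by (simp add: a_def E_def)
        moreover have "real k * (real k + 1) / N = b"
        proof -
          have "b = (real k + 1) / (d - real k - 1)" by (simp add: b_def algebra_simps)
          moreover have "real k \<noteq> 0" using k by simp
          ultimately show ?thesis unfolding N_def by (metis mult_divide_mult_cancel_left)
        qed
        ultimately show ?thesis by simp
      qed
      finally have "a * (1 + 1 / x) / b \<le> 1 + 1 / \<gamma>"
        using a ab by (simp only: pos_divide_le_eq mult.commute[of b])
      then show ?thesis by (simp add: s_def)
    qed
    have "ereal s \<le> inverse ?y"
    proof (cases "s \<le> 0")
      case True
      then have "ereal s \<le> 0" by simp
      then show ?thesis using y_inv by (rule order_trans)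
    next
      case False
      \<comment> \<open>A positive \<open>s\<close> excludes an infinite \<open>?y\<close>, so the
        inverse can be computed in the reals.\<close>
      have "?y \<le> ereal (1 / s)"
      proof (rule ereal_le_by_pos_reals)
        fix \<gamma> assume "0 < \<gamma>" "ereal \<gamma> < ?y"
        then have "s \<le> 1 / \<gamma>" by (rule key)
        then show "ereal \<gamma> \<le> ereal (1 / s)" using \<open>0 < \<gamma>\<close> False by (simp add: field_simps)
      qed (use False in simp)
      then obtain y where y: "?y = ereal y" "y > 0" using pos by (cases ?y) auto
      then have "y \<le> 1 / s" using \<open>?y \<le> ereal (1 / s)\<close> by simp
      then have "s \<le> 1 / y" using y False by (simp add: field_simps)
      then show ?thesis using y by (simp add: inverse_eq_divide)
    qed
    then have "ereal b * (1 + ereal s) \<le> ereal b * (1 + inverse ?y)"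
      using a ab by (intro ereal_mult_left_mono add_left_mono) auto
    moreover have "ereal b * (1 + ereal s) = ereal a * (1 + inverse ?x)"
      using a ab x by (simp add: s_def inverse_eq_divide)
    ultimately show ?thesis by (simp add: a_def b_def)
  qed
qed

theorem theorem7:
  fixes \<Lambda> :: "(real ^ 'n::{finite,linorder}) set"
  assumes "CARD('n) \<ge> 2"
    and "full_rank_lattice \<Lambda>"
    and "covolume \<Lambda> = 1"
  shows "((\<exists>k\<in>{1..CARD('n) - 1}.
             Omega_exponent k \<Lambda> = 0 \<or> Omega_exponent k (dual_lattice \<Lambda>) = 0) \<longrightarrow>
          (\<forall>k\<in>{1..CARD('n) - 1}.
             Omega_exponent k \<Lambda> = 0 \<and> Omega_exponent k (dual_lattice \<Lambda>) = 0)) \<and>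
         ((\<forall>k\<in>{1..CARD('n) - 1}.
             Omega_exponent k \<Lambda> \<noteq> 0 \<and> Omega_exponent k (dual_lattice \<Lambda>) \<noteq> 0) \<longrightarrow>
          (\<forall>k\<in>{1..<CARD('n) - 1}.
             ereal (real k / (real CARD('n) - real k))
               * (1 + inverse (Omega_exponent k \<Lambda>)) \<le>
             ereal (real (k + 1) / (real CARD('n) - real (k + 1)))
               * (1 + inverse (Omega_exponent (k + 1) \<Lambda>))) \<and>
          Omega_exponent (CARD('n) - 1) \<Lambda> = Omega_exponent 1 (dual_lattice \<Lambda>))"
proof -
  note d = assms(1) and \<Lambda> = assms(2,3)
  obtain A where A: "lattice_basis A \<Lambda>" using \<Lambda>(1) by (auto simp: full_rank_lattice_def)
  obtain B where B: "lattice_basis B (dual_lattice \<Lambda>)" "det B * det A = 1"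
    using dual_lattice_basis[OF A] by blast
  have "\<bar>det A\<bar> = 1" using covolume_eq[OF A] \<Lambda>(2) by simp
  moreover have "\<bar>det B\<bar> * \<bar>det A\<bar> = 1" using B(2) by (metis abs_mult abs_one)
  ultimately have "\<bar>det B\<bar> = 1" by simp
  then have \<Lambda>': "full_rank_lattice (dual_lattice \<Lambda>)" "covolume (dual_lattice \<Lambda>) = 1"
    using B(1) covolume_eq[OF B(1)] by (auto simp: full_rank_lattice_def)
  have dual: "Omega_exponent (CARD('n) - 1) \<Lambda> = Omega_exponent 1 (dual_lattice \<Lambda>)"
    by (rule Omega_exponent_dual[OF \<Lambda> \<Lambda>' d])
  \<comment> \<open>Stated for any lattice \<open>L\<close> of covolume 1, since it is applied to
    \<open>\<Lambda>\<close> and to its dual. By nonnegativity, being zero means not being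
    positive.\<close>
  have zero_iff: "Omega_exponent k L = 0 \<longleftrightarrow> Omega_exponent 1 L = 0"
    if "k \<in> {1..CARD('n) - 1}" "full_rank_lattice L" "covolume L = 1" for k and L :: "(real, 'n) vec set"
  proof -
    have k: "1 \<le> k" "k < CARD('n)" using that(1) d by auto
    show ?thesis
      using Omega_exponent_all_pos_iff[OF that(2,3) k] Omega_exponent_nonneg[OF that(2,3) k]
        Omega_exponent_nonneg[OF that(2,3), of 1] d by (metis order.irrefl order.strict_iff_order k(2) less_le_trans one_less_numeral_iff order.refl semiring_norm(76))
  qed
  have last: "CARD('n) - 1 \<in> {1..CARD('n) - 1}" using d by simp
  \<comment> \<open>The equality at order \<open>d - 1\<close> is the bridge between the exponents
    of the two lattices.\<close>
  have link: "Omega_exponent 1 \<Lambda> = 0 \<longleftrightarrow> Omega_exponent 1 (dual_lattice \<Lambda>) = 0"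
    using zero_iff[OF last \<Lambda>] dual by simp
  have zero: "Omega_exponent k \<Lambda> = 0 \<longleftrightarrow> Omega_exponent 1 \<Lambda> = 0"
    "Omega_exponent k (dual_lattice \<Lambda>) = 0 \<longleftrightarrow> Omega_exponent 1 \<Lambda> = 0"
    if "k \<in> {1..CARD('n) - 1}" for k
    using zero_iff[OF that \<Lambda>] zero_iff[OF that \<Lambda>'] link by simp_all
  show ?thesis
  proof (intro conjI impI ballI)
    fix k assume "\<exists>k\<in>{1..CARD('n) - 1}.
      Omega_exponent k \<Lambda> = 0 \<or> Omega_exponent k (dual_lattice \<Lambda>) = 0" and k: "k \<in> {1..CARD('n) - 1}"
    then have "Omega_exponent 1 \<Lambda> = 0" using zero by blast
    then show "Omega_exponent k \<Lambda> = 0" "Omega_exponent k (dual_lattice \<Lambda>) = 0" using zero[OF k] by auto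
  next
    fix k assume nz: "\<forall>k\<in>{1..CARD('n) - 1}.
      Omega_exponent k \<Lambda> \<noteq> 0 \<and> Omega_exponent k (dual_lattice \<Lambda>) \<noteq> 0" and k: "k \<in> {1..<CARD('n) - 1}"
    have pos: "0 < Omega_exponent j \<Lambda>" if "j \<in> {1..CARD('n) - 1}" for j
    proof -
      have "0 \<le> Omega_exponent j \<Lambda>" using that d by (intro Omega_exponent_nonneg[OF \<Lambda>]) auto
      then show ?thesis using bspec[OF nz that] by (simp add: order.strict_iff_order)
    qed
    show "ereal (real k / (real CARD('n) - real k)) * (1 + inverse (Omega_exponent k \<Lambda>)) \<le>
       ereal (real (k + 1) / (real CARD('n) - real (k + 1))) * (1 + inverse (Omega_exponent (k + 1) \<Lambda>))"
      using k by (intro Omega_exponent_transference[OF \<Lambda>] pos) auto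
  qed (rule dual)
qed

end
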